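(* Fix $\delta>0$ and let $u^\dagger$ be a sample from the Gaussian process $\mathcal N(0,(-\Delta)^{-s})$ on $\mathbb T^d$. Define $$s^{\mathrm{EB}}(q)=\operatorname*{argmin}_{t\in[d/2+\delta,1/\delta]}\Big(\|u(\cdot,t,q)\|_t^2+\log\det K(t,q)\Big),\qquad s^{\mathrm{KF}}(q)=\operatorname*{argmin}_{t\in[d/2+\delta,1/\delta]}\frac{\|u(\cdot,t,q)-u(\cdot,t,q-1)\|_t^2}{\|u(\cdot,t,q)\|_t^2}.$$ (i) If $s\in[d/2+\delta,1/\delta]$, then $s^{\mathrm{EB}}(q)\to s$ in probability as $q\to\infty$. (ii) If $\frac{s-d/2}{2}\in[d/2+\delta,1/\delta]$, then $s^{\mathrm{KF}}(q)\to\frac{s-d/2}{2}$ in probability as $q\to\infty$. Here the probability is with respect to the random draw of $u^\dagger$.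
   Context: Let $d\ge1$ and $\mathbb T^d=[0,1]^d$ with periodic identification. For $m\in\mathbb Z^d$ let $\phi_m(x)=e^{2\pi i\langle m,x\rangle}$; for a mean-zero function $v$ on $\mathbb T^d$ write $\hat v(m)=\int_{\mathbb T^d}v\,\overline{\phi_m}$ (so $\hat v(0)=0$) and, for $t>0$, $\|v\|_t^2=\sum_{m\in\mathbb Z^d}(4\pi^2|m|^2)^t|\hat v(m)|^2$. For $t>d/2$ let $K_t(x,y)=\sum_{m\in\mathbb Z^d\setminus\{0\}}(4\pi^2|m|^2)^{-t}\phi_m(x)\overline{\phi_m(y)}$ (the kernel of $(-\Delta)^{-t}$ on mean-zero periodic functions; its RKHS is $\{v:\|v\|_t<\infty\}$ with norm $\|\cdot\|_t$). For $q\in\mathbb N$ let $J_q=\{0,1,\dots,2^q-1\}^d$, $x_j=j2^{-q}$ for $j\in J_q$, and $\mathcal X_q=\{x_j:j\in J_q\}$ (so $\mathcal X_{q-1}\subset\mathcal X_q$). $K(t,q)$ is the $2^{qd}\times2^{qd}$ Gram matrix $(K_t(x_i,x_j))_{i,j\in J_q}$. Given $u^\dagger$, $u(\cdot,t,q)=K_t(\cdot,\mathcal X_q)K(t,q)^{-1}u^\dagger(\mathcal X_q)$ is the Gaussian process regression (kernel interpolation) estimate, equivalently the element of minimal $\|\cdot\|_t$ norm interpolating $u^\dagger$ on $\mathcal X_q$. The Gaussian process $\mathcal N(0,(-\Delta)^{-s})$, $s>d/2$, is the random field $u^\dagger=\sum_{m\ne0}(4\pi^2|m|^2)^{-s/2}\xi_m\phi_m$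 with $\xi_m$ i.i.d. standard normal; following the paper, its Fourier coefficients $\hat u(m)$, $m\neq0$, are independent centred Gaussians with variance $(4\pi^2)^{-s}|m|^{-2s}$. *)

theory Defs
  imports "HOL-Probability.Probability" "Jordan_Normal_Form.Determinant"
    "Jordan_Normal_Form.Gauss_Jordan_Elimination"
begin

text \<open>The torus dimension d is CARD('d) for a finite index type 'd.
  Points of the torus are x :: 'd \<Rightarrow> real (representatives in [0,1]^d),
  frequencies are m :: 'd \<Rightarrow> int.\<close>

definition ip :: "('d::finite \<Rightarrow> int) \<Rightarrow> ('d \<Rightarrow> real) \<Rightarrow> real" where
  "ip m x = (\<Sum>i\<in>UNIV. real_of_int (m i) * x i)"

definition sqn :: "('d::finite \<Rightarrow> int) \<Rightarrow> real" where
  "sqn m = (\<Sum>i\<in>UNIV. (real_of_int (m i))\<^sup>2)"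

definition phi :: "('d::finite \<Rightarrow> int) \<Rightarrow> ('d \<Rightarrow> real) \<Rightarrow> complex" where
  "phi m x = exp (complex_of_real (2 * pi * ip m x) * \<i>)"

definition lam :: "real \<Rightarrow> ('d::finite \<Rightarrow> int) \<Rightarrow> real" where
  "lam t m = (4 * pi\<^sup>2 * sqn m) powr (- t)"

definition torus :: "('d::finite \<Rightarrow> real) set" where
  "torus = Pi\<^sub>E UNIV (\<lambda>_. {0..1})"

definition leb :: "('d::finite \<Rightarrow> real) measure" where
  "leb = PiM UNIV (\<lambda>_. lborel)"

definition fcoef :: "(('d::finite \<Rightarrow> real) \<Rightarrow> complex) \<Rightarrow> ('d \<Rightarrow> int) \<Rightarrow> complex" where
  "fcoef v m = (\<integral>x. indicator torus x *\<^sub>R (v x * cnj (phi m x)) \<partial>leb)"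

text \<open>Squared Sobolev / RKHS norm: sum over m of (4 pi^2 |m|^2)^t |hat v(m)|^2.
  (The m = 0 term is excluded; it vanishes for mean-zero v.)\<close>
definition hnorm2 :: "real \<Rightarrow> (('d::finite \<Rightarrow> real) \<Rightarrow> complex) \<Rightarrow> real" where
  "hnorm2 t v = (\<Sum>\<^sub>\<infinity>m\<in>UNIV - {\<lambda>_. 0}. (4 * pi\<^sup>2 * sqn m) powr t * (cmod (fcoef v m))\<^sup>2)"

definition Kt :: "real \<Rightarrow> ('d::finite \<Rightarrow> real) \<Rightarrow> ('d \<Rightarrow> real) \<Rightarrow> complex" where
  "Kt t x y = (\<Sum>\<^sub>\<infinity>m\<in>UNIV - {\<lambda>_. 0}. complex_of_real (lam t m) * phi m x * cnj (phi m y))"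

definition Jq :: "nat \<Rightarrow> ('d::finite \<Rightarrow> int) set" where
  "Jq q = {j. \<forall>i. 0 \<le> j i \<and> j i < 2 ^ q}"

definition gpt :: "nat \<Rightarrow> ('d::finite \<Rightarrow> int) \<Rightarrow> ('d \<Rightarrow> real)" where
  "gpt q j = (\<lambda>i. real_of_int (j i) / 2 ^ q)"

text \<open>A fixed enumeration of J_q (the quantities below do not depend on its choice).\<close>
definition enumJ :: "nat \<Rightarrow> nat \<Rightarrow> ('d::finite \<Rightarrow> int)" where
  "enumJ q = (SOME f. bij_betw f {..<card (Jq q :: ('d \<Rightarrow> int) set)} (Jq q))"

definition npts :: "nat \<Rightarrow> 'd::finite itself \<Rightarrow> nat" where
  "npts q _ = card (Jq q :: ('d \<Rightarrow> int) set)"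

definition gram :: "real \<Rightarrow> nat \<Rightarrow> 'd::finite itself \<Rightarrow> complex mat" where
  "gram t q D = mat (npts q D) (npts q D)
      (\<lambda>(a, b). Kt t (gpt q (enumJ q a :: 'd \<Rightarrow> int)) (gpt q (enumJ q b :: 'd \<Rightarrow> int)))"

definition interp :: "real \<Rightarrow> nat \<Rightarrow> (('d::finite \<Rightarrow> real) \<Rightarrow> complex) \<Rightarrow> ('d \<Rightarrow> real) \<Rightarrow> complex" where
  "interp t q f y =
     (let D = TYPE('d); N = npts q D;
          c = the (mat_inverse (gram t q D)) *\<^sub>v vec N (\<lambda>a. f (gpt q (enumJ q a :: 'd \<Rightarrow> int)))
      in \<Sum>a<N. Kt t y (gpt q (enumJ q a :: 'd \<Rightarrow> int)) * c $ a)"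

text \<open>Empirical Bayes objective ||u(.,t,q)||_t^2 + log det K(t,q)
  (K(t,q) is Hermitian positive definite, so its determinant is real positive).\<close>
definition EB_obj :: "(('d::finite \<Rightarrow> real) \<Rightarrow> complex) \<Rightarrow> nat \<Rightarrow> real \<Rightarrow> real" where
  "EB_obj f q t = hnorm2 t (interp t q f) + ln (Re (det (gram t q TYPE('d))))"

definition KF_obj :: "(('d::finite \<Rightarrow> real) \<Rightarrow> complex) \<Rightarrow> nat \<Rightarrow> real \<Rightarrow> real" where
  "KF_obj f q t = hnorm2 t (\<lambda>y. interp t q f y - interp t (q - 1) f y) / hnorm2 t (interp t q f)"

definition argmin_set :: "(real \<Rightarrow> real) \<Rightarrow> real set \<Rightarrow> real set" where
  "argmin_set g I = {t \<in> I. \<forall>t'\<in>I. g t \<le> g t'}"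

text \<open>The sample u^dagger = sum_{m ~= 0} (4 pi^2|m|^2)^(-s/2) xi_m phi_m, evaluated pointwise as
  the limit of the partial sums over the cubes |m_i| <= R.\<close>
definition ufield :: "real \<Rightarrow> (('d::finite \<Rightarrow> int) \<Rightarrow> real) \<Rightarrow> ('d \<Rightarrow> real) \<Rightarrow> complex" where
  "ufield s xi x = lim (\<lambda>R::nat. \<Sum>m\<in>{m. m \<noteq> (\<lambda>_. 0) \<and> (\<forall>i. \<bar>m i\<bar> \<le> int R)}.
      complex_of_real ((4 * pi\<^sup>2 * sqn m) powr (- s / 2) * xi m) * phi m x)"

text \<open>Convergence in (outer) probability of a sequence of (possibly non-unique) minimisers:
  for every eps > 0, the event that some minimiser is eps-far from the target is contained
  in events of probability tending to 0.\<close>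
definition argmin_conv_prob :: "'w measure \<Rightarrow> (nat \<Rightarrow> 'w \<Rightarrow> real set) \<Rightarrow> real \<Rightarrow> bool" where
  "argmin_conv_prob M S s0 \<longleftrightarrow>
     (\<forall>\<epsilon>>0. \<forall>\<eta>>0. \<forall>\<^sub>F q in sequentially. \<exists>A\<in>sets M.
        {\<omega>\<in>space M. \<exists>t\<in>S q \<omega>. \<bar>t - s0\<bar> > \<epsilon>} \<subseteq> A \<and> measure M A < \<eta>)"

end

theory Submission
  imports Defs "HOL-Real_Asymp.Real_Asymp"
begin

text \<open>On the grid of mesh 1/N, N = 2^q, frequencies alias modulo N. The characters of the grid diagonalise
  the Gram matrix, with eigenvalues N^d G(t,r), where G(t,r) is the sum of (4 pi^2 |m|^2)^(-t) over the nonzero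
  frequencies m congruent to r. For the Gaussian sample the grid coefficient at r is sqrt(G(s,r)) Z(r) with
  independent standard normal Z(r), so

  \<^item> the empirical Bayes objective is, up to a constant, the sum over r of G(s,r)/G(t,r) Z(r)^2 + ln G(t,r);
  \<^item> the Kernel Flow numerator is the sum, over the classes modulo N/2, of the G-weighted variance of
    sqrt(G(s,r)) Z(r)/G(t,r) over the classes r modulo N above it.

  Writing w(r) for 4 pi^2 |m|^2 at a shortest frequency m of the class r, one has w^(-t) <= G(t,r) <= C w^(-t)
  uniformly in t, r and q.

  For t < s the logarithmic term of the first objective exceeds its value at s by order N^d log N, for t > s the
  quadratic term exceeds it by order N^(d + 2(t-s)). For the second objective put t* = (s - d/2)/2. Aliasing of
  the low frequencies contributes N^(-2t) to the numerator and the high frequencies contribute N^(d + 2t - 2s);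
  the two exponents agree exactly at t*, where the ratio is N^(-2 t*) up to logarithms, and away from t* it is
  polynomially larger. These gaps are wide enough for Markov and Chebyshev bounds, and all estimates are uniform
  in t because the random quantities enter through sums that do not involve t.\<close>

section \<open>Lattice sums\<close>

text \<open>Neither continuity of the objectives in t nor existence or measurability of minimisers
  enters. The target lies in the search interval, so every minimiser does at least as well as the
  target, and away from the target the objective is shown to be larger than its value there, on an
  event that does not depend on t. What shapes the probabilistic side is that the series of the
  sample need not converge absolutely when s is close to d/2; only its squared coefficients are
  summable. Convergence is therefore proved almost surely, by a maximal inequality, and separately
  in each residue class. There are countably many pairs (q, r), so one null set serves for all
  grids. What shapes the Kernel Flow estimate is that at the target the weights w^(2t-s) of the
  squared normalised coefficients have the exponent -d/2, the border of summability. A small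
  exponent \<gamma> absorbs the resulting growth together with all constants and random
  fluctuations.\<close>

definition freq_cube :: "nat \<Rightarrow> ('d::finite \<Rightarrow> int) set" where
  "freq_cube R = {m. m \<noteq> (\<lambda>_. 0) \<and> (\<forall>i. \<bar>m i\<bar> \<le> int R)}"

lemma freq_cube_subset_PiE: "freq_cube R \<subseteq> Pi\<^sub>E UNIV (\<lambda>_. {- int R..int R})"
  by (auto simp: freq_cube_def abs_le_iff minus_le_iff)

lemma finite_freq_cube [simp, intro]: "finite (freq_cube R)"
  using freq_cube_subset_PiE by (rule finite_subset) (intro finite_PiE, auto)

lemma freq_cube_mono: "R \<le> R' \<Longrightarrow> freq_cube R \<subseteq> freq_cube R'"
  by (auto simp: freq_cube_def intro: order_trans[of _ "int R"])

lemma finite_subset_freq_cube: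
  fixes F :: "('d::finite \<Rightarrow> int) set"
  assumes "finite F" "F \<subseteq> UNIV - {\<lambda>_. 0}"
  obtains R where "F \<subseteq> freq_cube R"
proof
  let ?B = "insert 0 ((\<lambda>(m, i). nat \<bar>m i\<bar>) ` (F \<times> UNIV))"
  have fin: "finite ?B" using assms by auto
  have "\<bar>m i\<bar> \<le> int (Max ?B)" if "m \<in> F" for m i
  proof -
    have "nat \<bar>m i\<bar> \<le> Max ?B"
      using fin that by (intro Max_ge) auto
    then show ?thesis by linarith
  qed
  then show "F \<subseteq> freq_cube (Max ?B)"
    using assms(2) by (auto simp: freq_cube_def)
qed

text \<open>The cubes eventually contain any given finite set of nonzero frequencies, so they are
  cofinal among the finite subsets and an unordered sum can be read off along them. This links
  \<open>has_sum\<close> to the cube-wise limit by which \<open>ufield\<close> is defined.\<close>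

lemma has_sum_imp_freq_cube_tendsto:
  fixes f :: "('d::finite \<Rightarrow> int) \<Rightarrow> 'b::{comm_monoid_add,topological_space}"
  assumes "(f has_sum l) A" "A \<subseteq> UNIV - {\<lambda>_. 0}"
  shows "(\<lambda>R. \<Sum>m\<in>freq_cube R \<inter> A. f m) \<longlonglongrightarrow> l"
proof -
  have "filterlim (\<lambda>R. freq_cube R \<inter> A) (finite_subsets_at_top A) sequentially"
    unfolding filterlim_finite_subsets_at_top
  proof safe
    fix F assume F: "finite F" "F \<subseteq> A"
    then obtain R0 where "F \<subseteq> freq_cube R0"
      using finite_subset_freq_cube[of F] assms(2) by blast
    then have "F \<subseteq> freq_cube R" if "R \<ge> R0" for R
      using freq_cube_mono[OF that] by blast
    with F show "\<forall>\<^sub>F R in sequentially. finite (freq_cube R \<inter> A) \<and> F \<subseteq> freq_cube R \<inter> A \<and> freq_cube R \<inter> A \<subseteq> A"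
      by (auto intro!: eventually_sequentiallyI[of R0])
  qed
  with assms(1) show ?thesis
    unfolding has_sum_def by (rule filterlim_compose)
qed

lemma sqn_nonneg [simp]: "0 \<le> sqn m"
  by (simp add: sqn_def sum_nonneg)

lemma sqn_ge_coord: "(real_of_int (m i))\<^sup>2 \<le> sqn m"
  unfolding sqn_def by (rule member_le_sum) auto

lemma sqn_ge_1:
  assumes "m \<noteq> (\<lambda>_. 0)" shows "1 \<le> sqn m"
proof -
  obtain i where "m i \<noteq> 0" using assms by auto
  then have "1 \<le> \<bar>m i\<bar>" by linarith
  then have "1 \<le> \<bar>real_of_int (m i)\<bar>" by linarith
  then have "1 \<le> (real_of_int (m i))\<^sup>2" by (simp add: abs_le_square_iff[of 1, simplified])
  also have "\<dots> \<le> sqn m" by (rule sqn_ge_coord)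
  finally show ?thesis .
qed

lemma pi_sq_ge: "4 \<le> pi\<^sup>2"
  using power_mono[OF pi_ge_two, of 2] by simp

lemma freq_sq_ge_1: "m \<noteq> (\<lambda>_. 0) \<Longrightarrow> 1 \<le> 4 * pi\<^sup>2 * sqn m"
  using mult_mono[of 1 "4 * pi\<^sup>2" 1 "sqn m"] sqn_ge_1[of m] pi_sq_ge by simp

lemma lam_nonneg [simp]: "0 \<le> lam t m"
  by (simp add: lam_def)

lemma lam_antimono: "m \<noteq> (\<lambda>_. 0) \<Longrightarrow> t \<le> t' \<Longrightarrow> lam t' m \<le> lam t m"
  using freq_sq_ge_1[of m] by (auto simp: lam_def intro!: powr_mono)

text \<open>A convergent p-series bounds each half-line; counting k = 0 in both of them only
  enlarges the bound. This is the one-dimensional factor of the lattice sum.\<close>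

lemma sum_int_interval_powr_bounded:
  assumes "p > 1"
  obtains B where "\<And>R::nat. (\<Sum>k\<in>{-int R..int R}. (1 + real_of_int \<bar>k\<bar>) powr (-p)) \<le> B" "B \<ge> 0"
proof -
  define h :: "int \<Rightarrow> real" where "h k = (1 + real_of_int \<bar>k\<bar>) powr (-p)" for k
  have "summable (\<lambda>n. real n powr (-p))" using assms by (simp add: summable_real_powr_iff)
  then have "summable (\<lambda>n. real (Suc n) powr (-p))" by (subst summable_Suc_iff)
  then have s: "summable (\<lambda>n. h (int n))" by (simp add: h_def add_ac)
  have "sum h {-int R..int R} \<le> 2 * suminf (\<lambda>n. h (int n))" for R
  proof -
    let ?A = "int ` {..R}" and ?B = "(\<lambda>n. - int n) ` {..R}"
    have "{-int R..int R} \<subseteq> ?A \<union> ?B"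
    proof
      fix k assume "k \<in> {-int R..int R}"
      then show "k \<in> ?A \<union> ?B"
        by (cases "k \<ge> 0") (auto intro!: image_eqI[of _ _ "nat \<bar>k\<bar>"])
    qed
    then have "sum h {-int R..int R} \<le> sum h (?A \<union> ?B)"
      by (intro sum_mono2) (auto simp: h_def)
    also have "\<dots> \<le> sum h ?A + sum h ?B"
      using sum.union_inter[of ?A ?B h] sum_nonneg[of "?A \<inter> ?B" h] by (auto simp: h_def)
    also have "sum h ?A = (\<Sum>n\<le>R. h (int n))"
      by (subst sum.reindex) auto
    also have "sum h ?B = (\<Sum>n\<le>R. h (int n))"
      by (subst sum.reindex) (auto simp: inj_on_def h_def)
    also have "(\<Sum>n\<le>R. h (int n)) \<le> suminf (\<lambda>n. h (int n))"
      by (rule sum_le_suminf[OF s]) (auto simp: h_def)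
    finally show ?thesis by simp
  qed
  moreover have "2 * suminf (\<lambda>n. h (int n)) \<ge> 0"
    using suminf_nonneg[OF s] by (auto simp: h_def)
  ultimately show ?thesis
    using that unfolding h_def by blast
qed

text \<open>A single coordinate never exceeds |m|, so the radial weight |m|^(-2t) can be shared
  equally among the d coordinates. Each factor receives the exponent 2t/d, which exceeds 1 exactly
  when t > d/2.\<close>

lemma lam_le_prod:
  fixes m :: "'d::finite \<Rightarrow> int"
  assumes "m \<noteq> (\<lambda>_. 0)" "t \<ge> 0"
  shows "lam t m \<le> (\<Prod>i\<in>UNIV. (1 + real_of_int \<bar>m i\<bar>) powr (- (2 * t / CARD('d))))"
proof -
  let ?d = "real CARD('d)"
  have d: "?d > 0" by simp
  have s1: "sqrt (sqn m) \<ge> 1" using sqn_ge_1[OF assms(1)] by simp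
  \<comment> \<open>Since m is nonzero, \<open>sqrt (sqn m)\<close> is at least 1 and can absorb the
    added 1; the resulting factor 2 is paid for by the 4 pi^2 in \<open>lam\<close>.\<close>
  have le: "1 + real_of_int \<bar>m i\<bar> \<le> 2 * sqrt (sqn m)" for i
  proof -
    have "real_of_int \<bar>m i\<bar> = sqrt ((real_of_int (m i))\<^sup>2)" by simp
    also have "\<dots> \<le> sqrt (sqn m)" using sqn_ge_coord by (rule real_sqrt_le_mono)
    finally show ?thesis using s1 by linarith
  qed
  have "lam t m \<le> (4 * sqn m) powr (-t)"
    unfolding lam_def using assms sqn_ge_1[OF assms(1)] pi_sq_ge
    by (intro powr_mono2') (auto intro!: mult_right_mono)
  also have "\<dots> = (2 * sqrt (sqn m)) powr (- (2 * t / ?d) * ?d)"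
  proof -
    have "4 * sqn m = (2 * sqrt (sqn m)) powr 2"
      using s1 sqn_nonneg[of m] by (simp add: power_mult_distrib)
    then have "(4 * sqn m) powr (-t) = (2 * sqrt (sqn m)) powr (2 * (-t))"
      by (simp only: powr_powr)
    then show ?thesis using d by simp
  qed
  also have "\<dots> = (\<Prod>i\<in>(UNIV::'d set). (2 * sqrt (sqn m)) powr (- (2 * t / ?d)))"
    using s1 by (simp only: powr_powr[symmetric] prod_constant) (simp add: powr_realpow)
  also have "\<dots> \<le> (\<Prod>i\<in>(UNIV::'d set). (1 + real_of_int \<bar>m i\<bar>) powr (- (2 * t / ?d)))"
    using le assms(2) d by (intro prod_mono) (auto intro!: powr_mono2' add_pos_nonneg)
  finally show ?thesis .
qed

lemma lam_summable:
  assumes t: "t > real CARD('d::finite) / 2"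
  shows "(lam t :: ('d \<Rightarrow> int) \<Rightarrow> real) summable_on UNIV - {\<lambda>_. 0}"
proof -
  let ?d = "real CARD('d)"
  define p where "p = 2 * t / ?d"
  have p: "p > 1" using t by (simp add: p_def field_simps)
  obtain B where B: "\<And>R::nat. (\<Sum>k\<in>{-int R..int R}. (1 + real_of_int \<bar>k\<bar>) powr (-p)) \<le> B" "B \<ge> 0"
    using sum_int_interval_powr_bounded[OF p] by blast
  have "sum (lam t) F \<le> B ^ CARD('d)" if F: "F \<subseteq> UNIV - {\<lambda>_. 0}" "finite F" for F :: "('d \<Rightarrow> int) set"
  proof -
    obtain R where R: "F \<subseteq> freq_cube R" using finite_subset_freq_cube[OF F(2,1)] .
    have "sum (lam t) F \<le> (\<Sum>m\<in>F. \<Prod>i\<in>UNIV. (1 + real_of_int \<bar>m i\<bar>) powr (- p))"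
    proof (rule sum_mono)
      fix m assume "m \<in> F"
      then have "m \<noteq> (\<lambda>_. 0)" using F by auto
      moreover have "t \<ge> 0" using t by (meson divide_nonneg_nonneg less_eq_real_def of_nat_0_le_iff order.trans zero_le_numeral)
      ultimately show "lam t m \<le> (\<Prod>i\<in>UNIV. (1 + real_of_int \<bar>m i\<bar>) powr (- p))"
        unfolding p_def by (rule lam_le_prod)
    qed
    \<comment> \<open>Enlarging F to a full box, zero frequency included, turns the sum of products
      into a product of one-dimensional sums.\<close>
    also have "\<dots> \<le> (\<Sum>m\<in>(Pi\<^sub>E UNIV (\<lambda>_. {- int R..int R}) :: ('d \<Rightarrow> int) set). \<Prod>i\<in>UNIV. (1 + real_of_int \<bar>m i\<bar>) powr (- p))"
      by (rule sum_mono2[OF _ order_trans[OF R freq_cube_subset_PiE]])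
        (auto intro!: prod_nonneg finite_PiE)
    also have "\<dots> = (\<Prod>i\<in>(UNIV::'d set). \<Sum>k\<in>{-int R..int R}. (1 + real_of_int \<bar>k\<bar>) powr (-p))"
      by (subst prod_sum_PiE) auto
    also have "\<dots> \<le> (\<Prod>i\<in>(UNIV::'d set). B)"
      by (intro prod_mono conjI B sum_nonneg) auto
    finally show ?thesis by simp
  qed
  then show ?thesis
    by (intro nonneg_bdd_above_summable_on) (auto intro!: bdd_aboveI2[where M = "B ^ CARD('d)"])
qed

section \<open>Residue classes of frequencies\<close>

definition res :: "nat \<Rightarrow> ('d::finite \<Rightarrow> int) \<Rightarrow> ('d \<Rightarrow> int)" where
  "res q m = (\<lambda>i. m i mod 2 ^ q)"

definition cls :: "nat \<Rightarrow> ('d::finite \<Rightarrow> int) \<Rightarrow> ('d \<Rightarrow> int) set" where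
  "cls q r = {m. m \<noteq> (\<lambda>_. 0) \<and> res q m = r}"

definition Gw :: "nat \<Rightarrow> real \<Rightarrow> ('d::finite \<Rightarrow> int) \<Rightarrow> real" where
  "Gw q t r = (\<Sum>\<^sub>\<infinity>m\<in>cls q r. lam t m)"

lemma Jq_eq_PiE: "(Jq q :: ('d::finite \<Rightarrow> int) set) = Pi\<^sub>E UNIV (\<lambda>_. {0..<2 ^ q})"
  by (auto simp: Jq_def)

lemma finite_Jq [simp, intro]: "finite (Jq q :: ('d::finite \<Rightarrow> int) set)"
  unfolding Jq_eq_PiE by (intro finite_PiE) auto

lemma card_Jq: "card (Jq q :: ('d::finite \<Rightarrow> int) set) = (2 ^ q) ^ CARD('d)"
  unfolding Jq_eq_PiE by (subst card_PiE) (auto simp: nat_power_eq)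

lemma res_in_Jq [simp]: "res q m \<in> Jq q"
  by (auto simp: res_def Jq_def)

lemma res_Jq: "r \<in> Jq q \<Longrightarrow> res q r = r"
  by (auto simp: res_def Jq_def)

lemma res_res: "p \<le> q \<Longrightarrow> res p (res q m) = res p m"
  by (auto simp: res_def mod_mod_cancel le_imp_power_dvd)

lemma cls_subset: "cls q r \<subseteq> UNIV - {\<lambda>_. 0}"
  by (auto simp: cls_def)

lemma UN_cls: "(\<Union>r\<in>Jq q. cls q r) = UNIV - {\<lambda>_. 0}"
  by (auto simp: cls_def)

lemma cls_disjoint: "r \<noteq> r' \<Longrightarrow> cls q r \<inter> cls q r' = {}"
  by (auto simp: cls_def)

lemma UN_cls_coarse: "p \<le> q \<Longrightarrow> (\<Union>r\<in>{r\<in>Jq q. res p r = r'}. cls q r) = cls p r'"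
  by (auto simp: cls_def res_res)

lemma infsum_classes:
  fixes f :: "('d::finite \<Rightarrow> int) \<Rightarrow> 'b::banach"
  assumes "f summable_on UNIV - {\<lambda>_. 0}"
  shows "infsum f (UNIV - {\<lambda>_. 0}) = (\<Sum>r\<in>Jq q. infsum f (cls q r))"
  unfolding UN_cls[of q, symmetric]
  by (rule sum_infsum[symmetric])
    (auto simp: cls_disjoint intro: summable_on_subset_banach[OF assms cls_subset])

lemma infsum_classes_coarse:
  fixes f :: "('d::finite \<Rightarrow> int) \<Rightarrow> 'b::banach"
  assumes "f summable_on UNIV - {\<lambda>_. 0}" "p \<le> q"
  shows "infsum f (cls p r') = (\<Sum>r\<in>{r\<in>Jq q. res p r = r'}. infsum f (cls q r))"
  unfolding UN_cls_coarse[OF assms(2), symmetric]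
  by (rule sum_infsum[symmetric])
    (auto simp: cls_disjoint intro: summable_on_subset_banach[OF assms(1) cls_subset])

lemma lam_summable_cls:
  assumes "t > real CARD('d::finite) / 2"
  shows "lam t summable_on cls q (r :: 'd \<Rightarrow> int)"
  using lam_summable[OF assms] cls_subset by (rule summable_on_subset_banach)

lemma Gw_coarse:
  assumes "t > real CARD('d::finite) / 2" "p \<le> q"
  shows "Gw p t (r' :: 'd \<Rightarrow> int) = (\<Sum>r\<in>{r\<in>Jq q. res p r = r'}. Gw q t r)"
  unfolding Gw_def by (rule infsum_classes_coarse[OF lam_summable[OF assms(1)] assms(2)])

section \<open>Centred representatives and two-sided bounds for the eigenvalues\<close>

definition symres :: "nat \<Rightarrow> ('d::finite \<Rightarrow> int) \<Rightarrow> ('d \<Rightarrow> int)" where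
  "symres q r = (\<lambda>i. if 2 * r i < 2 ^ q then r i else r i - 2 ^ q)"

text \<open>The class of 0 has no shortest representative 0, since the zero frequency is excluded; N(1,...,1) is as good
  as a shortest one.\<close>

definition rep :: "nat \<Rightarrow> ('d::finite \<Rightarrow> int) \<Rightarrow> ('d \<Rightarrow> int)" where
  "rep q r = (if r = (\<lambda>_. 0) then (\<lambda>_. 2 ^ q) else symres q r)"

definition ww :: "nat \<Rightarrow> ('d::finite \<Rightarrow> int) \<Rightarrow> real" where
  "ww q r = 4 * pi\<^sup>2 * sqn (rep q r)"

lemma res_symres: "r \<in> Jq q \<Longrightarrow> res q (symres q r) = r"
  by (auto simp: res_def symres_def Jq_def fun_eq_iff)

lemma symres_eq_0_iff:
  assumes "r \<in> Jq q" shows "symres q r = (\<lambda>_. 0) \<longleftrightarrow> r = (\<lambda>_. 0)"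
proof
  assume "symres q r = (\<lambda>_. 0)"
  then have "res q (\<lambda>_. 0) = r" using res_symres[OF assms] by simp
  then show "r = (\<lambda>_. 0)" by (auto simp: res_def)
qed (simp add: symres_def)

lemma abs_symres_le: "r \<in> Jq q \<Longrightarrow> 2 * \<bar>symres q r i\<bar> \<le> 2 ^ q"
proof -
  assume "r \<in> Jq q"
  then have "0 \<le> r i" "r i < 2 ^ q" by (auto simp: Jq_def)
  then show ?thesis unfolding symres_def by auto
qed

lemma rep_in_cls:
  assumes "r \<in> Jq q" shows "rep q r \<in> cls q r"
proof (cases "r = (\<lambda>_. 0)")
  case True
  then show ?thesis by (auto simp: rep_def cls_def res_def fun_eq_iff)
next
  case False
  then show ?thesis using assms by (auto simp: rep_def cls_def res_symres symres_eq_0_iff)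
qed

lemma inj_on_rep: "inj_on (rep q) (Jq q)"
proof (rule inj_onI)
  fix r r' assume "r \<in> Jq q" "r' \<in> Jq q" "rep q r = rep q r'"
  then show "r = r'"
    using rep_in_cls[of r q] rep_in_cls[of r' q] by (auto simp: cls_def)
qed

lemma lam_rep: "lam t (rep q r) = ww q r powr (- t)"
  by (simp add: lam_def ww_def)

lemma ww_ge_1: "r \<in> Jq q \<Longrightarrow> 1 \<le> ww q r"
  unfolding ww_def using rep_in_cls[of r q] by (intro freq_sq_ge_1) (auto simp: cls_def)

lemma abs_rep_le:
  assumes "r \<in> Jq q" shows "\<bar>rep q r i\<bar> \<le> 2 ^ q"
proof (cases "r = (\<lambda>_. 0)")
  case False
  then show ?thesis using abs_symres_le[OF assms, of i] by (simp add: rep_def)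
qed (simp add: rep_def)

lemma ww_le:
  fixes r :: "'d::finite \<Rightarrow> int"
  assumes "r \<in> Jq q"
  shows "ww q r \<le> 4 * pi\<^sup>2 * real CARD('d) * (2 ^ q)\<^sup>2"
proof -
  have "(real_of_int (rep q r i))\<^sup>2 \<le> (2 ^ q)\<^sup>2" for i
  proof -
    have "real_of_int \<bar>rep q r i\<bar> \<le> real_of_int (2 ^ q)"
      using abs_rep_le[OF assms] by (simp only: of_int_le_iff)
    then have "\<bar>real_of_int (rep q r i)\<bar> \<le> \<bar>2 ^ q\<bar>" by simp
    then show ?thesis by (simp only: abs_le_square_iff)
  qed
  then have "sqn (rep q r) \<le> real CARD('d) * (2 ^ q)\<^sup>2"
    unfolding sqn_def by (intro sum_bounded_above) auto
  then show ?thesis unfolding ww_def by (simp add: mult.assoc)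
qed

text \<open>A coordinate between N/8 and 7N/8 stays at distance at least N/8 from every multiple of
  N, so the representative has a coordinate of size at least N/8. With 4 pi^2 \<ge> 16 this gives 16
  N^2/64, the bound N^2/4 used for all high-frequency classes.\<close>

lemma ww_ge_of_coord:
  fixes r :: "'d::finite \<Rightarrow> int"
  assumes "r \<in> Jq q" "2 ^ q \<le> 8 * r i" "8 * r i \<le> 7 * 2 ^ q"
  shows "(2 ^ q)\<^sup>2 / 4 \<le> ww q r"
proof -
  have "r i > 0" using assms(2) zero_less_power[of "2::int" q] by linarith
  then have "rep q r = symres q r" by (auto simp: rep_def)
  then have "2 ^ q \<le> 8 * \<bar>rep q r i\<bar>" using assms by (auto simp: symres_def)
  then have "real_of_int (2 ^ q) \<le> real_of_int (8 * \<bar>rep q r i\<bar>)" by (simp only: of_int_le_iff)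
  then have "\<bar>2 ^ q\<bar> \<le> \<bar>8 * real_of_int (rep q r i)\<bar>" by (simp add: abs_mult)
  then have "(2 ^ q)\<^sup>2 \<le> (8 * real_of_int (rep q r i))\<^sup>2" by (simp only: abs_le_square_iff)
  also have "\<dots> \<le> 64 * sqn (rep q r)" using sqn_ge_coord[of "rep q r" i] by (simp add: power_mult_distrib)
  finally have "(2 ^ q)\<^sup>2 \<le> 64 * sqn (rep q r)" .
  moreover have "4 * 4 * sqn (rep q r) \<le> ww q r"
    unfolding ww_def using pi_sq_ge by (intro mult_right_mono) auto
  ultimately show ?thesis by linarith
qed

text \<open>Distinct classes have distinct nonzero representatives, so the sum is a part of the full
  lattice sum. The point is a bound free of q: expectations of weighted squares stay bounded as the
  grid is refined.\<close>

lemma sum_ww_powr_le: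
  assumes "p > real CARD('d::finite) / 2"
  shows "(\<Sum>r\<in>(Jq q :: ('d \<Rightarrow> int) set). ww q r powr (- p)) \<le> infsum (lam p) (UNIV - {\<lambda>_. 0 :: int} :: ('d \<Rightarrow> int) set)"
proof -
  have "(\<Sum>r\<in>(Jq q :: ('d \<Rightarrow> int) set). ww q r powr (- p)) = (\<Sum>m\<in>rep q ` (Jq q :: ('d \<Rightarrow> int) set). lam p m)"
    by (subst sum.reindex[OF inj_on_rep]) (auto simp: lam_rep)
  also have "\<dots> \<le> infsum (lam p) (UNIV - {\<lambda>_. 0} :: ('d \<Rightarrow> int) set)"
  proof (rule finite_sum_le_infsum[OF lam_summable[OF assms]])
    show "rep q ` Jq q \<subseteq> (UNIV - {\<lambda>_. 0} :: ('d \<Rightarrow> int) set)"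
    proof (rule image_subsetI)
      fix r :: "'d \<Rightarrow> int" assume "r \<in> Jq q"
      from rep_in_cls[OF this] show "rep q r \<in> UNIV - {\<lambda>_. 0}" by (simp add: cls_def)
    qed
  qed auto
  finally show ?thesis .
qed

lemma Gw_ge:
  assumes "t > real CARD('d) / 2" "(r :: 'd::finite \<Rightarrow> int) \<in> Jq q"
  shows "ww q r powr (- t) \<le> Gw q t r"
proof -
  have "(\<Sum>m\<in>{rep q r}. lam t m) \<le> Gw q t r"
    unfolding Gw_def using rep_in_cls[OF assms(2)]
    by (intro finite_sum_le_infsum lam_summable_cls[OF assms(1)]) auto
  then show ?thesis by (simp add: lam_rep)
qed

lemma Gw_pos:
  assumes "t > real CARD('d) / 2" "(r :: 'd::finite \<Rightarrow> int) \<in> Jq q"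
  shows "0 < Gw q t r"
proof -
  have "0 < ww q r powr (- t)" using ww_ge_1[OF assms(2)] by simp
  with Gw_ge[OF assms] show ?thesis by linarith
qed

text \<open>A centred representative has coordinates of size at most N/2, so adding a nonzero
  multiple N k_i leaves at least N |k_i|/2. Hence every other alias has |m|^2 at least N^2 |k|^2/4.
  Bounding the dependence on k by the exponent \<open>a\<close> and the factor 4^t by 4^T makes the
  estimate uniform in t.\<close>

lemma lam_shift_le:
  fixes r k :: "'d::finite \<Rightarrow> int"
  assumes "r \<in> Jq q" "k \<noteq> (\<lambda>_. 0)" "a \<le> t" "t \<le> T" "0 < a"
  shows "lam t (\<lambda>i. symres q r i + 2 ^ q * k i) \<le> 4 powr T * ((2 ^ q)\<^sup>2) powr (- t) * lam a k"
proof -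
  let ?m = "\<lambda>i. symres q r i + 2 ^ q * k i"
  have coord: "(2 ^ q * real_of_int (k i))\<^sup>2 \<le> 4 * (real_of_int (?m i))\<^sup>2" for i
  proof -
    have "2 ^ q * \<bar>k i\<bar> \<le> 2 * \<bar>?m i\<bar>"
    proof (cases "k i = 0")
      case False
      then have "2 ^ q * 1 \<le> 2 ^ q * \<bar>k i\<bar>" by (intro mult_left_mono) auto
      then have 1: "2 * \<bar>symres q r i\<bar> \<le> 2 ^ q * \<bar>k i\<bar>"
        using abs_symres_le[OF assms(1), of i] by linarith
      have 2: "2 ^ q * \<bar>k i\<bar> = \<bar>2 ^ q * k i\<bar>" by (simp add: abs_mult)
      have "P \<le> 2 * \<bar>x + y\<bar>" if "2 * \<bar>x\<bar> \<le> P" "P = \<bar>y\<bar>" for x y P :: int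
        using that abs_triangle_ineq4[of "x + y" x] by simp
      from this[OF 1 2] show ?thesis .
    qed simp
    then have "\<bar>2 ^ q * k i\<bar> \<le> \<bar>2 * ?m i\<bar>" by (simp only: abs_mult abs_numeral power_abs)
    then have "(2 ^ q * k i)\<^sup>2 \<le> (2 * ?m i)\<^sup>2" by (simp only: abs_le_square_iff)
    then have "real_of_int ((2 ^ q * k i)\<^sup>2) \<le> real_of_int ((2 * ?m i)\<^sup>2)" by (simp only: of_int_le_iff)
    moreover have "(2::real)\<^sup>2 = 4" by simp
    ultimately show ?thesis by (simp only: of_int_power of_int_mult of_int_numeral power_mult_distrib)
  qed
  have "(2 ^ q)\<^sup>2 * sqn k = (\<Sum>i\<in>UNIV. (2 ^ q * real_of_int (k i))\<^sup>2)"
    by (simp add: sqn_def sum_distrib_left power_mult_distrib)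
  also have "\<dots> \<le> 4 * sqn ?m"
    unfolding sqn_def sum_distrib_left by (intro sum_mono coord)
  finally have "(2 ^ q)\<^sup>2 * sqn k \<le> 4 * sqn ?m" .
  then have "pi\<^sup>2 * ((2 ^ q)\<^sup>2 * sqn k) \<le> pi\<^sup>2 * (4 * sqn ?m)" by (intro mult_left_mono) auto
  moreover have "(2 ^ q)\<^sup>2 / 4 * (4 * x * y) = x * ((2 ^ q)\<^sup>2 * y)" for x y :: real by simp
  ultimately have le: "(2 ^ q)\<^sup>2 / 4 * (4 * pi\<^sup>2 * sqn k) \<le> 4 * pi\<^sup>2 * sqn ?m"
    by (simp only: mult_ac)
  have k1: "1 \<le> 4 * pi\<^sup>2 * sqn k" using freq_sq_ge_1[OF assms(2)] .
  have t0: "t > 0" using assms(3,5) by linarith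
  have gen: "y powr (- t) \<le> 4 powr T * x powr (- t) * l"
    if "x / 4 * z \<le> y" "x > 0" "z \<ge> 1" "z powr (- t) \<le> l" for x y z l :: real
  proof -
    have "y powr (- t) \<le> (x / 4 * z) powr (- t)"
      by (rule powr_mono2') (use that t0 in \<open>auto simp del: times_divide_eq_left\<close>)
    also have "\<dots> = 4 powr t * x powr (- t) * z powr (- t)"
      unfolding powr_mult powr_divide by (simp add: powr_minus_divide[of 4])
    also have "\<dots> \<le> 4 powr T * x powr (- t) * l"
      by (rule mult_mono[OF mult_right_mono that(4)]) (simp_all add: assms(4))
    finally show ?thesis .
  qed
  show ?thesis
    using gen[OF le _ k1 lam_antimono[OF assms(2,3), unfolded lam_def[of t]]]
    unfolding lam_def[of t] by simp
qed

text \<open>The summand 1 pays for the representative, the other one for the remaining aliases: 16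
  pi^2 d is the product of the 4 from the shift estimate and the factor 4 pi^2 d by which
  \<open>ww\<close> can exceed N^2.\<close>

definition Gconst :: "'d::finite itself \<Rightarrow> real \<Rightarrow> real \<Rightarrow> real" where
  "Gconst _ a T = 1 + (16 * pi\<^sup>2 * real CARD('d)) powr T * infsum (lam a) (UNIV - {\<lambda>_. 0 :: int} :: ('d \<Rightarrow> int) set)"

lemma Gconst_ge_1: "1 \<le> Gconst TYPE('d::finite) a T"
  by (simp add: Gconst_def infsum_nonneg)

text \<open>The class is split into its centred representative and the set \<open>A\<close> of the
  other aliases, indexed injectively by the shift k. Their total is of order N^(-2t), which is at
  most a constant times w^(-t) because w is at most of order N^2.\<close>

lemma Gw_le:
  fixes r :: "'d::finite \<Rightarrow> int"
  assumes "real CARD('d) / 2 < a" "a \<le> t" "t \<le> T" "r \<in> Jq q"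
  shows "Gw q t r \<le> Gconst TYPE('d) a T * ww q r powr (- t)"
proof -
  let ?d = "real CARD('d)" and ?S = "infsum (lam a) (UNIV - {\<lambda>_. 0 :: int} :: ('d \<Rightarrow> int) set)"
  have d: "?d \<ge> 1" by (simp add: Suc_leI)
  have t: "t > ?d / 2" and a0: "a > 0" and t0: "t > 0" using assms d by linarith+
  define A where "A = cls q r - {symres q r}"
  define k where "k m = (\<lambda>i. (m i - symres q r i) div 2 ^ q)" for m :: "'d \<Rightarrow> int"
  have dec: "m = (\<lambda>i. symres q r i + 2 ^ q * k m i)" if "m \<in> A" for m
  proof
    fix i
    have "m i mod 2 ^ q = symres q r i mod 2 ^ q"
      using that res_symres[OF assms(4)] by (auto simp: A_def cls_def res_def fun_eq_iff)
    then have "2 ^ q dvd m i - symres q r i" by (simp only: mod_eq_dvd_iff)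
    then show "m i = symres q r i + 2 ^ q * k m i" by (simp add: k_def)
  qed
  have k0: "k m \<noteq> (\<lambda>_. 0)" if "m \<in> A" for m
  proof
    assume "k m = (\<lambda>_. 0)"
    then have "m = symres q r" using dec[OF that] by simp
    then show False using that by (simp add: A_def)
  qed
  have inj: "inj_on k A"
  proof (rule inj_onI)
    fix x y assume xy: "x \<in> A" "y \<in> A" "k x = k y"
    show "x = y" using dec[OF xy(1)] dec[OF xy(2)] by (simp add: xy(3))
  qed
  have summA: "lam t summable_on A"
    by (rule summable_on_subset_banach[OF lam_summable_cls[OF t, of q r]]) (auto simp: A_def)
  have kA: "k ` A \<subseteq> UNIV - {\<lambda>_. 0}" using k0 by auto
  have summk: "lam a summable_on k ` A"
    using lam_summable[OF assms(1)] kA by (rule summable_on_subset_banach)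
  then have summ2: "(\<lambda>m. lam a (k m)) summable_on A"
    using summable_on_reindex[OF inj, of "lam a"] by (simp add: o_def)
  have "infsum (lam t) A \<le> (\<Sum>\<^sub>\<infinity>m\<in>A. 4 powr T * ((2 ^ q)\<^sup>2) powr (- t) * lam a (k m))"
  proof (rule infsum_mono[OF summA summable_on_cmult_right[OF summ2]])
    fix m assume "m \<in> A"
    then show "lam t m \<le> 4 powr T * ((2 ^ q)\<^sup>2) powr (- t) * lam a (k m)"
      using lam_shift_le[OF assms(4) k0 assms(2,3) a0] dec by metis
  qed
  also have "\<dots> = 4 powr T * ((2 ^ q)\<^sup>2) powr (- t) * infsum (lam a) (k ` A)"
    unfolding infsum_reindex[OF inj] o_def by (rule infsum_cmult_right')
  also have "\<dots> \<le> 4 powr T * ((2 ^ q)\<^sup>2) powr (- t) * ?S"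
    by (intro mult_left_mono infsum_mono2 summk lam_summable[OF assms(1)] kA) auto
  also have "((2 ^ q)\<^sup>2) powr (- t) \<le> (4 * pi\<^sup>2 * ?d) powr T * ww q r powr (- t)"
  proof -
    have ge1: "1 \<le> 4 * pi\<^sup>2 * ?d" using mult_mono[of 1 "4 * pi\<^sup>2" 1 ?d] d pi_sq_ge by simp
    have "(4 * pi\<^sup>2 * ?d * (2 ^ q)\<^sup>2) powr (- t) \<le> ww q r powr (- t)"
      using ww_le[OF assms(4)] ww_ge_1[OF assms(4)] t0 by (intro powr_mono2') auto
    then have "(4 * pi\<^sup>2 * ?d) powr t * (4 * pi\<^sup>2 * ?d * (2 ^ q)\<^sup>2) powr (- t)
        \<le> (4 * pi\<^sup>2 * ?d) powr T * ww q r powr (- t)"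
      using ge1 assms(3) by (intro mult_mono powr_mono) auto
    moreover have "(4 * pi\<^sup>2 * ?d) powr t * (4 * pi\<^sup>2 * ?d * (2 ^ q)\<^sup>2) powr (- t) = ((2 ^ q)\<^sup>2) powr (- t)"
      using ge1 by (subst powr_mult) (auto simp: powr_minus)
    ultimately show ?thesis by simp
  qed
  finally have A_le: "infsum (lam t) A \<le> 4 powr T * ((4 * pi\<^sup>2 * ?d) powr T * ww q r powr (- t)) * ?S"
    by (simp add: mult_left_mono mult_right_mono infsum_nonneg)
  \<comment> \<open>For the zero class the centred representative is the excluded zero frequency, so
    \<open>A\<close> is already the whole class and the term of \<open>rep\<close> is merely
    added.\<close>
  have "Gw q t r \<le> lam t (rep q r) + infsum (lam t) A"
  proof (cases "r = (\<lambda>_. 0)")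
    case True
    then have "symres q r = (\<lambda>_. 0)" by (simp add: symres_def)
    then have "A = cls q r" by (auto simp: A_def cls_def)
    then show ?thesis by (simp add: Gw_def)
  next
    case False
    then have "rep q r = symres q r" by (simp add: rep_def)
    then have "cls q r = insert (rep q r) A" "rep q r \<notin> A"
      using rep_in_cls[OF assms(4)] by (auto simp: A_def)
    then show ?thesis unfolding Gw_def using summA by (simp add: infsum_insert)
  qed
  also have "\<dots> \<le> ww q r powr (- t) + 4 powr T * ((4 * pi\<^sup>2 * ?d) powr T * ww q r powr (- t)) * ?S"
    using A_le by (simp add: lam_rep)
  also have "\<dots> = Gconst TYPE('d) a T * ww q r powr (- t)"
  proof -
    have "(16 * pi\<^sup>2 * ?d) powr T = 4 powr T * (4 * pi\<^sup>2 * ?d) powr T"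
      by (subst powr_mult[symmetric]) (simp add: mult.assoc)
    then show ?thesis by (simp add: Gconst_def algebra_simps)
  qed
  finally show ?thesis .
qed

section \<open>Characters of the grid\<close>

lemma norm_phi [simp]: "cmod (phi m x) = 1"
  by (simp add: phi_def)

lemma ip_add: "ip (\<lambda>i. m i + n i) x = ip m x + ip n x"
  by (simp add: ip_def sum.distrib distrib_right)

lemma phi_add: "phi (\<lambda>i. m i + n i) x = phi m x * phi n x"
  by (simp add: phi_def ip_add algebra_simps flip: exp_add)

lemma cnj_phi: "cnj (phi m x) = phi (\<lambda>i. - m i) x"
  by (simp add: phi_def exp_cnj ip_def sum_negf)

lemma phi_diff: "phi (\<lambda>i. m i - n i) x = phi m x * cnj (phi n x)"
  using phi_add[of m "\<lambda>i. - n i" x] by (simp add: cnj_phi)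

lemma phi_eq_prod: "phi m x = (\<Prod>i\<in>UNIV. exp (complex_of_real (2 * pi * (real_of_int (m i) * x i)) * \<i>))"
  unfolding phi_def ip_def by (subst exp_sum[symmetric]) (simp_all add: sum_distrib_left sum_distrib_right)

text \<open>On the grid the phase is a multiple of the symmetric pairing of m and j, so frequencies
  and grid points may be exchanged. This turns orthogonality of the characters into the dual
  orthogonality over grid points.\<close>

lemma phi_gpt_commute: "phi m (gpt q j) = phi j (gpt q m)"
  by (simp add: phi_def ip_def gpt_def mult.commute)

lemma exp_2pi_int: "exp (complex_of_real (2 * pi * real_of_int n) * \<i>) = 1"
  by (auto simp: exp_eq_1 intro!: exI[of _ n])

lemma phi_res: "phi (res q m) (gpt q j) = phi m (gpt q j)"
proof -
  have "m = (\<lambda>i. res q m i + 2 ^ q * (m i div 2 ^ q))" by (simp add: res_def fun_eq_iff)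
  then have "phi m (gpt q j) = phi (\<lambda>i. res q m i + 2 ^ q * (m i div 2 ^ q)) (gpt q j)" by simp
  also have "\<dots> = phi (res q m) (gpt q j) * phi (\<lambda>i. 2 ^ q * (m i div 2 ^ q)) (gpt q j)"
    by (rule phi_add)
  \<comment> \<open>The two frequencies differ by N times an integer vector, whose phase at a grid
    point is an integer multiple of 2 pi.\<close>
  also have "ip (\<lambda>i. 2 ^ q * (m i div 2 ^ q)) (gpt q j) = real_of_int (\<Sum>i\<in>UNIV. (m i div 2 ^ q) * j i)"
    by (simp add: ip_def gpt_def)
  then have "phi (\<lambda>i. 2 ^ q * (m i div 2 ^ q)) (gpt q j) = 1"
    unfolding phi_def by (simp only: exp_2pi_int)
  finally show ?thesis by simp
qed

text \<open>Either a is a multiple of N and every term is 1, or the terms are the powers over a full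
  period of a nontrivial root of unity.\<close>

lemma sum_exp_grid:
  fixes a :: int
  shows "(\<Sum>k\<in>{0..<2 ^ q :: int}. exp (complex_of_real (2 * pi * (real_of_int a * (real_of_int k / 2 ^ q))) * \<i>))
    = (if a mod 2 ^ q = 0 then 2 ^ q else 0)"
proof -
  define z where "z = exp (complex_of_real (2 * pi * (real_of_int a / 2 ^ q)) * \<i>)"
  have powers: "exp (complex_of_real (2 * pi * (real_of_int a * (real_of_int (int k) / 2 ^ q))) * \<i>) = z ^ k" for k :: nat
    unfolding z_def by (subst exp_of_nat_mult[symmetric]) (simp add: field_simps)
  have "{0..<2 ^ q :: int} = int ` {..<2 ^ q}"
  proof (intro equalityI subsetI)
    fix k :: int assume "k \<in> {0..<2 ^ q}"
    then have "k = int (nat k)" "nat k < 2 ^ q" by (auto simp: nat_less_iff)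
    then show "k \<in> int ` {..<2 ^ q}" by blast
  qed auto
  then have "(\<Sum>k\<in>{0..<2 ^ q :: int}. exp (complex_of_real (2 * pi * (real_of_int a * (real_of_int k / 2 ^ q))) * \<i>))
      = (\<Sum>k<2 ^ q. z ^ k)"
    by (simp only: sum.reindex[OF inj_on_of_nat] o_def powers)
  also have "\<dots> = (if a mod 2 ^ q = 0 then 2 ^ q else 0)"
  proof (cases "a mod 2 ^ q = 0")
    case True
    then obtain b where "a = 2 ^ q * b" by (auto simp: mod_eq_0_iff_dvd)
    then have "z = 1" unfolding z_def using exp_2pi_int[of b] by simp
    with True show ?thesis by simp
  next
    case False
    have "z \<noteq> 1"
    proof
      assume "z = 1"
      then obtain n :: int where "2 * pi * (real_of_int a / 2 ^ q) = of_int (2 * n) * pi"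
        unfolding z_def exp_eq_1 by auto
      then have "real_of_int a = real_of_int (n * 2 ^ q)" by (simp add: field_simps)
      then have "a = n * 2 ^ q" by (simp only: of_int_eq_iff)
      with False show False by simp
    qed
    moreover have "z ^ (2 ^ q) = 1"
    proof -
      have "z ^ (2 ^ q) = exp (complex_of_real (2 * pi * real_of_int a) * \<i>)"
        unfolding z_def by (subst exp_of_nat_mult[symmetric]) (simp add: field_simps)
      then show ?thesis by (simp only: exp_2pi_int)
    qed
    ultimately show ?thesis using False by (simp add: geometric_sum)
  qed
  finally show ?thesis .
qed

lemma sum_phi_grid:
  "(\<Sum>j\<in>Jq q. phi m (gpt q j)) = (if res q m = (\<lambda>_. 0) then (2 ^ q) ^ CARD('d) else 0)"
  for m :: "'d::finite \<Rightarrow> int"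
proof -
  have "(\<Sum>j\<in>Jq q. phi m (gpt q j)) = (\<Prod>i\<in>UNIV. \<Sum>k\<in>{0..<2 ^ q :: int}.
      exp (complex_of_real (2 * pi * (real_of_int (m i) * (real_of_int k / 2 ^ q))) * \<i>))"
    unfolding phi_eq_prod Jq_eq_PiE gpt_def by (subst prod_sum_PiE) auto
  also have "\<dots> = (\<Prod>i\<in>UNIV. if m i mod 2 ^ q = 0 then 2 ^ q else 0)"
    by (simp only: sum_exp_grid)
  also have "\<dots> = (if res q m = (\<lambda>_. 0) then (2 ^ q) ^ CARD('d) else 0)"
  proof (cases "res q m = (\<lambda>_. 0)")
    case False
    then obtain i where "m i mod 2 ^ q \<noteq> 0" by (auto simp: res_def fun_eq_iff)
    then have "(\<Prod>i\<in>UNIV. if m i mod 2 ^ q = 0 then 2 ^ q else 0 :: complex) = 0"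
      by (intro prod_zero) auto
    with False show ?thesis by simp
  qed (auto simp: res_def fun_eq_iff)
  finally show ?thesis .
qed

lemma res_diff_eq_0_iff: "res q (\<lambda>i. m i - n i) = (\<lambda>_. 0) \<longleftrightarrow> res q m = res q n"
  by (auto simp: res_def fun_eq_iff mod_eq_dvd_iff mod_eq_0_iff_dvd)

lemma grid_orthogonal:
  fixes r r' :: "'d::finite \<Rightarrow> int"
  assumes "r \<in> Jq q" "r' \<in> Jq q"
  shows "(\<Sum>j\<in>Jq q. phi r (gpt q j) * cnj (phi r' (gpt q j))) = (if r = r' then (2 ^ q) ^ CARD('d) else 0)"
  using assms by (simp add: phi_diff[symmetric] sum_phi_grid res_diff_eq_0_iff res_Jq)

lemma grid_orthogonal':
  fixes j j' :: "'d::finite \<Rightarrow> int"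
  assumes "j \<in> Jq q" "j' \<in> Jq q"
  shows "(\<Sum>r\<in>Jq q. phi r (gpt q j) * cnj (phi r (gpt q j'))) = (if j = j' then (2 ^ q) ^ CARD('d) else 0)"
  using grid_orthogonal[OF assms] by (simp add: phi_gpt_commute[of _ q j] phi_gpt_commute[of _ q j'])

section \<open>Discrete Fourier coefficients on the grid and lattice sums by classes\<close>

definition Fd :: "nat \<Rightarrow> (('d::finite \<Rightarrow> real) \<Rightarrow> complex) \<Rightarrow> ('d \<Rightarrow> int) \<Rightarrow> complex" where
  "Fd q f r = (\<Sum>j\<in>Jq q. f (gpt q j) * cnj (phi r (gpt q j))) / (2 ^ q) ^ CARD('d)"

lemma grid_inversion:
  fixes f :: "('d::finite \<Rightarrow> real) \<Rightarrow> complex"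
  assumes "j \<in> Jq q"
  shows "(\<Sum>r\<in>Jq q. Fd q f r * phi r (gpt q j)) = f (gpt q j)"
proof -
  have "(\<Sum>r\<in>Jq q. Fd q f r * phi r (gpt q j))
      = (\<Sum>r\<in>Jq q. \<Sum>j'\<in>Jq q. f (gpt q j') * (phi r (gpt q j) * cnj (phi r (gpt q j')))) / (2 ^ q) ^ CARD('d)"
    by (simp add: Fd_def sum_divide_distrib sum_distrib_right sum_distrib_left mult_ac)
  also have "(\<Sum>r\<in>Jq q. \<Sum>j'\<in>Jq q. f (gpt q j') * (phi r (gpt q j) * cnj (phi r (gpt q j'))))
      = (\<Sum>j'\<in>Jq q. f (gpt q j') * (\<Sum>r\<in>Jq q. phi r (gpt q j) * cnj (phi r (gpt q j'))))"
    by (subst sum.swap) (simp add: sum_distrib_left)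
  also have "\<dots> = (\<Sum>j'\<in>Jq q. if j' = j then f (gpt q j) * (2 ^ q) ^ CARD('d) else 0)"
    by (intro sum.cong refl) (simp add: grid_orthogonal'[OF assms])
  also have "\<dots> = f (gpt q j) * (2 ^ q) ^ CARD('d)"
    using assms by (simp add: sum.delta)
  finally show ?thesis by simp
qed

text \<open>By orthogonality an expansion in grid characters is unique, so \<open>Fd\<close> can be
  computed by exhibiting any expansion on the grid points and reading off its coefficients. The Gram
  system, the interpolant, the sample and the passage to a coarser grid are all treated in this
  way.\<close>

lemma grid_coefficients:
  fixes h :: "('d::finite \<Rightarrow> int) \<Rightarrow> complex"
  assumes "r \<in> Jq q" "\<And>j. j \<in> Jq q \<Longrightarrow> f (gpt q j) = (\<Sum>r\<in>Jq q. h r * phi r (gpt q j))"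
  shows "Fd q f r = h r"
proof -
  have "(\<Sum>j\<in>Jq q. f (gpt q j) * cnj (phi r (gpt q j)))
      = (\<Sum>j\<in>Jq q. \<Sum>r'\<in>Jq q. h r' * (phi r' (gpt q j) * cnj (phi r (gpt q j))))"
    by (simp add: assms(2) sum_distrib_right mult.assoc)
  also have "\<dots> = (\<Sum>r'\<in>Jq q. h r' * (\<Sum>j\<in>Jq q. phi r' (gpt q j) * cnj (phi r (gpt q j))))"
    by (subst sum.swap) (simp add: sum_distrib_left)
  also have "\<dots> = (\<Sum>r'\<in>Jq q. if r' = r then h r * (2 ^ q) ^ CARD('d) else 0)"
    by (intro sum.cong refl) (simp add: grid_orthogonal[OF _ assms(1)])
  also have "\<dots> = h r * (2 ^ q) ^ CARD('d)"
    using assms(1) by (simp add: sum.delta)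
  finally show ?thesis by (simp add: Fd_def)
qed

lemma summable_on_classes:
  fixes f :: "('d::finite \<Rightarrow> int) \<Rightarrow> 'b::banach"
  assumes "\<And>r. r \<in> Jq q \<Longrightarrow> f summable_on cls q r"
  shows "f summable_on UNIV - {\<lambda>_. 0}"
  unfolding UN_cls[of q, symmetric]
  by (rule summable_on_finite_union_disjoint) (auto simp: cls_disjoint assms)

lemma lam_res_summable:
  fixes h :: "('d::finite \<Rightarrow> int) \<Rightarrow> real"
  assumes "t > real CARD('d) / 2"
  shows "(\<lambda>m. lam t m * h (res q m)) summable_on UNIV - {\<lambda>_. 0}"
proof (rule summable_on_classes)
  fix r :: "'d \<Rightarrow> int"
  have "(\<lambda>m. lam t m * h r) summable_on cls q r"
    by (rule summable_on_cmult_left[OF lam_summable_cls[OF assms]])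
  then show "(\<lambda>m. lam t m * h (res q m)) summable_on cls q r"
    by (subst summable_on_cong[where g = "\<lambda>m. lam t m * h r"]) (auto simp: cls_def)
qed

text \<open>A factor that depends only on the residue is constant on each class, so the lattice sum
  collapses to a finite sum weighted by \<open>Gw\<close>. The norms of the interpolants are
  evaluated through this.\<close>

lemma infsum_lam_res:
  fixes h :: "('d::finite \<Rightarrow> int) \<Rightarrow> real"
  assumes "t > real CARD('d) / 2"
  shows "(\<Sum>\<^sub>\<infinity>m\<in>UNIV - {\<lambda>_. 0}. lam t m * h (res q m)) = (\<Sum>r\<in>Jq q. Gw q t r * h r)"
  unfolding infsum_classes[OF lam_res_summable[OF assms], of h q q] Gw_def infsum_cmult_left'[symmetric]
  by (intro sum.cong refl infsum_cong) (auto simp: cls_def)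

lemma lam_res_abs_summable:
  fixes h :: "('d::finite \<Rightarrow> int) \<Rightarrow> complex"
  assumes "t > real CARD('d) / 2" "\<And>m. cmod (b m) = 1"
  shows "(\<lambda>m. cmod (complex_of_real (lam t m) * h (res q m) * b m)) summable_on UNIV - {\<lambda>_. 0}"
  using lam_res_summable[OF assms(1), of "\<lambda>r. cmod (h r)" q] by (simp add: norm_mult assms(2))

lemma infsum_lam_res_complex:
  fixes h :: "('d::finite \<Rightarrow> int) \<Rightarrow> complex"
  assumes "t > real CARD('d) / 2"
  shows "(\<Sum>\<^sub>\<infinity>m\<in>UNIV - {\<lambda>_. 0}. complex_of_real (lam t m) * h (res q m)) = (\<Sum>r\<in>Jq q. Gw q t r * h r)"
proof -
  have "(\<lambda>m. complex_of_real (lam t m) * h (res q m)) summable_on UNIV - {\<lambda>_. 0}"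
    using abs_summable_summable[OF lam_res_abs_summable[OF assms, of "\<lambda>_. 1" h q]] by simp
  then have "(\<Sum>\<^sub>\<infinity>m\<in>UNIV - {\<lambda>_. 0}. complex_of_real (lam t m) * h (res q m))
      = (\<Sum>r\<in>Jq q. \<Sum>\<^sub>\<infinity>m\<in>cls q r. complex_of_real (lam t m) * h (res q m))"
    by (rule infsum_classes)
  also have "\<dots> = (\<Sum>r\<in>Jq q. \<Sum>\<^sub>\<infinity>m\<in>cls q r. complex_of_real (lam t m) * h r)"
    by (intro sum.cong refl infsum_cong) (auto simp: cls_def)
  also have "\<dots> = (\<Sum>r\<in>Jq q. Gw q t r * h r)"
    unfolding infsum_cmult_left' Gw_def
    by (intro sum.cong refl arg_cong2[where f = times] infsumI has_sum_of_real has_sum_infsum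
        lam_summable_cls[OF assms])
  finally show ?thesis .
qed

lemma Kt_grid:
  fixes i j :: "'d::finite \<Rightarrow> int"
  assumes "t > real CARD('d) / 2"
  shows "Kt t (gpt q i) (gpt q j) = (\<Sum>r\<in>Jq q. Gw q t r * (phi r (gpt q i) * cnj (phi r (gpt q j))))"
proof -
  have "Kt t (gpt q i) (gpt q j) = (\<Sum>\<^sub>\<infinity>m\<in>UNIV - {\<lambda>_. 0}. complex_of_real (lam t m) *
      (\<lambda>r. phi r (gpt q i) * cnj (phi r (gpt q j))) (res q m))"
    unfolding Kt_def by (simp add: phi_res mult.assoc)
  then show ?thesis
    by (simp only: infsum_lam_res_complex[OF assms, of "\<lambda>r. phi r (gpt q i) * cnj (phi r (gpt q j))" q])
qed

lemma has_sum_finite_sum: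
  fixes f :: "'a \<Rightarrow> 'b \<Rightarrow> 'c::topological_comm_monoid_add"
  assumes "\<And>a. a \<in> A \<Longrightarrow> (f a has_sum s a) B"
  shows "((\<lambda>x. \<Sum>a\<in>A. f a x) has_sum (\<Sum>a\<in>A. s a)) B"
  using assms by (induction A rule: infinite_finite_induct) (auto intro: has_sum_add)

section \<open>The Gram matrix and the interpolant\<close>

lemma enumJ_bij: "bij_betw (enumJ q) {..<npts q TYPE('d)} (Jq q :: ('d::finite \<Rightarrow> int) set)"
proof -
  have "\<exists>f. bij_betw f {..<card (Jq q :: ('d \<Rightarrow> int) set)} (Jq q :: ('d \<Rightarrow> int) set)"
    using ex_bij_betw_nat_finite[of "Jq q :: ('d \<Rightarrow> int) set"] by (simp add: atLeast0LessThan)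
  then show ?thesis unfolding enumJ_def npts_def by (rule someI_ex)
qed

lemma enumJ_in: "a < npts q TYPE('d) \<Longrightarrow> (enumJ q a :: 'd::finite \<Rightarrow> int) \<in> Jq q"
  using enumJ_bij[of q, where 'd = 'd] by (auto dest: bij_betwE)

lemma enumJ_eq_iff:
  "a < npts q TYPE('d) \<Longrightarrow> b < npts q TYPE('d) \<Longrightarrow> (enumJ q a :: 'd::finite \<Rightarrow> int) = enumJ q b \<longleftrightarrow> a = b"
  using enumJ_bij[of q, where 'd = 'd] by (auto simp: bij_betw_def inj_on_def)

lemma sum_enumJ:
  "(\<Sum>a<npts q TYPE('d). h (enumJ q a :: 'd::finite \<Rightarrow> int)) = sum h (Jq q)"
  by (rule sum.reindex_bij_betw[OF enumJ_bij])

lemma prod_enumJ: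
  "(\<Prod>a<npts q TYPE('d). h (enumJ q a :: 'd::finite \<Rightarrow> int)) = prod h (Jq q)"
  by (rule prod.reindex_bij_betw[OF enumJ_bij])

text \<open>The character matrix is left unnormalised: its product with \<open>dft_adj\<close> is
  N^d times the identity, whence the factor N^d in the eigenvalues.\<close>

definition dft :: "nat \<Rightarrow> 'd::finite itself \<Rightarrow> complex mat" where
  "dft q D = mat (npts q D) (npts q D) (\<lambda>(a, b). phi (enumJ q b :: 'd \<Rightarrow> int) (gpt q (enumJ q a)))"

definition dft_adj :: "nat \<Rightarrow> 'd::finite itself \<Rightarrow> complex mat" where
  "dft_adj q D = mat (npts q D) (npts q D) (\<lambda>(a, b). cnj (phi (enumJ q a :: 'd \<Rightarrow> int) (gpt q (enumJ q b))))"

definition Gdiag :: "real \<Rightarrow> nat \<Rightarrow> 'd::finite itself \<Rightarrow> complex mat" where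
  "Gdiag t q D = mat (npts q D) (npts q D)
     (\<lambda>(a, b). if a = b then complex_of_real (Gw q t (enumJ q a :: 'd \<Rightarrow> int)) else 0)"

lemma dft_dft_adj:
  "dft q TYPE('d::finite) * dft_adj q TYPE('d) = ((2 ^ q) ^ CARD('d)) \<cdot>\<^sub>m 1\<^sub>m (npts q TYPE('d))"
proof (rule eq_matI)
  fix a b assume "a < dim_row (((2 ^ q) ^ CARD('d)) \<cdot>\<^sub>m 1\<^sub>m (npts q TYPE('d)) :: complex mat)"
    "b < dim_col (((2 ^ q) ^ CARD('d)) \<cdot>\<^sub>m 1\<^sub>m (npts q TYPE('d)) :: complex mat)"
  then have ab: "a < npts q TYPE('d)" "b < npts q TYPE('d)" by auto
  let ?h = "\<lambda>r :: 'd \<Rightarrow> int. phi r (gpt q (enumJ q a)) * cnj (phi r (gpt q (enumJ q b)))"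
  have "(dft q TYPE('d) * dft_adj q TYPE('d)) $$ (a, b) = (\<Sum>c<npts q TYPE('d). ?h (enumJ q c))"
    using ab by (simp add: dft_def dft_adj_def scalar_prod_def atLeast0LessThan)
  also have "\<dots> = sum ?h (Jq q)" by (rule sum_enumJ[of ?h q])
  also have "\<dots> = (if enumJ q a = (enumJ q b :: 'd \<Rightarrow> int) then (2 ^ q) ^ CARD('d) else 0)"
    by (rule grid_orthogonal'[OF enumJ_in[OF ab(1)] enumJ_in[OF ab(2)]])
  finally show "(dft q TYPE('d) * dft_adj q TYPE('d)) $$ (a, b)
      = (((2 ^ q) ^ CARD('d)) \<cdot>\<^sub>m 1\<^sub>m (npts q TYPE('d))) $$ (a, b)"
    using ab by (simp add: enumJ_eq_iff)
qed (auto simp: dft_def dft_adj_def)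

lemma gram_factor:
  assumes "t > real CARD('d::finite) / 2"
  shows "gram t q TYPE('d) = dft q TYPE('d) * Gdiag t q TYPE('d) * dft_adj q TYPE('d)"
proof (rule eq_matI)
  let ?n = "npts q TYPE('d)"
  fix a b assume "a < dim_row (dft q TYPE('d) * Gdiag t q TYPE('d) * dft_adj q TYPE('d))"
    "b < dim_col (dft q TYPE('d) * Gdiag t q TYPE('d) * dft_adj q TYPE('d))"
  then have ab: "a < ?n" "b < ?n" by (auto simp: dft_def dft_adj_def)
  let ?h = "\<lambda>r :: 'd \<Rightarrow> int. complex_of_real (Gw q t r) * (phi r (gpt q (enumJ q a)) * cnj (phi r (gpt q (enumJ q b))))"
  have dG: "(dft q TYPE('d) * Gdiag t q TYPE('d)) $$ (a, c)
      = phi (enumJ q c :: 'd \<Rightarrow> int) (gpt q (enumJ q a)) * Gw q t (enumJ q c :: 'd \<Rightarrow> int)" if "c < ?n" for c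
    using ab that by (simp add: dft_def Gdiag_def scalar_prod_def atLeast0LessThan mult_delta_right)
  have "(dft q TYPE('d) * Gdiag t q TYPE('d) * dft_adj q TYPE('d)) $$ (a, b)
      = (\<Sum>c<?n. (dft q TYPE('d) * Gdiag t q TYPE('d)) $$ (a, c) * dft_adj q TYPE('d) $$ (c, b))"
    using ab by (subst index_mult_mat)
      (auto simp: dft_def Gdiag_def dft_adj_def scalar_prod_def atLeast0LessThan simp del: index_mult_mat(1) intro!: sum.cong)
  also have "\<dots> = (\<Sum>c<?n. ?h (enumJ q c))"
    using ab by (intro sum.cong refl) (simp add: dG dft_adj_def)
  also have "\<dots> = sum ?h (Jq q)" by (rule sum_enumJ[of ?h q])
  also have "\<dots> = Kt t (gpt q (enumJ q a :: 'd \<Rightarrow> int)) (gpt q (enumJ q b :: 'd \<Rightarrow> int))"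
    unfolding Kt_grid[OF assms] by simp
  finally show "gram t q TYPE('d) $$ (a, b) = (dft q TYPE('d) * Gdiag t q TYPE('d) * dft_adj q TYPE('d)) $$ (a, b)"
    using ab by (simp add: gram_def)
qed (auto simp: dft_def dft_adj_def gram_def)

lemma det_gram:
  assumes "t > real CARD('d::finite) / 2"
  shows "det (gram t q TYPE('d)) = complex_of_real (((2 ^ q) ^ CARD('d)) ^ npts q TYPE('d) * (\<Prod>r\<in>(Jq q :: ('d \<Rightarrow> int) set). Gw q t r))"
proof -
  let ?n = "npts q TYPE('d)"
  have c: "dft q TYPE('d) \<in> carrier_mat ?n ?n" "dft_adj q TYPE('d) \<in> carrier_mat ?n ?n"
    "Gdiag t q TYPE('d) \<in> carrier_mat ?n ?n" "dft q TYPE('d) * Gdiag t q TYPE('d) \<in> carrier_mat ?n ?n"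
    by (auto simp: dft_def dft_adj_def Gdiag_def)
  have "det (gram t q TYPE('d)) = det (dft q TYPE('d) * dft_adj q TYPE('d)) * det (Gdiag t q TYPE('d))"
    unfolding gram_factor[OF assms] det_mult[OF c(4,2)] det_mult[OF c(1,3)] det_mult[OF c(1,2)] by simp
  also have "det (dft q TYPE('d) * dft_adj q TYPE('d)) = ((2 ^ q) ^ CARD('d)) ^ ?n"
    unfolding dft_dft_adj by simp
  also have "det (Gdiag t q TYPE('d)) = prod_list (diag_mat (Gdiag t q TYPE('d)))"
    by (rule det_upper_triangular[OF _ c(3)]) (auto simp: Gdiag_def)
  also have "\<dots> = (\<Prod>a<?n. complex_of_real (Gw q t (enumJ q a :: 'd \<Rightarrow> int)))"
    unfolding prod_list_diag_prod by (intro prod.cong) (auto simp: Gdiag_def atLeast0LessThan)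
  also have "\<dots> = (\<Prod>r\<in>(Jq q :: ('d \<Rightarrow> int) set). complex_of_real (Gw q t r))"
    by (rule prod_enumJ[of "\<lambda>r. complex_of_real (Gw q t r)" q])
  finally show ?thesis by simp
qed

text \<open>The summand with the logarithm of N^d does not involve t, so it cancels when two values
  of the empirical Bayes objective are subtracted.\<close>

lemma ln_det_gram:
  assumes "t > real CARD('d::finite) / 2"
  shows "ln (Re (det (gram t q TYPE('d)))) =
    real (npts q TYPE('d)) * ln ((2 ^ q) ^ CARD('d)) + (\<Sum>r\<in>(Jq q :: ('d \<Rightarrow> int) set). ln (Gw q t r))"
proof -
  have pos: "Gw q t r > 0" if "r \<in> Jq q" for r :: "'d \<Rightarrow> int"
    using Gw_pos[OF assms that] .
  show ?thesis
    unfolding det_gram[OF assms] Re_complex_of_real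
    by (subst ln_mult_pos) (auto simp: ln_realpow ln_prod less_imp_neq[OF pos, symmetric] pos intro!: prod_pos)
qed

text \<open>The inverse is never computed: a candidate solution of the Gram system is written down
  and checked, and invertibility, from the nonzero determinant, makes it the only one.\<close>

lemma interp_coefficients:
  fixes f :: "('d::finite \<Rightarrow> real) \<Rightarrow> complex"
  assumes "t > real CARD('d) / 2" "a < npts q TYPE('d)"
  shows "(the (mat_inverse (gram t q TYPE('d))) *\<^sub>v vec (npts q TYPE('d)) (\<lambda>a. f (gpt q (enumJ q a :: 'd \<Rightarrow> int)))) $ a
    = (\<Sum>r\<in>Jq q. Fd q f r / Gw q t r * phi r (gpt q (enumJ q a))) / (2 ^ q) ^ CARD('d)"
proof -
  let ?n = "npts q TYPE('d)" and ?A = "gram t q TYPE('d)"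
  let ?v = "vec ?n (\<lambda>a. f (gpt q (enumJ q a :: 'd \<Rightarrow> int)))"
  define g where "g x = (\<Sum>r\<in>Jq q. Fd q f r / Gw q t r * phi r x)" for x
  \<comment> \<open>Solving in the eigenbasis divides each coefficient by N^d G; here the division
    by N^d is done separately, after the one by G in \<open>g\<close>.\<close>
  define c where "c = vec ?n (\<lambda>a. g (gpt q (enumJ q a :: 'd \<Rightarrow> int)) / (2 ^ q) ^ CARD('d))"
  have A: "?A \<in> carrier_mat ?n ?n" by (simp add: gram_def)
  have G: "Gw q t r \<noteq> 0" if "r \<in> Jq q" for r :: "'d \<Rightarrow> int"
    using Gw_pos[OF assms(1) that] by simp
  have dA: "det ?A \<noteq> 0" unfolding det_gram[OF assms(1)] using G by simp
  then obtain B where inv: "mat_inverse ?A = Some B"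
    using mat_inverse(1)[OF A, where b = "()"] det_non_zero_imp_unit[OF A dA, of "()"]
    by (cases "mat_inverse ?A") auto
  from mat_inverse(2)[OF A this] have B: "B * ?A = 1\<^sub>m ?n" "B \<in> carrier_mat ?n ?n" by auto
  have Ac: "?A *\<^sub>v c = ?v"
  proof (rule eq_vecI)
    fix a assume "a < dim_vec ?v"
    then have a: "a < ?n" by simp
    let ?x = "gpt q (enumJ q a :: 'd \<Rightarrow> int)"
    let ?h = "\<lambda>j :: 'd \<Rightarrow> int. Kt t ?x (gpt q j) * (g (gpt q j) / (2 ^ q) ^ CARD('d))"
    have "(?A *\<^sub>v c) $ a = (\<Sum>b<?n. ?h (enumJ q b))"
      using a by (simp add: gram_def c_def scalar_prod_def atLeast0LessThan)
    also have "\<dots> = sum ?h (Jq q)" by (rule sum_enumJ[of ?h q])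
    also have "\<dots> = (\<Sum>j\<in>Jq q. \<Sum>r\<in>Jq q. Gw q t r * phi r ?x * (g (gpt q j) * cnj (phi r (gpt q j)) / (2 ^ q) ^ CARD('d)))"
      unfolding Kt_grid[OF assms(1)] by (simp add: sum_distrib_right sum_distrib_left sum_divide_distrib mult_ac)
    also have "\<dots> = (\<Sum>r\<in>Jq q. Gw q t r * phi r ?x * Fd q g r)"
      by (subst sum.swap) (simp add: Fd_def sum_distrib_left sum_divide_distrib)
    also have "\<dots> = (\<Sum>r\<in>Jq q. Fd q f r * phi r ?x)"
      by (intro sum.cong refl) (simp add: grid_coefficients[of _ q g "\<lambda>r. Fd q f r / Gw q t r"] g_def G)
    also have "\<dots> = f ?x" by (rule grid_inversion[OF enumJ_in[OF a]])
    finally show "(?A *\<^sub>v c) $ a = ?v $ a" using a by simp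
  qed (simp add: gram_def)
  have "B *\<^sub>v ?v = B *\<^sub>v (?A *\<^sub>v c)" unfolding Ac ..
  also have "\<dots> = (B * ?A) *\<^sub>v c" using A B(2) by (subst assoc_mult_mat_vec[OF B(2) A]) (auto simp: c_def)
  also have "\<dots> = c" unfolding B(1) by (simp add: c_def)
  finally have "B *\<^sub>v ?v = c" .
  with inv show ?thesis using assms(2) by (simp add: c_def g_def)
qed

text \<open>The interpolant distributes the grid coefficient of a class over the frequencies of that
  class in proportion to \<open>lam\<close>. This form makes its Fourier coefficients
  visible.\<close>

lemma interp_fourier:
  fixes f :: "('d::finite \<Rightarrow> real) \<Rightarrow> complex"
  assumes "t > real CARD('d) / 2"
  shows "interp t q f y = (\<Sum>\<^sub>\<infinity>m\<in>UNIV - {\<lambda>_. 0}. complex_of_real (lam t m) * (Fd q f (res q m) / Gw q t (res q m)) * phi m y)"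
proof -
  let ?n = "npts q TYPE('d)"
  define g where "g x = (\<Sum>r\<in>Jq q. Fd q f r / Gw q t r * phi r x)" for x
  define c where "c j = g (gpt q j) / (2 ^ q) ^ CARD('d)" for j
  have "interp t q f y = (\<Sum>a<?n. Kt t y (gpt q (enumJ q a :: 'd \<Rightarrow> int)) * c (enumJ q a))"
    unfolding interp_def Let_def using interp_coefficients[OF assms, of _ q f]
    by (intro sum.cong refl) (simp add: c_def g_def)
  also have "\<dots> = (\<Sum>j\<in>Jq q. Kt t y (gpt q j) * c j)"
    by (rule sum_enumJ[of "\<lambda>j. Kt t y (gpt q j) * c j" q])
  finally have eq: "interp t q f y = (\<Sum>j\<in>Jq q. Kt t y (gpt q j) * c j)" .
  have "((\<lambda>m. complex_of_real (lam t m) * phi m y * cnj (phi m (gpt q j)) * c j) has_sum Kt t y (gpt q j) * c j) (UNIV - {\<lambda>_. 0})" for j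
  proof -
    have "(\<lambda>m. complex_of_real (lam t m) * phi m y * cnj (phi m (gpt q j))) summable_on (UNIV - {\<lambda>_. 0})"
      by (rule abs_summable_summable) (use lam_summable[OF assms] in \<open>simp add: norm_mult\<close>)
    then show ?thesis
      unfolding Kt_def by (intro has_sum_cmult_left has_sum_infsum)
  qed
  then have "((\<lambda>m. \<Sum>j\<in>Jq q. complex_of_real (lam t m) * phi m y * cnj (phi m (gpt q j)) * c j) has_sum interp t q f y) (UNIV - {\<lambda>_. 0})"
    unfolding eq by (rule has_sum_finite_sum)
  moreover have "(\<Sum>j\<in>Jq q. complex_of_real (lam t m) * phi m y * cnj (phi m (gpt q j)) * c j)
      = complex_of_real (lam t m) * (Fd q f (res q m) / Gw q t (res q m)) * phi m y" for m
  proof -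
    have "(\<Sum>j\<in>Jq q. complex_of_real (lam t m) * phi m y * cnj (phi m (gpt q j)) * c j)
        = complex_of_real (lam t m) * phi m y * Fd q g (res q m)"
      by (simp add: Fd_def c_def sum_distrib_left sum_divide_distrib phi_res mult_ac)
    also have "Fd q g (res q m) = Fd q f (res q m) / Gw q t (res q m)"
      by (rule grid_coefficients) (auto simp: g_def)
    finally show ?thesis by (simp add: mult_ac)
  qed
  ultimately show ?thesis by (simp add: infsumI)
qed

section \<open>Fourier coefficients and Sobolev norms\<close>

lemma integral_exp_unit_interval:
  fixes n :: int
  shows "has_bochner_integral lborel
    (\<lambda>x. indicator {0..1} x *\<^sub>R exp (complex_of_real (2 * pi * (real_of_int n * x)) * \<i>)) (if n = 0 then 1 else 0)"
proof (cases "n = 0")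
  case True
  have "has_bochner_integral lborel (\<lambda>x::real. indicator {0..1} x *\<^sub>R (1::complex)) (of_real 1 - of_real 0)"
    by (rule has_bochner_integral_FTC_Icc) (auto intro!: derivative_eq_intros)
  with True show ?thesis by simp
next
  case False
  define F where "F x = exp (complex_of_real (2 * pi * (real_of_int n * x)) * \<i>) / (2 * pi * n * \<i>)" for x :: real
  have "has_bochner_integral lborel
    (\<lambda>x. indicator {0..1} x *\<^sub>R exp (complex_of_real (2 * pi * (real_of_int n * x)) * \<i>)) (F 1 - F 0)"
  proof (rule has_bochner_integral_FTC_Icc)
    fix x :: real
    have "((\<lambda>z::complex. exp (2 * pi * (real_of_int n * z) * \<i>) / (2 * pi * n * \<i>)) has_field_derivative
        exp (2 * pi * (real_of_int n * x) * \<i>)) (at (complex_of_real x))"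
      using False by (auto intro!: derivative_eq_intros)
    from has_vector_derivative_real_field[OF this]
    have "((\<lambda>x. exp (complex_of_real (2 * pi * (real_of_int n * x)) * \<i>) / (2 * pi * n * \<i>)) has_vector_derivative
        exp (complex_of_real (2 * pi * (real_of_int n * x)) * \<i>)) (at x within {0..1})"
      by (simp add: o_def)
    then show "(F has_vector_derivative exp (complex_of_real (2 * pi * (real_of_int n * x)) * \<i>)) (at x within {0..1})"
      unfolding F_def .
  qed (auto intro!: continuous_intros)
  moreover have "F 1 = F 0"
    unfolding F_def using exp_2pi_int[of n] by simp
  ultimately show ?thesis using False by simp
qed

interpretation leb: product_sigma_finite "\<lambda>_::'d::finite. lborel :: real measure"
  by standard

lemma phi_measurable [measurable]: "(phi m :: ('d::finite \<Rightarrow> real) \<Rightarrow> complex) \<in> borel_measurable leb"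
  unfolding phi_def[abs_def] ip_def leb_def by measurable

lemma torus_indicator: "indicator torus x = (\<Prod>i\<in>(UNIV::'d::finite set). indicator {0..1} (x i) :: real)"
proof (cases "x \<in> torus")
  case False
  then obtain i where "x i \<notin> {0..1}" by (auto simp: torus_def PiE_iff)
  then have "(\<Prod>i\<in>(UNIV::'d set). indicator {0..1} (x i) :: real) = 0"
    by (intro prod_zero bexI[of _ i]) (simp_all add: indicator_def)
  with False show ?thesis by simp
qed (auto simp: torus_def PiE_iff)

lemma torus_sets [measurable]: "(torus :: ('d::finite \<Rightarrow> real) set) \<in> sets leb"
  unfolding torus_def leb_def by measurable

lemma integral_phi_torus:
  fixes m :: "'d::finite \<Rightarrow> int"
  shows "(\<integral>x. indicator torus x *\<^sub>R phi m x \<partial>leb) = (if m = (\<lambda>_. 0) then 1 else 0)"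
proof -
  let ?f = "\<lambda>i x. indicator {0..1} x *\<^sub>R exp (complex_of_real (2 * pi * (real_of_int (m i) * x)) * \<i>)"
  have "indicator torus x *\<^sub>R phi m x = (\<Prod>i\<in>UNIV. ?f i (x i))" for x
    by (simp add: torus_indicator phi_eq_prod scaleR_conv_of_real prod.distrib)
  then have "(\<integral>x. indicator torus x *\<^sub>R phi m x \<partial>leb) = (\<integral>x. (\<Prod>i\<in>UNIV. ?f i (x i)) \<partial>leb)" by simp
  also have "\<dots> = (\<Prod>i\<in>UNIV. \<integral>x. ?f i x \<partial>lborel)"
    unfolding leb_def using integral_exp_unit_interval
    by (intro leb.product_integral_prod) (auto intro: has_bochner_integral.intros dest: integrable.intros)
  also have "\<dots> = (\<Prod>i\<in>UNIV. if m i = 0 then 1 else 0)"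
    using has_bochner_integral_integral_eq[OF integral_exp_unit_interval] by simp
  also have "\<dots> = (if m = (\<lambda>_. 0) then 1 else 0)"
  proof (cases "m = (\<lambda>_. 0)")
    case False
    then obtain i where "m i \<noteq> 0" by (auto simp: fun_eq_iff)
    then have "(\<Prod>i\<in>UNIV. if m i = 0 then 1 else 0 :: complex) = 0" by (intro prod_zero) auto
    with False show ?thesis by simp
  qed simp
  finally show ?thesis .
qed

lemma emeasure_torus: "emeasure leb (torus :: ('d::finite \<Rightarrow> real) set) = 1"
  unfolding leb_def torus_def by (subst leb.emeasure_PiM) auto

lemma integrable_torus:
  fixes f :: "('d::finite \<Rightarrow> real) \<Rightarrow> complex"
  assumes [measurable]: "f \<in> borel_measurable leb" and "\<And>x. cmod (f x) \<le> B"
  shows "integrable leb (\<lambda>x. indicator torus x *\<^sub>R f x)"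
proof (rule Bochner_Integration.integrable_bound)
  show "integrable leb (\<lambda>x. indicator (torus :: ('d \<Rightarrow> real) set) x * B)"
    using emeasure_torus[where 'd = 'd] by (intro integrable_mult_left integrable_real_indicator) auto
  show "AE x in leb. norm (indicator torus x *\<^sub>R f x) \<le> norm (indicator torus x * B)"
  proof (rule AE_I2)
    fix x :: "'d \<Rightarrow> real"
    have "cmod (f x) \<le> \<bar>B\<bar>" using assms(2)[of x] by linarith
    then show "norm (indicator torus x *\<^sub>R f x) \<le> norm (indicator torus x * B)"
      by (simp add: indicator_def)
  qed
qed measurable

text \<open>Partial sums over cubes are bounded by the sum of all |c m|, a constant integrable on
  the torus, so dominated convergence exchanges sum and integral. A partial sum has the coefficient
  \<open>c k\<close> as soon as its cube contains k.\<close>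

lemma fcoef_series:
  fixes c :: "('d::finite \<Rightarrow> int) \<Rightarrow> complex"
  assumes c: "(\<lambda>m. cmod (c m)) summable_on UNIV - {\<lambda>_. 0}" and k: "k \<noteq> (\<lambda>_. 0)"
  shows "fcoef (\<lambda>y. \<Sum>\<^sub>\<infinity>m\<in>UNIV - {\<lambda>_. 0}. c m * phi m y) k = c k"
proof -
  let ?Z = "UNIV - {\<lambda>_. 0} :: ('d \<Rightarrow> int) set"
  define B where "B = infsum (\<lambda>m. cmod (c m)) ?Z"
  define S where "S R y = (\<Sum>m\<in>freq_cube R. c m * phi m y)" for R y
  define V where "V y = (\<Sum>\<^sub>\<infinity>m\<in>?Z. c m * phi m y)" for y
  have cube: "freq_cube R \<inter> ?Z = freq_cube R" for R by (auto simp: freq_cube_def)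
  have SV: "(\<lambda>R. S R y) \<longlonglongrightarrow> V y" for y
  proof -
    have "(\<lambda>m. c m * phi m y) summable_on ?Z"
      by (rule abs_summable_summable) (use c in \<open>simp add: norm_mult\<close>)
    from has_sum_imp_freq_cube_tendsto[OF has_sum_infsum[OF this]] show ?thesis
      by (simp add: S_def V_def cube)
  qed
  have SB: "cmod (S R y) \<le> B" for R y
  proof -
    have "cmod (S R y) \<le> (\<Sum>m\<in>freq_cube R. cmod (c m))"
      unfolding S_def by (rule order_trans[OF norm_sum]) (simp add: norm_mult)
    also have "\<dots> \<le> B" unfolding B_def using cube[of R]
      by (intro finite_sum_le_infsum[OF c]) auto
    finally show ?thesis .
  qed
  have Smeas [measurable]: "S R \<in> borel_measurable leb" for R
    unfolding S_def[abs_def] by measurable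
  have Vmeas [measurable]: "V \<in> borel_measurable leb"
    by (rule borel_measurable_LIMSEQ_metric[OF Smeas SV])
  have lim: "(\<lambda>R. \<integral>x. indicator torus x *\<^sub>R (S R x * cnj (phi k x)) \<partial>leb) \<longlonglongrightarrow> (\<integral>x. indicator torus x *\<^sub>R (V x * cnj (phi k x)) \<partial>leb)"
  proof (rule integral_dominated_convergence)
    show "integrable leb (\<lambda>x. indicator (torus :: ('d \<Rightarrow> real) set) x * B)"
      using emeasure_torus[where 'd = 'd] by (intro integrable_mult_left integrable_real_indicator) auto
    show "AE x in leb. (\<lambda>R. indicator torus x *\<^sub>R (S R x * cnj (phi k x))) \<longlonglongrightarrow> indicator torus x *\<^sub>R (V x * cnj (phi k x))"
      using SV by (intro AE_I2 tendsto_intros)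
    show "AE x in leb. norm (indicator torus x *\<^sub>R (S R x * cnj (phi k x))) \<le> indicator torus x * B" for R
      using SB by (intro AE_I2) (auto simp: indicator_def norm_mult)
  qed (simp_all add: cnj_phi)
  have int: "(\<integral>x. indicator torus x *\<^sub>R (S R x * cnj (phi k x)) \<partial>leb) = (\<Sum>m\<in>freq_cube R. if m = k then c k else 0)" for R
  proof -
    have "(\<integral>x. indicator torus x *\<^sub>R (S R x * cnj (phi k x)) \<partial>leb)
        = (\<integral>x. (\<Sum>m\<in>freq_cube R. c m * (indicator torus x *\<^sub>R phi (\<lambda>i. m i - k i) x)) \<partial>leb)"
      by (simp add: S_def phi_diff sum_distrib_right scaleR_sum_right mult.assoc)
    also have "\<dots> = (\<Sum>m\<in>freq_cube R. c m * (\<integral>x. indicator torus x *\<^sub>R phi (\<lambda>i. m i - k i) x \<partial>leb))"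
    proof -
      have "integrable leb (\<lambda>x. c m * (indicator torus x *\<^sub>R phi (\<lambda>i. m i - k i) x))" for m
        by (rule integrable_mult_right, rule integrable_torus[where B = 1]) simp_all
      then show ?thesis
        by (simp only: Bochner_Integration.integral_sum integral_mult_right_zero)
    qed
    also have "\<dots> = (\<Sum>m\<in>freq_cube R. if m = k then c k else 0)"
    proof (intro sum.cong refl)
      fix m
      have "(\<lambda>i. m i - k i) = (\<lambda>_. 0) \<longleftrightarrow> m = k" by (auto simp: fun_eq_iff)
      then show "c m * (\<integral>x. indicator torus x *\<^sub>R phi (\<lambda>i. m i - k i) x \<partial>leb) = (if m = k then c k else 0)"
        by (simp add: integral_phi_torus)
    qed
    finally show ?thesis .
  qed
  obtain R0 where "{k} \<subseteq> freq_cube R0" using finite_subset_freq_cube[of "{k}"] k by auto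
  then have "(\<integral>x. indicator torus x *\<^sub>R (S R x * cnj (phi k x)) \<partial>leb) = c k" if "R \<ge> R0" for R
    using freq_cube_mono[OF that] by (auto simp: int)
  then have "(\<lambda>R. \<integral>x. indicator torus x *\<^sub>R (S R x * cnj (phi k x)) \<partial>leb) \<longlonglongrightarrow> c k"
    by (intro tendsto_eventually eventually_sequentiallyI)
  from LIMSEQ_unique[OF this lim] show ?thesis
    by (simp add: fcoef_def V_def)
qed

text \<open>The weight in the norm is the inverse of \<open>lam\<close> and cancels one of the two
  factors \<open>lam\<close> of the squared coefficient; what remains is a lattice sum with a
  residue-dependent factor.\<close>

lemma hnorm2_series:
  fixes h :: "('d::finite \<Rightarrow> int) \<Rightarrow> complex"
  assumes t: "t > real CARD('d) / 2"
  shows "hnorm2 t (\<lambda>y. \<Sum>\<^sub>\<infinity>m\<in>UNIV - {\<lambda>_. 0}. complex_of_real (lam t m) * h (res q m) * phi m y)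
    = (\<Sum>r\<in>Jq q. Gw q t r * (cmod (h r))\<^sup>2)"
proof -
  have fc: "fcoef (\<lambda>y. \<Sum>\<^sub>\<infinity>m\<in>UNIV - {\<lambda>_. 0}. complex_of_real (lam t m) * h (res q m) * phi m y) k
      = complex_of_real (lam t k) * h (res q k)" if "k \<noteq> (\<lambda>_. 0)" for k
    using fcoef_series[of "\<lambda>m. complex_of_real (lam t m) * h (res q m)" k]
      lam_res_abs_summable[OF t, of "\<lambda>_. 1" h q] that by simp
  have "(4 * pi\<^sup>2 * sqn k) powr t * (cmod (complex_of_real (lam t k) * h (res q k)))\<^sup>2
      = lam t k * (cmod (h (res q k)))\<^sup>2" if "k \<noteq> (\<lambda>_. 0)" for k
  proof -
    have "(4 * pi\<^sup>2 * sqn k) powr t * lam t k = 1"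
      using sqn_ge_1[OF that] by (simp add: lam_def powr_minus)
    then have "(4 * pi\<^sup>2 * sqn k) powr t * (lam t k)\<^sup>2 = lam t k"
      unfolding power2_eq_square[of "lam t k"] by (simp only: mult.assoc[symmetric] mult_1)
    then show ?thesis by (simp add: norm_mult power_mult_distrib)
  qed
  then show ?thesis
    unfolding hnorm2_def infsum_lam_res[OF t, of "\<lambda>r. (cmod (h r))\<^sup>2", symmetric]
    by (intro infsum_cong) (simp add: fc)
qed

lemma hnorm2_interp:
  fixes f :: "('d::finite \<Rightarrow> real) \<Rightarrow> complex"
  assumes "t > real CARD('d) / 2"
  shows "hnorm2 t (interp t q f) = (\<Sum>r\<in>Jq q. (cmod (Fd q f r))\<^sup>2 / Gw q t r)"
proof -
  have "hnorm2 t (interp t q f) = (\<Sum>r\<in>Jq q. Gw q t r * (cmod (Fd q f r / Gw q t r))\<^sup>2)"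
    unfolding interp_fourier[OF assms, abs_def] by (rule hnorm2_series[OF assms])
  also have "\<dots> = (\<Sum>r\<in>Jq q. (cmod (Fd q f r))\<^sup>2 / Gw q t r)"
    by (intro sum.cong refl) (use Gw_pos[OF assms] in \<open>force simp: norm_divide power_divide power2_eq_square\<close>)
  finally show ?thesis .
qed

lemma infsum_minus:
  fixes f g :: "'a \<Rightarrow> 'b::banach"
  assumes "f summable_on A" "g summable_on A"
  shows "(\<Sum>\<^sub>\<infinity>x\<in>A. f x - g x) = infsum f A - infsum g A"
  using infsum_add[OF assms(1) summable_on_uminus[THEN iffD2, OF assms(2)]]
  by (simp add: infsum_uminus)

text \<open>Residues modulo 2^p are determined by residues modulo 2^q, so the coefficients of the
  coarse interpolant, too, are \<open>lam\<close> times a function of the fine residue, and the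
  difference has the same form.\<close>

lemma hnorm2_interp_diff:
  fixes f :: "('d::finite \<Rightarrow> real) \<Rightarrow> complex"
  assumes t: "t > real CARD('d) / 2" and "p \<le> q"
  shows "hnorm2 t (\<lambda>y. interp t q f y - interp t p f y) =
    (\<Sum>r\<in>Jq q. Gw q t r * (cmod (Fd q f r / Gw q t r - Fd p f (res p r) / Gw p t (res p r)))\<^sup>2)"
proof -
  define h where "h r = Fd q f r / Gw q t r - Fd p f (res p r) / Gw p t (res p r)" for r
  have "interp t q f y - interp t p f y =
      (\<Sum>\<^sub>\<infinity>m\<in>UNIV - {\<lambda>_. 0}. complex_of_real (lam t m) * h (res q m) * phi m y)" for y
  proof -
    have summ: "(\<lambda>m. complex_of_real (lam t m) * g (res p m) * phi m y) summable_on UNIV - {\<lambda>_. 0}" for g p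
      by (rule abs_summable_summable, rule lam_res_abs_summable[OF t norm_phi])
    show ?thesis
      unfolding interp_fourier[OF t] h_def res_res[OF assms(2)]
      using infsum_minus[OF summ[of "\<lambda>r. Fd q f r / Gw q t r" q] summ[of "\<lambda>r. Fd p f r / Gw p t r" p]]
      by (simp only: left_diff_distrib right_diff_distrib)
  qed
  then show ?thesis
    unfolding h_def[symmetric] by (simp only: hnorm2_series[OF t])
qed

text \<open>Frequencies of one class are indistinguishable on the grid, so the cube-wise limit of
  the field at a grid point is a finite combination of the class-wise limits; no convergence
  elsewhere on the torus enters.\<close>

lemma Fd_ufield:
  fixes \<xi> :: "('d::finite \<Rightarrow> int) \<Rightarrow> real"
  assumes U: "\<And>r. r \<in> Jq q \<Longrightarrow>
      (\<lambda>R. \<Sum>m\<in>freq_cube R \<inter> cls q r. (4 * pi\<^sup>2 * sqn m) powr (- s / 2) * \<xi> m) \<longlonglongrightarrow> U r"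
    and "r \<in> Jq q"
  shows "Fd q (ufield s \<xi>) r = complex_of_real (U r)"
proof (rule grid_coefficients[OF assms(2)])
  fix j :: "'d \<Rightarrow> int" assume "j \<in> Jq q"
  let ?a = "\<lambda>m. (4 * pi\<^sup>2 * sqn m) powr (- s / 2) * \<xi> m"
  have "(\<Sum>m\<in>freq_cube R. complex_of_real (?a m) * phi m (gpt q j))
      = (\<Sum>r\<in>Jq q. complex_of_real (\<Sum>m\<in>freq_cube R \<inter> cls q r. ?a m) * phi r (gpt q j))" for R
  proof -
    have "(\<Sum>m\<in>freq_cube R. complex_of_real (?a m) * phi m (gpt q j))
        = (\<Sum>m\<in>(\<Union>r\<in>Jq q. freq_cube R \<inter> cls q r). complex_of_real (?a m) * phi (res q m) (gpt q j))"
      unfolding phi_res by (rule sum.cong) (auto simp: freq_cube_def cls_def)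
    also have "\<dots> = (\<Sum>r\<in>Jq q. \<Sum>m\<in>freq_cube R \<inter> cls q r. complex_of_real (?a m) * phi (res q m) (gpt q j))"
      by (rule sum.UNION_disjoint) (auto simp: cls_def)
    also have "\<dots> = (\<Sum>r\<in>Jq q. complex_of_real (\<Sum>m\<in>freq_cube R \<inter> cls q r. ?a m) * phi r (gpt q j))"
      unfolding of_real_sum sum_distrib_right by (intro sum.cong refl) (auto simp: cls_def)
    finally show ?thesis .
  qed
  moreover have "(\<lambda>R. \<Sum>r\<in>Jq q. complex_of_real (\<Sum>m\<in>freq_cube R \<inter> cls q r. ?a m) * phi r (gpt q j))
      \<longlonglongrightarrow> (\<Sum>r\<in>Jq q. complex_of_real (U r) * phi r (gpt q j))"
    by (intro tendsto_sum tendsto_mult tendsto_const tendsto_of_real U)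
  ultimately have "(\<lambda>R. \<Sum>m\<in>freq_cube R. complex_of_real (?a m) * phi m (gpt q j))
      \<longlonglongrightarrow> (\<Sum>r\<in>Jq q. complex_of_real (U r) * phi r (gpt q j))" by simp
  from limI[OF this] show "ufield s \<xi> (gpt q j) = (\<Sum>r\<in>Jq q. complex_of_real (U r) * phi r (gpt q j))"
    unfolding ufield_def freq_cube_def .
qed

text \<open>On the coarse grid, which is part of the fine one, fine frequencies with the same coarse
  residue coincide, so their coefficients add up.\<close>

lemma Fd_coarse:
  fixes f :: "('d::finite \<Rightarrow> real) \<Rightarrow> complex"
  assumes "p \<le> q" "r' \<in> Jq p"
  shows "Fd p f r' = (\<Sum>r\<in>{r\<in>Jq q. res p r = r'}. Fd q f r)"
proof (rule grid_coefficients[OF assms(2)])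
  fix j :: "'d \<Rightarrow> int" assume j: "j \<in> Jq p"
  \<comment> \<open>The index, on the fine grid, of the coarse grid point with index j.\<close>
  define j' where "j' = (\<lambda>i. 2 ^ (q - p) * j i)"
  have pow: "(2::'b::semiring_1) ^ q = 2 ^ (q - p) * 2 ^ p"
    using assms(1) by (simp flip: power_add)
  have gpt: "gpt q j' = gpt p j"
    unfolding gpt_def j'_def pow by (simp add: fun_eq_iff)
  have "j' i < 2 ^ q" for i
    using j unfolding Jq_def j'_def pow by (simp add: mult_strict_left_mono)
  then have j': "j' \<in> Jq q" using j by (auto simp: Jq_def j'_def)
  have "f (gpt p j) = (\<Sum>r\<in>Jq q. Fd q f r * phi (res p r) (gpt p j))"
    using grid_inversion[OF j', of f] unfolding gpt phi_res by simp
  also have "\<dots> = (\<Sum>r'\<in>Jq p. \<Sum>r\<in>{r\<in>Jq q. res p r = r'}. Fd q f r * phi (res p r) (gpt p j))"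
    by (rule sum.group[symmetric]) auto
  also have "\<dots> = (\<Sum>r'\<in>Jq p. (\<Sum>r\<in>{r\<in>Jq q. res p r = r'}. Fd q f r) * phi r' (gpt p j))"
    unfolding sum_distrib_right by (intro sum.cong refl) auto
  finally show "f (gpt p j) = (\<Sum>r'\<in>Jq p. (\<Sum>r\<in>{r\<in>Jq q. res p r = r'}. Fd q f r) * phi r' (gpt p j))" .
qed

section \<open>Random series\<close>

lemma integrable_mult_of_squares:
  fixes f g :: "'a \<Rightarrow> real"
  assumes [measurable]: "f \<in> borel_measurable M" "g \<in> borel_measurable M"
    and "integrable M (\<lambda>x. (f x)\<^sup>2)" "integrable M (\<lambda>x. (g x)\<^sup>2)"
  shows "integrable M (\<lambda>x. f x * g x)"
proof (rule Bochner_Integration.integrable_bound)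
  show "integrable M (\<lambda>x. (f x)\<^sup>2 + (g x)\<^sup>2)" using assms by simp
  have "\<bar>f x * g x\<bar> \<le> (f x)\<^sup>2 + (g x)\<^sup>2" for x
  proof -
    have "0 \<le> (\<bar>f x\<bar> - \<bar>g x\<bar>)\<^sup>2" by simp
    then have "2 * \<bar>f x * g x\<bar> \<le> (f x)\<^sup>2 + (g x)\<^sup>2"
      by (simp add: power2_diff abs_mult)
    moreover have "0 \<le> \<bar>f x * g x\<bar>" by simp
    ultimately show ?thesis by linarith
  qed
  then show "AE x in M. norm (f x * g x) \<le> norm ((f x)\<^sup>2 + (g x)\<^sup>2)"
    by (intro AE_I2) (simp add: abs_of_nonneg)
qed measurable

context prob_space
begin

text \<open>Independence and zero means remove the mixed products, so variances add.\<close>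

lemma expectation_square_indep_sum:
  fixes X :: "'i \<Rightarrow> 'a \<Rightarrow> real"
  assumes fin: "finite I" and ind: "indep_vars (\<lambda>_. borel) X I"
    and int: "\<And>i. i \<in> I \<Longrightarrow> integrable M (\<lambda>\<omega>. (X i \<omega>)\<^sup>2)"
    and mean: "\<And>i. i \<in> I \<Longrightarrow> expectation (X i) = 0"
  shows "expectation (\<lambda>\<omega>. (\<Sum>i\<in>I. X i \<omega>)\<^sup>2) = (\<Sum>i\<in>I. expectation (\<lambda>\<omega>. (X i \<omega>)\<^sup>2))"
    and "integrable M (\<lambda>\<omega>. (\<Sum>i\<in>I. X i \<omega>)\<^sup>2)"
proof -
  have rv: "random_variable borel (X i)" if "i \<in> I" for i
    using ind that by (auto simp: indep_vars_def)
  have int1: "integrable M (X i)" if "i \<in> I" for i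
    using rv[OF that] int[OF that] by (rule square_integrable_imp_integrable)
  have intXX: "integrable M (\<lambda>\<omega>. X i \<omega> * X j \<omega>)" if "i \<in> I" "j \<in> I" for i j
    using that by (intro integrable_mult_of_squares rv int)
  have cross: "expectation (\<lambda>\<omega>. X i \<omega> * X j \<omega>) = (if j = i then expectation (\<lambda>\<omega>. (X i \<omega>)\<^sup>2) else 0)"
    if "i \<in> I" "j \<in> I" for i j
  proof (cases "j = i")
    case False
    have "expectation (\<lambda>\<omega>. \<Prod>k\<in>{i, j}. X k \<omega>) = (\<Prod>k\<in>{i, j}. expectation (X k))"
      using that by (intro indep_vars_lebesgue_integral indep_vars_subset[OF ind] int1) auto
    with False mean that show ?thesis by simp
  qed (simp add: power2_eq_square)
  have eq: "(\<Sum>i\<in>I. X i \<omega>)\<^sup>2 = (\<Sum>i\<in>I. \<Sum>j\<in>I. X i \<omega> * X j \<omega>)" for \<omega>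
    by (simp add: power2_eq_square sum_product)
  show "integrable M (\<lambda>\<omega>. (\<Sum>i\<in>I. X i \<omega>)\<^sup>2)"
    unfolding eq by (intro Bochner_Integration.integrable_sum intXX)
  have "expectation (\<lambda>\<omega>. (\<Sum>i\<in>I. X i \<omega>)\<^sup>2) = (\<Sum>i\<in>I. \<Sum>j\<in>I. expectation (\<lambda>\<omega>. X i \<omega> * X j \<omega>))"
    unfolding eq by (simp add: Bochner_Integration.integral_sum Bochner_Integration.integrable_sum intXX)
  also have "\<dots> = (\<Sum>i\<in>I. \<Sum>j\<in>I. if j = i then expectation (\<lambda>\<omega>. (X i \<omega>)\<^sup>2) else 0)"
    by (intro sum.cong refl cross)
  also have "\<dots> = (\<Sum>i\<in>I. expectation (\<lambda>\<omega>. (X i \<omega>)\<^sup>2))"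
    using fin by simp
  finally show "expectation (\<lambda>\<omega>. (\<Sum>i\<in>I. X i \<omega>)\<^sup>2) = (\<Sum>i\<in>I. expectation (\<lambda>\<omega>. (X i \<omega>)\<^sup>2))" .
qed

text \<open>The path is stopped at the first k at which the partial sum reaches e in absolute value.
  On that event the square of S_n is at least e^2 plus twice S_k (S_n - S_k), and the latter term
  has mean zero because the past up to k and the later increment are independent.\<close>

lemma kolmogorov_inequality:
  fixes X :: "nat \<Rightarrow> 'a \<Rightarrow> real"
  assumes ind: "indep_vars (\<lambda>_. borel) X UNIV"
    and int: "\<And>i. integrable M (\<lambda>\<omega>. (X i \<omega>)\<^sup>2)" and mean: "\<And>i. expectation (X i) = 0"
    and e: "e > 0"
  shows "prob {\<omega>\<in>space M. \<exists>k\<le>n. e \<le> \<bar>\<Sum>i=m..<k. X i \<omega>\<bar>} \<le> (\<Sum>i=m..<n. expectation (\<lambda>\<omega>. (X i \<omega>)\<^sup>2)) / e\<^sup>2"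
proof -
  have rv [measurable]: "random_variable borel (X i)" for i
    using ind by (auto simp: indep_vars_def)
  have int1: "integrable M (X i)" for i
    by (rule square_integrable_imp_integrable) (use int in auto)
  define S where "S k \<omega> = (\<Sum>i=m..<k. X i \<omega>)" for k \<omega>
  have S_meas [measurable]: "S k \<in> borel_measurable M" for k unfolding S_def[abs_def] by measurable
  \<comment> \<open>First passage at k, phrased as a property of a coordinate sequence: independence
    is available for restrictions to index sets, and \<open>P k\<close> reads only coordinates below
    k.\<close>
  define P where "P k x \<longleftrightarrow> e \<le> \<bar>\<Sum>i=m..<k. x i\<bar> \<and> (\<forall>j\<in>{..<k}. \<bar>\<Sum>i=m..<j. x i\<bar> < e)" for k and x :: "nat \<Rightarrow> real"
  define B where "B k \<omega> = (if P k (\<lambda>i. X i \<omega>) then 1 else 0 :: real)" for k \<omega>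
  have B_meas [measurable]: "B k \<in> borel_measurable M" for k
    unfolding B_def[abs_def] P_def by measurable
  have S2: "expectation (\<lambda>\<omega>. (S k \<omega>)\<^sup>2) = (\<Sum>i=m..<k. expectation (\<lambda>\<omega>. (X i \<omega>)\<^sup>2))"
    "integrable M (\<lambda>\<omega>. (S k \<omega>)\<^sup>2)" for k
    unfolding S_def
    by (intro expectation_square_indep_sum indep_vars_subset[OF ind] int mean; simp)+
  have intS: "integrable M (S k)" for k
    by (rule square_integrable_imp_integrable) (use S2 in auto)
  have intBS: "integrable M (\<lambda>\<omega>. B k \<omega> * S k \<omega>)" for k
  proof (rule Bochner_Integration.integrable_bound[OF intS[of k]])
    show "AE \<omega> in M. norm (B k \<omega> * S k \<omega>) \<le> norm (S k \<omega>)"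
      by (intro AE_I2) (simp add: B_def)
  qed measurable
  have cross: "expectation (\<lambda>\<omega>. (B k \<omega> * S k \<omega>) * (S n \<omega> - S k \<omega>)) = 0"
    "integrable M (\<lambda>\<omega>. (B k \<omega> * S k \<omega>) * (S n \<omega> - S k \<omega>))" if "k \<le> n" for k
  proof -
    \<comment> \<open>For k below m the partial sum is empty and the increment starts at m, whence
      the maximum.\<close>
    let ?I = "{m..<k}" and ?J = "{max m k..<n}"
    define f where "f x = (if P k x then 1 else 0 :: real) * (\<Sum>i=m..<k. x i)" for x :: "nat \<Rightarrow> real"
    define g where "g x = (\<Sum>i\<in>?J. x i)" for x :: "nat \<Rightarrow> real"
    have 1: "indep_var (PiM ?I (\<lambda>_. borel)) (\<lambda>\<omega>. restrict (\<lambda>i. X i \<omega>) ?I) (PiM ?J (\<lambda>_. borel)) (\<lambda>\<omega>. restrict (\<lambda>i. X i \<omega>) ?J)"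
      by (rule indep_var_restrict[OF ind]) auto
    have 2: "f \<in> borel_measurable (PiM ?I (\<lambda>_. borel))"
    proof -
      have sums: "(\<lambda>x. \<Sum>i=m..<j. x i) \<in> borel_measurable (PiM ?I (\<lambda>_. borel :: real measure))" if "j \<le> k" for j
        using that by (intro borel_measurable_sum measurable_component_singleton) auto
      have P1: "Measurable.pred (PiM ?I (\<lambda>_. borel)) (\<lambda>x. e \<le> \<bar>\<Sum>i=m..<k. x i\<bar>)"
      proof -
        note sums[of k, measurable] show ?thesis by measurable
      qed
      have P2: "Measurable.pred (PiM ?I (\<lambda>_. borel)) (\<lambda>x. \<bar>\<Sum>i=m..<j. x i\<bar> < e)" if "j \<in> {..<k}" for j
      proof -
        have [measurable]: "(\<lambda>x. \<Sum>i=m..<j. x i) \<in> borel_measurable (PiM ?I (\<lambda>_. borel :: real measure))"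
          using that by (intro sums) auto
        show ?thesis by measurable
      qed
      have P3 [measurable]: "Measurable.pred (PiM ?I (\<lambda>_. borel)) (P k)"
        unfolding P_def[abs_def] using P1 P2 by (intro pred_intros_logic pred_intros_finite) auto
      show ?thesis
        unfolding f_def[abs_def] using sums[of k] by measurable
    qed
    have 3: "g \<in> borel_measurable (PiM ?J (\<lambda>_. borel))"
      unfolding g_def[abs_def] by (intro borel_measurable_sum measurable_component_singleton) auto
    have "indep_var borel (f \<circ> (\<lambda>\<omega>. restrict (\<lambda>i. X i \<omega>) ?I)) borel (g \<circ> (\<lambda>\<omega>. restrict (\<lambda>i. X i \<omega>) ?J))"
      by (rule indep_var_compose[OF 1 2 3])
    moreover have "(f \<circ> (\<lambda>\<omega>. restrict (\<lambda>i. X i \<omega>) ?I)) = (\<lambda>\<omega>. B k \<omega> * S k \<omega>)"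
    proof
      fix \<omega>
      have "(\<Sum>i=m..<j. restrict (\<lambda>i. X i \<omega>) ?I i) = (\<Sum>i=m..<j. X i \<omega>)" if "j \<le> k" for j
        using that by (intro sum.cong) auto
      then have "P k (restrict (\<lambda>i. X i \<omega>) ?I) = P k (\<lambda>i. X i \<omega>)"
        unfolding P_def by (intro arg_cong2[where f = "(\<and>)"] ball_cong) auto
      then show "(f \<circ> (\<lambda>\<omega>. restrict (\<lambda>i. X i \<omega>) ?I)) \<omega> = B k \<omega> * S k \<omega>"
        by (simp add: f_def B_def S_def)
    qed
    moreover have "(g \<circ> (\<lambda>\<omega>. restrict (\<lambda>i. X i \<omega>) ?J)) = (\<lambda>\<omega>. S n \<omega> - S k \<omega>)"
    proof
      fix \<omega>
      have "{m..<n} = {m..<k} \<union> ?J" using that by auto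
      then have "S n \<omega> = S k \<omega> + (\<Sum>i\<in>?J. X i \<omega>)"
        unfolding S_def by (simp add: sum.union_disjoint ivl_disj_int)
      then show "(g \<circ> (\<lambda>\<omega>. restrict (\<lambda>i. X i \<omega>) ?J)) \<omega> = S n \<omega> - S k \<omega>" by (simp add: g_def)
    qed
    ultimately have iv: "indep_var borel (\<lambda>\<omega>. B k \<omega> * S k \<omega>) borel (\<lambda>\<omega>. S n \<omega> - S k \<omega>)" by simp
    have intD: "integrable M (\<lambda>\<omega>. S n \<omega> - S k \<omega>)" using intS by simp
    show "integrable M (\<lambda>\<omega>. (B k \<omega> * S k \<omega>) * (S n \<omega> - S k \<omega>))"
      by (rule indep_var_integrable[OF iv intBS intD])
    have "expectation (S k) = 0" for k
      unfolding S_def[abs_def] by (simp add: Bochner_Integration.integral_sum int1 mean)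
    then have "expectation (\<lambda>\<omega>. S n \<omega> - S k \<omega>) = 0" using intS by simp
    then show "expectation (\<lambda>\<omega>. (B k \<omega> * S k \<omega>) * (S n \<omega> - S k \<omega>)) = 0"
      using indep_var_lebesgue_integral[OF iv intBS intD] by simp
  qed
  define E where "E = {\<omega>\<in>space M. \<exists>k\<le>n. e \<le> \<bar>S k \<omega>\<bar>}"
  have E_meas [measurable]: "E \<in> sets M" unfolding E_def by measurable
  \<comment> \<open>At most one \<open>B k\<close> is nonzero, the one of the first passage, so the
    sum over k is a single cross term; the bound follows by dropping the square of S_n -
    S_k.\<close>
  have pw: "e\<^sup>2 * indicator E \<omega> + (\<Sum>k\<le>n. 2 * ((B k \<omega> * S k \<omega>) * (S n \<omega> - S k \<omega>))) \<le> (S n \<omega>)\<^sup>2"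
    if "\<omega> \<in> space M" for \<omega>
  proof (cases "\<omega> \<in> E")
    case True
    then have ex: "\<exists>k. k \<le> n \<and> e \<le> \<bar>S k \<omega>\<bar>" by (auto simp: E_def)
    define k where "k = (LEAST k. e \<le> \<bar>S k \<omega>\<bar>)"
    have k: "e \<le> \<bar>S k \<omega>\<bar>" "k \<le> n" "\<And>j. j < k \<Longrightarrow> \<bar>S j \<omega>\<bar> < e"
      using ex LeastI_ex[of "\<lambda>k. e \<le> \<bar>S k \<omega>\<bar>"] Least_le[of "\<lambda>k. e \<le> \<bar>S k \<omega>\<bar>"]
        not_less_Least[of _ "\<lambda>k. e \<le> \<bar>S k \<omega>\<bar>"] unfolding k_def[symmetric]
      by (auto intro: order_trans simp: not_le)
    have "B j \<omega> = (if j = k then 1 else 0)" for j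
    proof (cases j k rule: linorder_cases)
      case less
      then show ?thesis using k(3)[of j] by (auto simp: B_def P_def S_def)
    next
      case equal
      then show ?thesis using k by (auto simp: B_def P_def S_def)
    next
      case greater
      then have "\<not> (\<forall>j'\<in>{..<j}. \<bar>S j' \<omega>\<bar> < e)" using k(1) by (auto simp: not_less intro!: bexI[of _ k])
      then show ?thesis using greater by (simp add: B_def P_def S_def)
    qed
    then have "(\<Sum>k\<le>n. 2 * ((B k \<omega> * S k \<omega>) * (S n \<omega> - S k \<omega>))) = 2 * (S k \<omega> * (S n \<omega> - S k \<omega>))"
      using k(2) by (simp add: if_distrib[of "\<lambda>x. x * _"] if_distrib[of "\<lambda>x. 2 * x"] cong: if_cong)
    moreover have "e\<^sup>2 \<le> (S k \<omega>)\<^sup>2" using k(1) e by (simp add: abs_le_square_iff[symmetric])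
    moreover have "0 \<le> (S n \<omega> - S k \<omega>)\<^sup>2" by simp
    ultimately show ?thesis using True by (simp add: power2_eq_square algebra_simps)
  next
    case False
    then have "B k \<omega> = 0" if "k \<le> n" for k
      using that \<open>\<omega> \<in> space M\<close> by (auto simp: E_def B_def P_def S_def)
    with False show ?thesis by simp
  qed
  have intl: "integrable M (\<lambda>\<omega>. e\<^sup>2 * indicator E \<omega> + (\<Sum>k\<le>n. 2 * ((B k \<omega> * S k \<omega>) * (S n \<omega> - S k \<omega>))))"
    by (intro Bochner_Integration.integrable_add Bochner_Integration.integrable_sum integrable_mult_right cross(2))
      (auto simp: emeasure_eq_measure)
  have "e\<^sup>2 * prob E = expectation (\<lambda>\<omega>. e\<^sup>2 * indicator E \<omega> + (\<Sum>k\<le>n. 2 * ((B k \<omega> * S k \<omega>) * (S n \<omega> - S k \<omega>))))"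
  proof -
    have "integrable M (\<lambda>\<omega>. e\<^sup>2 * indicator E \<omega>)" by (auto simp: emeasure_eq_measure)
    moreover have "integrable M (\<lambda>\<omega>. \<Sum>k\<le>n. 2 * ((B k \<omega> * S k \<omega>) * (S n \<omega> - S k \<omega>)))"
      by (intro Bochner_Integration.integrable_sum integrable_mult_right cross(2)) auto
    moreover have "expectation (\<lambda>\<omega>. \<Sum>k\<le>n. 2 * ((B k \<omega> * S k \<omega>) * (S n \<omega> - S k \<omega>))) = 0"
      by (subst Bochner_Integration.integral_sum) (auto simp: cross)
    ultimately show ?thesis by simp
  qed
  also have "\<dots> \<le> expectation (\<lambda>\<omega>. (S n \<omega>)\<^sup>2)"
    by (rule integral_mono[OF intl S2(2) pw])
  finally have "prob E \<le> expectation (\<lambda>\<omega>. (S n \<omega>)\<^sup>2) / e\<^sup>2"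
    using e by (simp add: field_simps)
  then show ?thesis unfolding S2(1)[of n] unfolding E_def S_def .
qed

text \<open>The tail variance \<open>T m\<close> tends to 0 and bounds, through the maximal
  inequality, the probability that some partial sum started at m is large. Outside a null set each
  tolerance 1/(j+1) is therefore met by all sums started at a suitable m, which is the Cauchy
  criterion.\<close>

lemma indep_series_summable_AE:
  fixes X :: "nat \<Rightarrow> 'a \<Rightarrow> real"
  assumes ind: "indep_vars (\<lambda>_. borel) X UNIV"
    and int: "\<And>i. integrable M (\<lambda>\<omega>. (X i \<omega>)\<^sup>2)" and mean: "\<And>i. expectation (X i) = 0"
    and summ: "summable (\<lambda>i. expectation (\<lambda>\<omega>. (X i \<omega>)\<^sup>2))"
  shows "AE \<omega> in M. summable (\<lambda>i. X i \<omega>)"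
proof -
  let ?v = "\<lambda>i. expectation (\<lambda>\<omega>. (X i \<omega>)\<^sup>2)"
  have rv [measurable]: "random_variable borel (X i)" for i
    using ind by (auto simp: indep_vars_def)
  have v0: "?v i \<ge> 0" for i by (simp add: integral_nonneg_AE)
  define T where "T m = suminf ?v - (\<Sum>i<m. ?v i)" for m
  have T: "(\<Sum>i=m..<n. ?v i) \<le> T m" for m n
  proof (cases "m \<le> n")
    case True
    have "(\<Sum>i<n. ?v i) = (\<Sum>i<m. ?v i) + (\<Sum>i=m..<n. ?v i)"
      using True by (metis lessThan_atLeast0 le0 sum.atLeastLessThan_concat)
    moreover have "(\<Sum>i<n. ?v i) \<le> suminf ?v" using summ v0 by (intro sum_le_suminf) auto
    ultimately show ?thesis by (simp add: T_def)
  next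
    case False
    then show ?thesis using sum_le_suminf[OF summ, of "{..<m}"] v0 by (simp add: T_def)
  qed
  have "(\<lambda>m. suminf ?v - (\<Sum>i<m. ?v i)) \<longlonglongrightarrow> suminf ?v - suminf ?v"
    by (intro tendsto_diff tendsto_const summable_LIMSEQ summ)
  then have T0: "T \<longlonglongrightarrow> 0" by (simp add: T_def[abs_def])
  define C where "C e m = {\<omega>\<in>space M. \<exists>k. e \<le> \<bar>\<Sum>i=m..<k. X i \<omega>\<bar>}" for e :: real and m
  have C_meas [measurable]: "C e m \<in> sets M" for e m unfolding C_def by measurable
  have C_le: "prob (C e m) \<le> T m / e\<^sup>2" if e: "e > 0" for e m
  proof -
    define D where "D n = {\<omega>\<in>space M. \<exists>k\<le>n. e \<le> \<bar>\<Sum>i=m..<k. X i \<omega>\<bar>}" for n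
    have "(\<lambda>n. prob (D n)) \<longlonglongrightarrow> prob (\<Union>n. D n)"
      by (rule finite_Lim_measure_incseq)
        (auto simp: D_def incseq_def intro: order_trans)
    moreover have "(\<Union>n. D n) = C e m" by (auto simp: D_def C_def)
    moreover have "prob (D n) \<le> T m / e\<^sup>2" for n
      unfolding D_def using kolmogorov_inequality[OF ind int mean e, of n m] T[of m n] e
      by (meson divide_right_mono order_trans zero_le_power2)
    ultimately show ?thesis by (auto intro: LIMSEQ_le_const2)
  qed
  have "AE \<omega> in M. \<exists>m. \<omega> \<notin> C (1 / real (Suc j)) m" for j
  proof (rule AE_I')
    let ?e = "1 / real (Suc j)" and ?N = "\<Inter>m. C (1 / real (Suc j)) m"
    have "prob ?N \<le> T m / ?e\<^sup>2" for m
      by (rule order_trans[OF finite_measure_mono C_le]) auto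
    then have "prob ?N \<le> 0 / ?e\<^sup>2"
      by (intro LIMSEQ_le_const[OF tendsto_divide[OF T0 tendsto_const]]) auto
    then have "prob ?N = 0" by (intro antisym measure_nonneg) simp
    then show "?N \<in> null_sets M" by (auto simp: null_sets_def emeasure_eq_measure)
    show "{\<omega> \<in> space M. \<not> (\<exists>m. \<omega> \<notin> C ?e m)} \<subseteq> ?N" by auto
  qed
  then have "AE \<omega> in M. \<forall>j. \<exists>m. \<omega> \<notin> C (1 / real (Suc j)) m"
    by (simp add: AE_all_countable)
  with AE_space show ?thesis
  proof eventually_elim
    fix \<omega> assume \<omega>: "\<omega> \<in> space M" "\<forall>j. \<exists>m. \<omega> \<notin> C (1 / real (Suc j)) m"
    show "summable (\<lambda>i. X i \<omega>)"
      unfolding summable_Cauchy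
    proof (intro allI impI)
      fix e :: real assume "e > 0"
      \<comment> \<open>Half of e, since a block from k to n is the difference of two blocks that
        start at m.\<close>
      then obtain j where j: "1 / real (Suc j) < e / 2" using nat_approx_posE[of "e / 2"] by auto
      obtain m where m: "\<omega> \<notin> C (1 / real (Suc j)) m" using \<omega>(2) by blast
      have small: "\<bar>\<Sum>i=m..<k. X i \<omega>\<bar> < e / 2" for k
      proof -
        have "\<bar>\<Sum>i=m..<k. X i \<omega>\<bar> < 1 / real (Suc j)"
          using m \<omega>(1) unfolding C_def mem_Collect_eq not_ex de_Morgan_conj not_le by blast
        with j show ?thesis by linarith
      qed
      show "\<exists>N. \<forall>m\<ge>N. \<forall>n. norm (\<Sum>i=m..<n. X i \<omega>) < e"
      proof (intro exI allI impI)
        fix k n assume "m \<le> k"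
        show "norm (\<Sum>i=k..<n. X i \<omega>) < e"
        proof (cases "k \<le> n")
          case True
          then have "(\<Sum>i=m..<k. X i \<omega>) + (\<Sum>i=k..<n. X i \<omega>) = (\<Sum>i=m..<n. X i \<omega>)"
            using \<open>m \<le> k\<close> by (intro sum.atLeastLessThan_concat)
          with small[of k] small[of n] show ?thesis unfolding real_norm_def by linarith
        qed (use \<open>e > 0\<close> in simp)
      qed
    qed
  qed
qed

text \<open>Besides the moments, crude constants suffice later. The density is at most 1/2, so
  [-\<eta>, \<eta>] has mass at most \<eta>; by symmetry each half-line has mass at least 1/2;
  removing [-1/4, 1/4] from the positive one leaves at least 1/4.\<close>

lemma std_normal_law:
  assumes [measurable]: "Z \<in> borel_measurable M" and law: "distr M borel Z = std_normal_distribution"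
  shows "integrable M (\<lambda>\<omega>. (Z \<omega>)\<^sup>2)"
    and "expectation (\<lambda>\<omega>. (Z \<omega>)\<^sup>2) = 1"
    and "expectation Z = 0"
    and "\<eta> \<ge> 0 \<Longrightarrow> prob {\<omega>\<in>space M. \<bar>Z \<omega>\<bar> \<le> \<eta>} \<le> \<eta>"
    and "prob {\<omega>\<in>space M. Z \<omega> \<le> 0} \<ge> 1 / 2"
    and "prob {\<omega>\<in>space M. Z \<omega> \<ge> 1 / 4} \<ge> 1 / 4"
proof -
  interpret N: real_distribution std_normal_distribution by (rule real_dist_normal_dist)
  have sq: "integrable std_normal_distribution (\<lambda>x. x\<^sup>2)"
    by (rule integrable_std_normal_distribution_moment)
  then show "integrable M (\<lambda>\<omega>. (Z \<omega>)\<^sup>2)"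
    unfolding law[symmetric] by (subst (asm) integrable_distr_eq) auto
  have "expectation (\<lambda>\<omega>. (Z \<omega>)\<^sup>2) = (LINT x|std_normal_distribution. x\<^sup>2)"
    unfolding law[symmetric] by (subst integral_distr) auto
  then show "expectation (\<lambda>\<omega>. (Z \<omega>)\<^sup>2) = 1"
    using std_normal_distribution_even_moments(1)[of 1] by simp
  have "expectation Z = (LINT x|std_normal_distribution. x)"
    unfolding law[symmetric] by (subst integral_distr) auto
  then show "expectation Z = 0"
    using integral_std_normal_distribution_moment_odd[of 1] by simp
  have prob_eq: "prob {\<omega>\<in>space M. Z \<omega> \<in> A} = N.prob A" if "A \<in> sets borel" for A
    unfolding law[symmetric] using that by (subst measure_distr) (auto simp: vimage_def Int_def conj_commute)
  have mu: "N.prob A = (\<integral>x. indicator A x * std_normal_density x \<partial>lborel)" if [measurable]: "A \<in> sets borel" for A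
  proof -
    have "N.prob A = (LINT x|std_normal_distribution. indicator A x)" by simp
    also have "\<dots> = (\<integral>x. std_normal_density x *\<^sub>R indicator A x \<partial>lborel)"
      by (rule integral_density) auto
    finally show ?thesis by (simp add: mult.commute)
  qed
  have dens: "std_normal_density x \<le> 1 / 2" for x
  proof -
    have "2 \<le> sqrt (2 * pi)" using pi_ge_two by (intro real_le_rsqrt) simp
    then have "1 / sqrt (2 * pi) \<le> 1 / 2" by (intro divide_left_mono) auto
    moreover have "exp (- x\<^sup>2 / 2) \<le> 1" by simp
    ultimately have "1 / sqrt (2 * pi) * exp (- x\<^sup>2 / 2) \<le> 1 / 2 * 1" by (intro mult_mono) auto
    then show ?thesis unfolding std_normal_density_def by simp
  qed
  have small: "N.prob {-\<eta>..\<eta>} \<le> \<eta>" if "\<eta> \<ge> 0" for \<eta>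
  proof -
    have "N.prob {-\<eta>..\<eta>} \<le> (\<integral>x. indicator {-\<eta>..\<eta>} x * (1 / 2) \<partial>lborel)"
      unfolding mu[of "{-\<eta>..\<eta>}", simplified]
    proof (rule integral_mono)
      show "integrable lborel (\<lambda>x. indicator {-\<eta>..\<eta>} x * std_normal_density x)"
        using integrable_mult_indicator[of "{-\<eta>..\<eta>}" lborel std_normal_density] by simp
      show "integrable lborel (\<lambda>x. indicator {-\<eta>..\<eta>} x * (1 / 2) :: real)"
        by (intro integrable_mult_left integrable_real_indicator) (auto simp: emeasure_lborel_Icc_eq)
    qed (use dens in \<open>auto simp: indicator_def\<close>)
    also have "\<dots> = \<eta>" using that by simp
    finally show ?thesis .
  qed
  show "prob {\<omega>\<in>space M. \<bar>Z \<omega>\<bar> \<le> \<eta>} \<le> \<eta>" if "\<eta> \<ge> 0" for \<eta>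
    using prob_eq[of "{-\<eta>..\<eta>}"] small[OF that] by (simp add: abs_le_iff conj_commute minus_le_iff)
  have sym: "N.prob {..0} = N.prob {0..}"
  proof -
    have "N.prob {..0} = (\<integral>x. indicator {..0} x * std_normal_density x \<partial>lborel)" by (rule mu) simp
    also have "\<dots> = (\<integral>x. indicator {..0} (0 + (-1) * x) * std_normal_density (0 + (-1) * x) \<partial>lborel)"
      using lborel_integral_real_affine[of "-1" "\<lambda>x. indicator {..0} x * std_normal_density x" 0] by simp
    also have "\<dots> = (\<integral>x. indicator {0..} x * std_normal_density x \<partial>lborel)"
      by (intro Bochner_Integration.integral_cong) (auto simp: indicator_def std_normal_density_def)
    also have "\<dots> = N.prob {0..}" by (rule mu[symmetric]) simp
    finally show ?thesis .
  qed
  have "1 = N.prob ({..0} \<union> {0..})"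
  proof -
    have "{..0} \<union> {0..} = (UNIV :: real set)" by auto
    then show ?thesis using N.prob_space by simp
  qed
  also have "\<dots> \<le> N.prob {..0} + N.prob {0..}" by (rule measure_Un_le) auto
  finally have half: "N.prob {..0} \<ge> 1 / 2" "N.prob {0..} \<ge> 1 / 2" using sym by simp_all
  show "prob {\<omega>\<in>space M. Z \<omega> \<le> 0} \<ge> 1 / 2"
    using prob_eq[of "{..0}"] half by simp
  have "N.prob {0..} \<le> N.prob ({1/4..} \<union> {-(1/4)..1/4})"
    by (rule N.finite_measure_mono) auto
  also have "\<dots> \<le> N.prob {1/4..} + N.prob {-(1/4)..1/4}" by (rule measure_Un_le) auto
  finally have "N.prob {1/4..} \<ge> 1 / 4" using half small[of "1/4"] by simp
  then show "prob {\<omega>\<in>space M. Z \<omega> \<ge> 1 / 4} \<ge> 1 / 4"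
    using prob_eq[of "{1/4..}"] by simp
qed

text \<open>Only the squares of the coefficients are assumed summable, so the limit exists almost
  surely rather than absolutely. Grouping by the increments of \<open>D\<close> gives an ordinary
  series of independent centred terms. The law of the limit follows from convergence of the
  characteristic functions and the uniqueness theorem.\<close>

lemma gaussian_series:
  fixes \<xi> :: "'i \<Rightarrow> 'a \<Rightarrow> real" and D :: "nat \<Rightarrow> 'i set"
  assumes ind: "indep_vars (\<lambda>_. borel) \<xi> I"
    and nrm: "\<And>m. m \<in> I \<Longrightarrow> distr M borel (\<xi> m) = std_normal_distribution"
    and fin: "\<And>R. finite (D R)" and inc: "incseq D" and DI: "\<And>R. D R \<subseteq> I"
    and lim: "(\<lambda>R. \<Sum>m\<in>D R. (a m)\<^sup>2) \<longlonglongrightarrow> \<sigma>\<^sup>2" and \<sigma>: "\<sigma> > 0"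
  shows "AE \<omega> in M. convergent (\<lambda>R. \<Sum>m\<in>D R. a m * \<xi> m \<omega>)"
    and "distr M borel (\<lambda>\<omega>. lim (\<lambda>R. \<Sum>m\<in>D R. a m * \<xi> m \<omega>) / \<sigma>) = std_normal_distribution"
proof -
  have rv: "random_variable borel (\<xi> m)" if "m \<in> I" for m
    using ind that by (auto simp: indep_vars_def)
  \<comment> \<open>Increments of the exhaustion, starting with \<open>D 0\<close> itself, so that
    the blocks up to R together make up \<open>D R\<close>.\<close>
  define E where "E R = (case R of 0 \<Rightarrow> D 0 | Suc k \<Rightarrow> D (Suc k) - D k)" for R
  have ED: "E R \<subseteq> D R" for R by (auto simp: E_def split: nat.split)
  have finE: "finite (E R)" for R using ED fin by (rule finite_subset)
  have EI: "E R \<subseteq> I" for R using ED DI by blast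
  have block: "(\<Sum>i<Suc R. sum f (E i)) = sum f (D R)" for R and f :: "'i \<Rightarrow> real"
  proof (induction R)
    case (Suc R)
    have "D (Suc R) = D R \<union> E (Suc R)" using incseq_SucD[OF inc] by (auto simp: E_def)
    moreover have "D R \<inter> E (Suc R) = {}" by (auto simp: E_def)
    ultimately show ?case using Suc fin finE by (simp add: sum.union_disjoint)
  qed (simp add: E_def)
  have disj: "disjoint_family E"
  proof -
    have "E i \<inter> E j = {}" if ij: "i < j" for i j
    proof -
      obtain k where "j = Suc k" "i \<le> k" using ij by (cases j) auto
      then show ?thesis using ED[of i] incseqD[OF inc, of i k] by (auto simp: E_def)
    qed
    then show ?thesis unfolding disjoint_family_on_def
      by (metis Int_commute linorder_neqE_nat)
  qed
  define X where "X m \<omega> = a m * \<xi> m \<omega>" for m \<omega>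
  have Xind: "indep_vars (\<lambda>_. borel) X I"
    unfolding X_def[abs_def] by (rule indep_vars_compose2[OF ind, of "\<lambda>m x. a m * x"]) auto
  have Xsq: "integrable M (\<lambda>\<omega>. (X m \<omega>)\<^sup>2)" "expectation (\<lambda>\<omega>. (X m \<omega>)\<^sup>2) = (a m)\<^sup>2"
    "expectation (X m) = 0" "integrable M (X m)" if "m \<in> I" for m
  proof -
    note f = std_normal_law[OF rv[OF that] nrm[OF that]]
    show "integrable M (\<lambda>\<omega>. (X m \<omega>)\<^sup>2)" "expectation (\<lambda>\<omega>. (X m \<omega>)\<^sup>2) = (a m)\<^sup>2"
      "expectation (X m) = 0" using f(1-3) by (simp_all add: X_def[abs_def] power_mult_distrib)
    show "integrable M (X m)"
      using square_integrable_imp_integrable[OF rv[OF that] f(1)] by (simp add: X_def[abs_def])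
  qed
  define Y where "Y R \<omega> = (\<Sum>m\<in>E R. X m \<omega>)" for R \<omega>
  have "indep_vars (\<lambda>_. borel) (\<lambda>R \<omega>. (\<Sum>m\<in>E R. restrict (\<lambda>m. X m \<omega>) (E R) m)) UNIV"
  proof (rule indep_vars_compose2[OF indep_vars_restrict[OF Xind]])
    show "(\<lambda>x. \<Sum>m\<in>E R. x m) \<in> borel_measurable (PiM (E R) (\<lambda>_. borel :: real measure))" for R
      by (intro borel_measurable_sum measurable_component_singleton)
  qed (use EI disj in auto)
  then have Yind: "indep_vars (\<lambda>_. borel) Y UNIV" by (simp add: Y_def[abs_def])
  have Ysq: "expectation (\<lambda>\<omega>. (Y R \<omega>)\<^sup>2) = (\<Sum>m\<in>E R. (a m)\<^sup>2)" "integrable M (\<lambda>\<omega>. (Y R \<omega>)\<^sup>2)" for R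
  proof -
    have EI': "m \<in> I" if "m \<in> E R" for m using EI that by blast
    note e = expectation_square_indep_sum[OF finE[of R] indep_vars_subset[OF Xind EI[of R]] Xsq(1)[OF EI'] Xsq(3)[OF EI']]
    show "integrable M (\<lambda>\<omega>. (Y R \<omega>)\<^sup>2)" using e(2) by (simp add: Y_def)
    show "expectation (\<lambda>\<omega>. (Y R \<omega>)\<^sup>2) = (\<Sum>m\<in>E R. (a m)\<^sup>2)"
      using e(1) by (simp add: Y_def Xsq(2)[OF EI'])
  qed
  have Ymean: "expectation (Y R) = 0" for R
    unfolding Y_def[abs_def] using EI Xsq
    by (subst Bochner_Integration.integral_sum) (auto simp: subset_iff intro!: sum.neutral)
  have "summable (\<lambda>R. \<Sum>m\<in>E R. (a m)\<^sup>2)"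
  proof (rule sums_summable)
    have "(\<lambda>R. \<Sum>i<Suc R. \<Sum>m\<in>E i. (a m)\<^sup>2) \<longlonglongrightarrow> \<sigma>\<^sup>2" unfolding block by (rule lim)
    then show "(\<lambda>R. \<Sum>m\<in>E R. (a m)\<^sup>2) sums \<sigma>\<^sup>2"
      unfolding sums_def by (rule LIMSEQ_imp_Suc)
  qed
  then have "AE \<omega> in M. summable (\<lambda>R. Y R \<omega>)"
    by (intro indep_series_summable_AE[OF Yind Ysq(2) Ymean]) (simp add: Ysq(1))
  then show conv: "AE \<omega> in M. convergent (\<lambda>R. \<Sum>m\<in>D R. a m * \<xi> m \<omega>)"
  proof eventually_elim
    fix \<omega> assume "summable (\<lambda>R. Y R \<omega>)"
    then have "(\<lambda>R. \<Sum>i<Suc R. Y i \<omega>) \<longlonglongrightarrow> suminf (\<lambda>R. Y R \<omega>)"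
      by (intro LIMSEQ_Suc summable_LIMSEQ)
    then show "convergent (\<lambda>R. \<Sum>m\<in>D R. a m * \<xi> m \<omega>)"
      unfolding Y_def block X_def by (rule convergentI)
  qed
  define S where "S R \<omega> = (\<Sum>m\<in>D R. a m * \<xi> m \<omega>)" for R \<omega>
  \<comment> \<open>Where the partial sums diverge, \<open>lim\<close> is an unspecified value; this
    concerns a null set only, and \<open>U\<close> is measurable all the same.\<close>
  define U where "U \<omega> = lim (\<lambda>R. S R \<omega>)" for \<omega>
  have S_meas [measurable]: "S R \<in> borel_measurable M" for R
    unfolding S_def[abs_def] using rv DI by (intro borel_measurable_sum borel_measurable_times) auto
  have U_meas [measurable]: "U \<in> borel_measurable M"
    unfolding U_def[abs_def] by measurable
  have SU: "AE \<omega> in M. (\<lambda>R. S R \<omega>) \<longlonglongrightarrow> U \<omega>"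
    using conv unfolding U_def S_def[symmetric] by eventually_elim (simp add: convergent_LIMSEQ_iff)
  have charS: "(CLINT \<omega>|M. iexp (t * (S R \<omega> / \<sigma>))) = exp (- (t\<^sup>2 / \<sigma>\<^sup>2 * (\<Sum>m\<in>D R. (a m)\<^sup>2)) / 2)" for t R
  proof -
    define W where "W m \<omega> = (a m / \<sigma>) * \<xi> m \<omega>" for m \<omega>
    have Wm: "W m \<in> borel_measurable M" if "m \<in> I" for m
      unfolding W_def[abs_def] using rv[OF that] by simp
    have "indep_vars (\<lambda>_. borel) W (D R)"
      unfolding W_def[abs_def]
      by (rule indep_vars_subset[OF indep_vars_compose2[OF ind, of "\<lambda>m x. a m / \<sigma> * x"] DI]) auto
    from char_distr_sum[OF this, of t]
    have "char (distr M borel (\<lambda>\<omega>. \<Sum>m\<in>D R. W m \<omega>)) t = (\<Prod>m\<in>D R. char (distr M borel (W m)) t)" .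
    also have "\<dots> = (\<Prod>m\<in>D R. complex_of_real (exp (- (t * (a m / \<sigma>))\<^sup>2 / 2)))"
    proof (intro prod.cong refl)
      fix m assume "m \<in> D R"
      then have m: "m \<in> I" using DI by blast
      have "char (distr M borel (W m)) t = (CLINT \<omega>|M. iexp (t * (a m / \<sigma>) * \<xi> m \<omega>))"
        unfolding char_def using Wm[OF m] by (subst integral_distr) (auto simp: W_def mult.assoc)
      also have "\<dots> = char (distr M borel (\<xi> m)) (t * (a m / \<sigma>))"
        unfolding char_def using rv[OF m] by (subst integral_distr) auto
      also have "\<dots> = complex_of_real (exp (- (t * (a m / \<sigma>))\<^sup>2 / 2))"
        unfolding nrm[OF m] char_std_normal_distribution by simp
      finally show "char (distr M borel (W m)) t = complex_of_real (exp (- (t * (a m / \<sigma>))\<^sup>2 / 2))" .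
    qed
    also have "\<dots> = complex_of_real (exp (\<Sum>m\<in>D R. - (t * (a m / \<sigma>))\<^sup>2 / 2))"
      by (simp add: exp_sum[OF fin])
    also have "(\<Sum>m\<in>D R. - (t * (a m / \<sigma>))\<^sup>2 / 2) = - (t\<^sup>2 / \<sigma>\<^sup>2 * (\<Sum>m\<in>D R. (a m)\<^sup>2)) / 2"
      by (simp add: sum_distrib_left sum_divide_distrib sum_negf power_mult_distrib power_divide)
    also have "(\<lambda>\<omega>. \<Sum>m\<in>D R. W m \<omega>) = (\<lambda>\<omega>. S R \<omega> / \<sigma>)"
      by (simp add: W_def S_def sum_divide_distrib fun_eq_iff)
    also have "char (distr M borel (\<lambda>\<omega>. S R \<omega> / \<sigma>)) t = (CLINT \<omega>|M. iexp (t * (S R \<omega> / \<sigma>)))"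
      unfolding char_def by (subst integral_distr) auto
    finally show ?thesis .
  qed
  have "char (distr M borel (\<lambda>\<omega>. U \<omega> / \<sigma>)) t = char std_normal_distribution t" for t
  proof -
    have "(\<lambda>R. CLINT \<omega>|M. iexp (t * (S R \<omega> / \<sigma>))) \<longlonglongrightarrow> (CLINT \<omega>|M. iexp (t * (U \<omega> / \<sigma>)))"
    proof (rule integral_dominated_convergence[where w = "\<lambda>_. 1"])
      show "AE \<omega> in M. (\<lambda>R. iexp (t * (S R \<omega> / \<sigma>))) \<longlonglongrightarrow> iexp (t * (U \<omega> / \<sigma>))"
        using SU
      proof eventually_elim
        fix \<omega> assume "(\<lambda>R. S R \<omega>) \<longlonglongrightarrow> U \<omega>"
        then show "(\<lambda>R. iexp (t * (S R \<omega> / \<sigma>))) \<longlonglongrightarrow> iexp (t * (U \<omega> / \<sigma>))"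
          using \<sigma> by (intro tendsto_intros) auto
      qed
    qed auto
    moreover have "(\<lambda>R. complex_of_real (exp (- (t\<^sup>2 / \<sigma>\<^sup>2 * (\<Sum>m\<in>D R. (a m)\<^sup>2)) / 2)))
        \<longlonglongrightarrow> complex_of_real (exp (- (t\<^sup>2 / \<sigma>\<^sup>2 * \<sigma>\<^sup>2) / 2))"
      by (intro tendsto_intros lim) simp
    ultimately have "(CLINT \<omega>|M. iexp (t * (U \<omega> / \<sigma>))) = complex_of_real (exp (- (t\<^sup>2 / \<sigma>\<^sup>2 * \<sigma>\<^sup>2) / 2))"
      unfolding charS by (rule LIMSEQ_unique)
    also have "(CLINT \<omega>|M. iexp (t * (U \<omega> / \<sigma>))) = char (distr M borel (\<lambda>\<omega>. U \<omega> / \<sigma>)) t"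
      unfolding char_def by (subst integral_distr) auto
    finally show ?thesis using \<sigma> by (simp add: char_std_normal_distribution)
  qed
  then have "char (distr M borel (\<lambda>\<omega>. U \<omega> / \<sigma>)) = char std_normal_distribution" by auto
  moreover have "(\<lambda>\<omega>. U \<omega> / \<sigma>) \<in> borel_measurable M" by measurable
  ultimately have "distr M borel (\<lambda>\<omega>. U \<omega> / \<sigma>) = std_normal_distribution"
    by (intro Levy_uniqueness real_distribution_distr real_dist_normal_dist)
  then show "distr M borel (\<lambda>\<omega>. lim (\<lambda>R. \<Sum>m\<in>D R. a m * \<xi> m \<omega>) / \<sigma>) = std_normal_distribution"
    by (simp add: U_def[abs_def] S_def)
qed

end

section \<open>The Gaussian sample on the grid\<close>

text \<open>High probability in the outer sense: the exceptional set need not be measurable, only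
  covered by a measurable set of small measure. Statements about all minimisers involve uncountably
  many t, and \<open>argmin_conv_prob\<close> has the same form.\<close>

definition whp :: "'w measure \<Rightarrow> (nat \<Rightarrow> 'w \<Rightarrow> bool) \<Rightarrow> bool" where
  "whp M P \<longleftrightarrow> (\<forall>\<eta>>0. \<forall>\<^sub>F q in sequentially. \<exists>A\<in>sets M. {\<omega>\<in>space M. \<not> P q \<omega>} \<subseteq> A \<and> measure M A < \<eta>)"

lemma (in finite_measure) whp_conj:
  assumes "whp M P" "whp M Q"
  shows "whp M (\<lambda>q \<omega>. P q \<omega> \<and> Q q \<omega>)"
  unfolding whp_def
proof (intro allI impI)
  fix \<eta> :: real assume "\<eta> > 0"
  then have h: "\<eta> / 2 > 0" by simp
  have "\<forall>\<^sub>F q in sequentially. \<exists>A\<in>sets M. {\<omega>\<in>space M. \<not> P q \<omega>} \<subseteq> A \<and> measure M A < \<eta> / 2"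
    "\<forall>\<^sub>F q in sequentially. \<exists>A\<in>sets M. {\<omega>\<in>space M. \<not> Q q \<omega>} \<subseteq> A \<and> measure M A < \<eta> / 2"
    using assms h unfolding whp_def by blast+
  then show "\<forall>\<^sub>F q in sequentially. \<exists>A\<in>sets M. {\<omega>\<in>space M. \<not> (P q \<omega> \<and> Q q \<omega>)} \<subseteq> A \<and> measure M A < \<eta>"
  proof eventually_elim
    case (elim q)
    then obtain A B where AB: "A \<in> sets M" "{\<omega>\<in>space M. \<not> P q \<omega>} \<subseteq> A" "measure M A < \<eta> / 2"
      "B \<in> sets M" "{\<omega>\<in>space M. \<not> Q q \<omega>} \<subseteq> B" "measure M B < \<eta> / 2" by blast
    have "measure M (A \<union> B) < \<eta>"
      using measure_Un_le[of A M B] AB by linarith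
    with AB show ?case
      by (intro bexI[of _ "A \<union> B"]) auto
  qed
qed

lemma whp_mono:
  assumes "whp M P" "\<forall>\<^sub>F q in sequentially. \<forall>\<omega>\<in>space M. P q \<omega> \<longrightarrow> Q q \<omega>"
  shows "whp M Q"
  unfolding whp_def
proof (intro allI impI)
  fix \<eta> :: real assume "\<eta> > 0"
  with assms(1) have "\<forall>\<^sub>F q in sequentially. \<exists>A\<in>sets M. {\<omega>\<in>space M. \<not> P q \<omega>} \<subseteq> A \<and> measure M A < \<eta>"
    unfolding whp_def by blast
  with assms(2) show "\<forall>\<^sub>F q in sequentially. \<exists>A\<in>sets M. {\<omega>\<in>space M. \<not> Q q \<omega>} \<subseteq> A \<and> measure M A < \<eta>"
  proof eventually_elim
    case (elim q)
    then obtain A where A: "A \<in> sets M" "{\<omega>\<in>space M. \<not> P q \<omega>} \<subseteq> A" "measure M A < \<eta>" by blast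
    with elim(1) show ?case
      by (intro bexI[of _ A]) auto
  qed
qed

lemma whp_AE:
  assumes "AE \<omega> in M. \<forall>q. P q \<omega>"
  shows "whp M P"
proof -
  obtain N where N: "{\<omega>\<in>space M. \<not> (\<forall>q. P q \<omega>)} \<subseteq> N" "emeasure M N = 0" "N \<in> sets M"
    using assms by (auto elim: AE_E)
  have "measure M N = 0" using N(2) by (simp add: measure_def)
  with N show ?thesis unfolding whp_def
    by (intro allI impI always_eventually bexI[of _ N]) auto
qed

lemma whp_tendsto_0:
  assumes "\<forall>\<^sub>F q in sequentially. {\<omega>\<in>space M. \<not> P q \<omega>} \<in> sets M \<and> measure M {\<omega>\<in>space M. \<not> P q \<omega>} \<le> b q"
    and "b \<longlonglongrightarrow> 0"
  shows "whp M P"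
  unfolding whp_def
proof (intro allI impI)
  fix \<eta> :: real assume "\<eta> > 0"
  with assms(2) have "\<forall>\<^sub>F q in sequentially. b q < \<eta>" by (rule order_tendstoD)
  with assms(1) show "\<forall>\<^sub>F q in sequentially. \<exists>A\<in>sets M. {\<omega>\<in>space M. \<not> P q \<omega>} \<subseteq> A \<and> measure M A < \<eta>"
    by eventually_elim (auto intro: le_less_trans)
qed

lemma (in prob_space) whp_markov:
  fixes X :: "nat \<Rightarrow> 'a \<Rightarrow> real"
  assumes "\<forall>\<^sub>F q in sequentially. integrable M (X q) \<and> (\<forall>\<omega>. 0 \<le> X q \<omega>) \<and> expectation (X q) \<le> b q \<and> c q > 0"
    and "(\<lambda>q. b q / c q) \<longlonglongrightarrow> 0"
  shows "whp M (\<lambda>q \<omega>. X q \<omega> < c q)"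
proof (rule whp_tendsto_0[OF _ assms(2)])
  show "\<forall>\<^sub>F q in sequentially. {\<omega>\<in>space M. \<not> X q \<omega> < c q} \<in> sets M \<and>
      measure M {\<omega>\<in>space M. \<not> X q \<omega> < c q} \<le> b q / c q"
    using assms(1)
  proof eventually_elim
    case q: (elim q)
    then have [measurable]: "X q \<in> borel_measurable M" by auto
    have "{\<omega>\<in>space M. \<not> X q \<omega> < c q} = {\<omega>\<in>space M. c q \<le> X q \<omega>}" by (auto simp: not_less)
    moreover have "prob {\<omega>\<in>space M. c q \<le> X q \<omega>} \<le> expectation (X q) / c q"
      using q by (intro integral_Markov_inequality_measure[where A = "{}"]) auto
    moreover have "expectation (X q) / c q \<le> b q / c q" using q by (intro divide_right_mono) auto
    ultimately show ?case by auto
  qed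
qed

text \<open>A smaller \<epsilon> gives a stronger statement, so any positive upper bound may be
  imposed on it. The Kernel Flow argument uses this to keep \<epsilon> below the target and below
  1.\<close>

lemma argmin_conv_probI:
  assumes "\<And>\<epsilon>. 0 < \<epsilon> \<Longrightarrow> \<epsilon> < bnd \<Longrightarrow> whp M (\<lambda>q \<omega>. \<forall>t\<in>S q \<omega>. \<bar>t - s0\<bar> \<le> \<epsilon>)" "bnd > 0"
  shows "argmin_conv_prob M S s0"
  unfolding argmin_conv_prob_def
proof (intro allI impI)
  fix \<epsilon> \<eta> :: real assume e: "\<epsilon> > 0" "\<eta> > 0"
  define e1 where "e1 = min \<epsilon> (bnd / 2)"
  have e1: "0 < e1" "e1 < bnd" "e1 \<le> \<epsilon>" using e assms(2) by (auto simp: e1_def)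
  have "\<forall>\<^sub>F q in sequentially. \<exists>A\<in>sets M. {\<omega>\<in>space M. \<not> (\<forall>t\<in>S q \<omega>. \<bar>t - s0\<bar> \<le> e1)} \<subseteq> A \<and> measure M A < \<eta>"
    using assms(1)[OF e1(1,2)] e(2) unfolding whp_def by blast
  then show "\<forall>\<^sub>F q in sequentially. \<exists>A\<in>sets M. {\<omega>\<in>space M. \<exists>t\<in>S q \<omega>. \<bar>t - s0\<bar> > \<epsilon>} \<subseteq> A \<and> measure M A < \<eta>"
  proof eventually_elim
    case (elim q)
    then obtain A where A: "A \<in> sets M" "{\<omega>\<in>space M. \<not> (\<forall>t\<in>S q \<omega>. \<bar>t - s0\<bar> \<le> e1)} \<subseteq> A" "measure M A < \<eta>" by blast
    have "{\<omega>\<in>space M. \<exists>t\<in>S q \<omega>. \<bar>t - s0\<bar> > \<epsilon>} \<subseteq> {\<omega>\<in>space M. \<not> (\<forall>t\<in>S q \<omega>. \<bar>t - s0\<bar> \<le> e1)}"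
      using e1(3) by force
    with A show ?case
      by (meson subset_trans)
  qed
qed

text \<open>The pairs {r, f r} are disjoint because f is injective on A and maps A off itself, so
  they are disjoint blocks of independent variables.\<close>

lemma (in prob_space) indep_vars_pairs:
  assumes "indep_vars (\<lambda>_. borel) X I" "inj_on f A" "f ` A \<inter> A = {}" "A \<union> f ` A \<subseteq> I"
  shows "indep_vars (\<lambda>_. borel \<Otimes>\<^sub>M borel) (\<lambda>r \<omega>. (X r \<omega>, X (f r) \<omega>)) A"
proof -
  have "indep_vars (\<lambda>r. borel \<Otimes>\<^sub>M borel) (\<lambda>r \<omega>. (restrict (\<lambda>i. X i \<omega>) {r, f r} r, restrict (\<lambda>i. X i \<omega>) {r, f r} (f r))) A"
  proof (rule indep_vars_compose2[OF indep_vars_restrict[OF assms(1)]])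
    show "disjoint_family_on (\<lambda>r. {r, f r}) A"
      using assms(2,3) by (auto simp: disjoint_family_on_def inj_on_def)
    show "(\<lambda>x. (x r, x (f r))) \<in> measurable (Pi\<^sub>M {r, f r} (\<lambda>_. borel)) (borel \<Otimes>\<^sub>M borel)" for r
      by (intro measurable_Pair measurable_component_singleton) auto
  qed (use assms(4) in auto)
  then show ?thesis by simp
qed

text \<open>Chebyshev's inequality: each centred indicator has variance at most 1, so the count has
  variance at most |A|, while failure means a deviation of at least p |A|/2 from the mean.\<close>

lemma (in prob_space) prob_few_successes:
  fixes Y :: "'i \<Rightarrow> 'a \<Rightarrow> 'b"
  assumes ind: "indep_vars (\<lambda>_. N) Y A" and fin: "finite A" and "A \<noteq> {}"
    and E [measurable]: "E \<in> sets N" and p: "\<And>i. i \<in> A \<Longrightarrow> prob {\<omega>\<in>space M. Y i \<omega> \<in> E} \<ge> p" "p > 0"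
  shows "{\<omega>\<in>space M. \<not> p * card A / 2 \<le> card {i\<in>A. Y i \<omega> \<in> E}} \<in> sets M"
    and "prob {\<omega>\<in>space M. \<not> p * card A / 2 \<le> card {i\<in>A. Y i \<omega> \<in> E}} \<le> 4 / (p\<^sup>2 * card A)"
proof -
  have rv [measurable]: "random_variable N (Y i)" if "i \<in> A" for i
    using ind that by (auto simp: indep_vars_def)
  define P where "P i = prob {\<omega>\<in>space M. Y i \<omega> \<in> E}" for i
  define X where "X i \<omega> = indicator E (Y i \<omega>) - P i" for i \<omega>
  have Xm [measurable]: "X i \<in> borel_measurable M" if "i \<in> A" for i
    unfolding X_def[abs_def] using rv[OF that] by measurable
  have Xind: "indep_vars (\<lambda>_. borel) X A"
    unfolding X_def[abs_def] by (rule indep_vars_compose2[OF ind, of "\<lambda>i y. indicator E y - P i"]) measurable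
  have P01: "0 \<le> P i" "P i \<le> 1" for i by (auto simp: P_def)
  have Xb: "\<bar>X i \<omega>\<bar> \<le> 1" for i \<omega> using P01[of i] by (auto simp: X_def indicator_def)
  have Xsq: "integrable M (\<lambda>\<omega>. (X i \<omega>)\<^sup>2)" if "i \<in> A" for i
  proof (rule integrable_const_bound[where B = 1])
    show "AE \<omega> in M. norm ((X i \<omega>)\<^sup>2) \<le> 1" using Xb by (intro AE_I2) (simp add: abs_square_le_1)
  qed (use Xm[OF that] in measurable)
  have Xsq1: "expectation (\<lambda>\<omega>. (X i \<omega>)\<^sup>2) \<le> 1" if "i \<in> A" for i
  proof -
    have "expectation (\<lambda>\<omega>. (X i \<omega>)\<^sup>2) \<le> expectation (\<lambda>_. 1)"
      using Xsq[OF that] Xb by (intro integral_mono) (auto simp: abs_square_le_1)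
    then show ?thesis by (simp add: prob_space)
  qed
  have X0: "expectation (X i) = 0" if "i \<in> A" for i
  proof -
    note rv[OF that, measurable]
    have "expectation (\<lambda>\<omega>. indicator E (Y i \<omega>)) = (expectation (indicator {\<omega>\<in>space M. Y i \<omega> \<in> E}) :: real)"
      by (intro Bochner_Integration.integral_cong) (auto simp: indicator_def)
    also have "\<dots> = P i" by (simp add: P_def)
    finally have "expectation (\<lambda>\<omega>. indicator E (Y i \<omega>)) = P i" .
    moreover have "integrable M (\<lambda>\<omega>. indicator E (Y i \<omega>) :: real)"
      by (rule integrable_const_bound[where B = 1]) auto
    ultimately show ?thesis unfolding X_def[abs_def] by (simp add: prob_space)
  qed
  note sq = expectation_square_indep_sum[OF fin Xind Xsq X0]
  have card_eq: "real (card {i\<in>A. Y i \<omega> \<in> E}) = (\<Sum>i\<in>A. indicator E (Y i \<omega>))" for \<omega>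
    using fin by (simp add: indicator_def sum.If_cases Int_def)
  have bad: "{\<omega>\<in>space M. \<not> p * card A / 2 \<le> card {i\<in>A. Y i \<omega> \<in> E}}
      \<subseteq> {\<omega>\<in>space M. (p * card A / 2)\<^sup>2 \<le> (\<Sum>i\<in>A. X i \<omega>)\<^sup>2}"
  proof safe
    fix \<omega> assume "\<omega> \<in> space M" "\<not> p * card A / 2 \<le> card {i\<in>A. Y i \<omega> \<in> E}"
    moreover have "p * card A \<le> (\<Sum>i\<in>A. P i)"
      using sum_mono[of A "\<lambda>_. p" P] p(1) by (simp add: P_def mult.commute)
    ultimately have "p * card A / 2 \<le> - (\<Sum>i\<in>A. X i \<omega>)"
      unfolding X_def sum_subtractf card_eq[symmetric] by linarith
    moreover have "0 \<le> p * card A / 2" using p(2) by simp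
    ultimately have "(p * card A / 2)\<^sup>2 \<le> (- (\<Sum>i\<in>A. X i \<omega>))\<^sup>2" by (intro power_mono)
    then show "(p * card A / 2)\<^sup>2 \<le> (\<Sum>i\<in>A. X i \<omega>)\<^sup>2" by simp
  qed
  show "{\<omega>\<in>space M. \<not> p * card A / 2 \<le> card {i\<in>A. Y i \<omega> \<in> E}} \<in> sets M"
    unfolding card_eq using rv by measurable
  have cA: "real (card A) > 0" using fin \<open>A \<noteq> {}\<close> by (simp add: card_gt_0_iff)
  have Sm [measurable]: "(\<lambda>\<omega>. \<Sum>i\<in>A. X i \<omega>) \<in> borel_measurable M"
    by (intro borel_measurable_sum Xm)
  have "prob {\<omega>\<in>space M. \<not> p * card A / 2 \<le> card {i\<in>A. Y i \<omega> \<in> E}}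
      \<le> prob {\<omega>\<in>space M. (p * card A / 2)\<^sup>2 \<le> (\<Sum>i\<in>A. X i \<omega>)\<^sup>2}"
    by (rule finite_measure_mono[OF bad]) measurable
  also have "\<dots> \<le> expectation (\<lambda>\<omega>. (\<Sum>i\<in>A. X i \<omega>)\<^sup>2) / (p * card A / 2)\<^sup>2"
    using sq(2) cA p(2) by (intro integral_Markov_inequality_measure[where A = "{}"]) auto
  also have "\<dots> \<le> card A / (p * card A / 2)\<^sup>2"
    using sum_mono[of A "\<lambda>i. expectation (\<lambda>\<omega>. (X i \<omega>)\<^sup>2)" "\<lambda>_. 1", OF Xsq1]
    by (intro divide_right_mono) (simp_all add: sq(1))
  also have "\<dots> = 4 / (p\<^sup>2 * card A)"
    using cA p(2) by (simp add: field_simps power2_eq_square)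
  finally show "prob {\<omega>\<in>space M. \<not> p * card A / 2 \<le> card {i\<in>A. Y i \<omega> \<in> E}} \<le> 4 / (p\<^sup>2 * card A)" .
qed

section \<open>The class coefficients of the sample and their joint law\<close>

locale gaussian_coefficients = prob_space M for M :: "'w measure" +
  fixes \<xi> :: "'w \<Rightarrow> ('d::finite \<Rightarrow> int) \<Rightarrow> real" and s :: real
  assumes normal: "\<And>m. m \<noteq> (\<lambda>_. 0) \<Longrightarrow> distributed M lborel (\<lambda>\<omega>. \<xi> \<omega> m) std_normal_density"
    and indep: "indep_vars (\<lambda>_. borel) (\<lambda>m \<omega>. \<xi> \<omega> m) (UNIV - {\<lambda>_. 0})"
    and s_gt: "s > real CARD('d) / 2"
begin

definition acoef :: "('d \<Rightarrow> int) \<Rightarrow> real" where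
  "acoef m = (4 * pi\<^sup>2 * sqn m) powr (- s / 2)"

definition Uc :: "nat \<Rightarrow> ('d \<Rightarrow> int) \<Rightarrow> 'w \<Rightarrow> real" where
  "Uc q r \<omega> = lim (\<lambda>R. \<Sum>m\<in>freq_cube R \<inter> cls q r. acoef m * \<xi> \<omega> m)"

text \<open>The variances \<open>lam s m\<close> add up to \<open>Gw q s r\<close> over the class,
  so this is the standardised class coefficient. Variables with different q live on the same
  probability space; independence is claimed only within one q.\<close>

definition Zc :: "nat \<Rightarrow> ('d \<Rightarrow> int) \<Rightarrow> 'w \<Rightarrow> real" where
  "Zc q r \<omega> = Uc q r \<omega> / sqrt (Gw q s r)"

lemma acoef_sq: "(acoef m)\<^sup>2 = lam s m"
  by (simp add: acoef_def lam_def power2_eq_square flip: powr_add)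

lemma law_xi: "m \<noteq> (\<lambda>_. 0) \<Longrightarrow> distr M borel (\<lambda>\<omega>. \<xi> \<omega> m) = std_normal_distribution"
  using distributed_distr_eq_density[OF normal] by (metis distr_cong sets_lborel)

lemma class_series:
  assumes "r \<in> Jq q"
  shows "AE \<omega> in M. convergent (\<lambda>R. \<Sum>m\<in>freq_cube R \<inter> cls q r. acoef m * \<xi> \<omega> m)"
    and "distr M borel (Zc q r) = std_normal_distribution"
proof -
  have pos: "Gw q s r > 0" by (rule Gw_pos[OF s_gt assms])
  have "(\<lambda>R. \<Sum>m\<in>freq_cube R \<inter> cls q r. lam s m) \<longlonglongrightarrow> Gw q s r"
    unfolding Gw_def
    by (rule has_sum_imp_freq_cube_tendsto[OF has_sum_infsum[OF lam_summable_cls[OF s_gt]] cls_subset])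
  then have lim: "(\<lambda>R. \<Sum>m\<in>freq_cube R \<inter> cls q r. (acoef m)\<^sup>2) \<longlonglongrightarrow> (sqrt (Gw q s r))\<^sup>2"
    using pos by (simp add: acoef_sq)
  have inc: "incseq (\<lambda>R. freq_cube R \<inter> cls q r)"
    using freq_cube_mono by (fastforce simp: incseq_def)
  have sub: "freq_cube R \<inter> cls q r \<subseteq> UNIV - {\<lambda>_. 0}" for R
    by (auto simp: cls_def)
  have law: "distr M borel (\<lambda>\<omega>. \<xi> \<omega> m) = std_normal_distribution" if "m \<in> UNIV - {\<lambda>_. 0}" for m
    using that by (simp add: law_xi)
  have fin: "finite (freq_cube R \<inter> cls q r)" for R by simp
  have "sqrt (Gw q s r) > 0" using pos by simp
  note G = gaussian_series[OF indep law fin inc sub lim this]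
  show "AE \<omega> in M. convergent (\<lambda>R. \<Sum>m\<in>freq_cube R \<inter> cls q r. acoef m * \<xi> \<omega> m)" by (rule G(1))
  show "distr M borel (Zc q r) = std_normal_distribution"
    using G(2) by (simp add: Zc_def[abs_def] Uc_def)
qed

text \<open>Classes are disjoint sets of frequencies, and each limit is a measurable function of its
  own block of variables.\<close>

lemma indep_Zc: "indep_vars (\<lambda>_. borel) (Zc q) (Jq q)"
proof -
  define g where "g r x = lim (\<lambda>R. \<Sum>m\<in>freq_cube R \<inter> cls q r. acoef m * x m) / sqrt (Gw q s r)" for r and x :: "('d \<Rightarrow> int) \<Rightarrow> real"
  have "indep_vars (\<lambda>_. borel) (\<lambda>r \<omega>. g r (restrict (\<lambda>m. \<xi> \<omega> m) (cls q r))) (Jq q)"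
  proof (rule indep_vars_compose2[OF indep_vars_restrict[OF indep]])
    show "disjoint_family_on (cls q) (Jq q)"
      by (auto simp: disjoint_family_on_def cls_def)
    fix r :: "'d \<Rightarrow> int"
    have [measurable]: "(\<lambda>x. \<Sum>m\<in>freq_cube R \<inter> cls q r. acoef m * x m) \<in> borel_measurable (Pi\<^sub>M (cls q r) (\<lambda>_. borel))" for R
      by (intro borel_measurable_sum borel_measurable_times measurable_component_singleton) auto
    show "g r \<in> borel_measurable (Pi\<^sub>M (cls q r) (\<lambda>_. borel))"
      unfolding g_def[abs_def] by measurable
    show "cls q r \<subseteq> UNIV - {\<lambda>_. 0}" by (rule cls_subset)
  qed
  moreover have "g r (restrict (\<lambda>m. \<xi> \<omega> m) (cls q r)) = Zc q r \<omega>" for r \<omega>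
  proof -
    have "(\<Sum>m\<in>freq_cube R \<inter> cls q r. acoef m * restrict (\<lambda>m. \<xi> \<omega> m) (cls q r) m)
        = (\<Sum>m\<in>freq_cube R \<inter> cls q r. acoef m * \<xi> \<omega> m)" for R
      by (intro sum.cong) auto
    then show ?thesis by (simp add: g_def Zc_def Uc_def)
  qed
  ultimately show ?thesis by simp
qed

lemma Zc_measurable: "r \<in> Jq q \<Longrightarrow> Zc q r \<in> borel_measurable M"
  using indep_Zc[of q] by (auto simp: indep_vars_def)

lemmas Zc_law = std_normal_law[OF Zc_measurable class_series(2)]

text \<open>Convergence is required for countably many pairs (q, r) only, so a single null set
  suffices for all grids at once.\<close>

lemma AE_Fd:
  "AE \<omega> in M. \<forall>q. \<forall>r\<in>Jq q. Fd q (ufield s (\<xi> \<omega>)) r = complex_of_real (sqrt (Gw q s r) * Zc q r \<omega>)"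
proof -
  have "AE \<omega> in M. \<forall>q. \<forall>r\<in>Jq q. convergent (\<lambda>R. \<Sum>m\<in>freq_cube R \<inter> cls q r. acoef m * \<xi> \<omega> m)"
    using class_series(1) by (simp add: AE_all_countable AE_finite_all)
  then show ?thesis
  proof eventually_elim
    fix \<omega> assume *: "\<forall>q. \<forall>r\<in>Jq q. convergent (\<lambda>R. \<Sum>m\<in>freq_cube R \<inter> cls q r. acoef m * \<xi> \<omega> m)"
    show "\<forall>q. \<forall>r\<in>Jq q. Fd q (ufield s (\<xi> \<omega>)) r = complex_of_real (sqrt (Gw q s r) * Zc q r \<omega>)"
    proof (intro allI ballI)
      fix q and r :: "'d \<Rightarrow> int" assume r: "r \<in> Jq q"
      have "Fd q (ufield s (\<xi> \<omega>)) r = complex_of_real (Uc q r \<omega>)"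
        using * by (intro Fd_ufield[OF _ r]) (simp add: Uc_def acoef_def convergent_LIMSEQ_iff)
      then show "Fd q (ufield s (\<xi> \<omega>)) r = complex_of_real (sqrt (Gw q s r) * Zc q r \<omega>)"
        using Gw_pos[OF s_gt r] by (simp add: Zc_def)
    qed
  qed
qed

text \<open>The squares have mean 1, so the weighted sum has mean at most \<open>b q\<close>, and
  Markov's inequality applies.\<close>

lemma whp_weighted_squares:
  assumes "\<forall>\<^sub>F q in sequentially. (\<forall>r\<in>Jq q. 0 \<le> c q r) \<and> (\<Sum>r\<in>Jq q. c q r) \<le> b q \<and> 0 < B q"
    and "(\<lambda>q. b q / B q) \<longlonglongrightarrow> 0"
  shows "whp M (\<lambda>q \<omega>. (\<Sum>r\<in>Jq q. c q r * (Zc q r \<omega>)\<^sup>2) < B q)"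
proof -
  define X where "X q \<omega> = (\<Sum>r\<in>Jq q. \<bar>c q r\<bar> * (Zc q r \<omega>)\<^sup>2)" for q \<omega>
  have "whp M (\<lambda>q \<omega>. X q \<omega> < B q)"
  proof (rule whp_markov[OF _ assms(2)])
    show "\<forall>\<^sub>F q in sequentially. integrable M (X q) \<and> (\<forall>\<omega>. 0 \<le> X q \<omega>) \<and> expectation (X q) \<le> b q \<and> B q > 0"
      using assms(1)
    proof eventually_elim
      case q: (elim q)
      have int: "integrable M (\<lambda>\<omega>. \<bar>c q r\<bar> * (Zc q r \<omega>)\<^sup>2)" if "r \<in> Jq q" for r
        using Zc_law(1)[OF that that] by simp
      have "expectation (X q) = (\<Sum>r\<in>Jq q. expectation (\<lambda>\<omega>. \<bar>c q r\<bar> * (Zc q r \<omega>)\<^sup>2))"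
        unfolding X_def[abs_def] using int by (rule Bochner_Integration.integral_sum)
      also have "\<dots> = (\<Sum>r\<in>Jq q. c q r)"
        using q Zc_law(2) by (intro sum.cong refl) auto
      finally show ?case
        using q int by (auto simp: X_def[abs_def] intro!: sum_nonneg)
    qed
  qed
  then show ?thesis
  proof (rule whp_mono)
    show "\<forall>\<^sub>F q in sequentially. \<forall>\<omega>\<in>space M. X q \<omega> < B q \<longrightarrow> (\<Sum>r\<in>Jq q. c q r * (Zc q r \<omega>)\<^sup>2) < B q"
      using assms(1)
    proof eventually_elim
      case q: (elim q)
      then have "(\<Sum>r\<in>Jq q. c q r * (Zc q r \<omega>)\<^sup>2) = X q \<omega>" for \<omega>
        unfolding X_def by (intro sum.cong) auto
      then show ?case by simp
    qed
  qed
qed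

end

section \<open>Distinguished residue classes\<close>

text \<open>The window from N/8 to 3N/8 is chosen so that each class in it and its translate by N/2,
  lying between 5N/8 and 7N/8, have high frequency, the two blocks are disjoint, and a fixed
  proportion 4^(-d) of all classes is caught.\<close>

definition mid :: "nat \<Rightarrow> ('d::finite \<Rightarrow> int) set" where
  "mid q = {r. \<forall>i. 2 ^ q \<le> 8 * r i \<and> 8 * r i < 3 * 2 ^ q}"

text \<open>The translate is a different class modulo N in the same class modulo N/2, so the coarse
  grid cannot tell the two apart.\<close>

definition opp :: "nat \<Rightarrow> ('d::finite \<Rightarrow> int) \<Rightarrow> ('d \<Rightarrow> int)" where
  "opp q r = (\<lambda>i. r i + 2 ^ (q - 1))"

text \<open>Of the classes modulo N above a class modulo N/2, the one of lowest frequency: a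
  coordinate below N/4 is kept, any other is moved to the last quarter, where it stands for a
  negative frequency of size at most N/4.\<close>

definition lift_res :: "nat \<Rightarrow> ('d::finite \<Rightarrow> int) \<Rightarrow> ('d \<Rightarrow> int)" where
  "lift_res q r = (\<lambda>i. if 4 * r i < 2 ^ q then r i else r i + 2 ^ (q - 1))"

lemma two_power_8: "q \<ge> 3 \<Longrightarrow> (2::'a::semiring_1) ^ q = 8 * 2 ^ (q - 3)"
  using power_add[of "2::'a" 3 "q - 3"] by simp

lemma two_power_2: "q \<ge> 1 \<Longrightarrow> (2::'a::semiring_1) ^ q = 2 * 2 ^ (q - 1)"
  using power_add[of "2::'a" 1 "q - 1"] by simp

lemma mid_subset: "mid q \<subseteq> Jq q"
proof
  fix r :: "'a \<Rightarrow> int" assume "r \<in> mid q"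
  then have "2 ^ q \<le> 8 * r i" "8 * r i < 3 * 2 ^ q" for i by (auto simp: mid_def)
  moreover have "(0::int) < 2 ^ q" by simp
  ultimately show "r \<in> Jq q" unfolding Jq_def
    by (smt (verit) mem_Collect_eq)
qed

lemma finite_mid [simp]: "finite (mid q)"
  using mid_subset by (rule finite_subset) simp

lemma card_mid:
  assumes "q \<ge> 3"
  shows "real (card (mid q :: ('d::finite \<Rightarrow> int) set)) = (2 ^ q) ^ CARD('d) / 4 ^ CARD('d)"
proof -
  let ?h = "2 ^ (q - 3) :: int"
  have "(mid q :: ('d \<Rightarrow> int) set) = Pi\<^sub>E UNIV (\<lambda>_. {?h..<3 * ?h})"
    unfolding mid_def two_power_8[OF assms] by (auto simp: PiE_iff)
  then have "card (mid q :: ('d \<Rightarrow> int) set) = nat (2 * ?h) ^ CARD('d)"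
    by (simp add: card_PiE)
  then have "real (card (mid q :: ('d \<Rightarrow> int) set)) = (2 * 2 ^ (q - 3)) ^ CARD('d)"
    by (simp add: nat_mult_distrib nat_power_eq)
  also have "\<dots> = (2 ^ q / 4) ^ CARD('d)" unfolding two_power_8[OF assms] by simp
  finally show ?thesis by (simp add: power_divide)
qed

lemma res_opp: "q \<ge> 1 \<Longrightarrow> res (q - 1) (opp q r) = res (q - 1) r"
  by (simp add: res_def opp_def)

lemma inj_opp: "inj_on (opp q) A"
  by (auto simp: inj_on_def opp_def fun_eq_iff)

lemma opp_mid:
  assumes "q \<ge> 3" "r \<in> mid q"
  shows "opp q r \<in> Jq q" "opp q r \<notin> mid q" "(2 ^ q)\<^sup>2 / 4 \<le> ww q (opp q r)" "(2 ^ q)\<^sup>2 / 4 \<le> ww q r"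
proof -
  have r: "2 ^ q \<le> 8 * r i" "8 * r i < 3 * 2 ^ q" for i using assms(2) by (auto simp: mid_def)
  have p: "(2::int) ^ q = 2 * 2 ^ (q - 1)" using assms(1) by (intro two_power_2) simp
  have pos: "(0::int) < 2 ^ (q - 1)" by simp
  show J: "opp q r \<in> Jq q"
    unfolding Jq_def opp_def mem_Collect_eq
  proof
    fix i show "0 \<le> r i + 2 ^ (q - 1) \<and> r i + 2 ^ (q - 1) < 2 ^ q"
      using r[of i] p pos by linarith
  qed
  have o: "2 ^ q \<le> 8 * opp q r i" "8 * opp q r i \<le> 7 * 2 ^ q" "\<not> 8 * opp q r i < 3 * 2 ^ q" for i
    using r[of i] p pos by (auto simp: opp_def)
  then show "opp q r \<notin> mid q" by (auto simp: mid_def)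
  show "(2 ^ q)\<^sup>2 / 4 \<le> ww q (opp q r)" using o by (intro ww_ge_of_coord[OF J]) auto
  have "8 * r undefined \<le> 7 * 2 ^ q" using r(2)[of undefined] p pos by linarith
  then show "(2 ^ q)\<^sup>2 / 4 \<le> ww q r"
    using r mid_subset assms(2) by (intro ww_ge_of_coord[of r q undefined]) auto
qed

text \<open>The class of (1,...,1) carries a frequency that does not depend on q, while its partner
  under \<open>opp\<close> has high frequency. It yields lower bounds free of q: for the
  denominator, and for the leading coefficient in the numerator at small t.\<close>

lemma ones:
  assumes "q \<ge> 3"
  shows "(\<lambda>_::'d::finite. 1) \<in> Jq q" "ww q (\<lambda>_::'d. 1) = 4 * pi\<^sup>2 * real CARD('d)"
    "opp q (\<lambda>_::'d. 1) \<in> Jq q" "(2 ^ q)\<^sup>2 / 4 \<le> ww q (opp q (\<lambda>_::'d. 1))" "opp q (\<lambda>_::'d. 1) \<noteq> (\<lambda>_. 1)"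
proof -
  have p: "(2::int) ^ q = 8 * 2 ^ (q - 3)" "(2::int) ^ (q - 1) = 4 * 2 ^ (q - 3)"
    using two_power_8[OF assms, where 'a = int] two_power_2[of q, where 'a = int] assms by auto
  have pos: "(1::int) \<le> 2 ^ (q - 3)" by simp
  have b: "(2::int) < 2 ^ q" "(1::int) + 2 ^ (q - 1) < 2 ^ q"
    "(2::int) ^ q \<le> 8 * (1 + 2 ^ (q - 1))" "8 * (1 + (2::int) ^ (q - 1)) \<le> 7 * 2 ^ q"
  proof -
    have "2 < A \<and> 1 + B < A \<and> A \<le> 8 * (1 + B) \<and> 8 * (1 + B) \<le> 7 * A"
      if "A = 8 * h" "B = 4 * h" "1 \<le> h" for A B h :: int
      using that by auto
    from this[OF p pos] show "(2::int) < 2 ^ q" "(1::int) + 2 ^ (q - 1) < 2 ^ q"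
      "(2::int) ^ q \<le> 8 * (1 + 2 ^ (q - 1))" "8 * (1 + (2::int) ^ (q - 1)) \<le> 7 * 2 ^ q" by blast+
  qed
  show "(\<lambda>_::'d. 1) \<in> Jq q" unfolding Jq_def using b(1) by simp
  have "rep q (\<lambda>_::'d. 1) = (\<lambda>_. 1)"
    unfolding rep_def symres_def using b(1) by (simp add: fun_eq_iff)
  then show "ww q (\<lambda>_::'d::finite. 1) = 4 * pi\<^sup>2 * real CARD('d)"
    by (simp add: ww_def sqn_def)
  show J: "opp q (\<lambda>_::'d. 1) \<in> Jq q" unfolding Jq_def opp_def using b(2) by simp
  show "(2 ^ q)\<^sup>2 / 4 \<le> ww q (opp q (\<lambda>_::'d. 1))"
    by (rule ww_ge_of_coord[OF J, of undefined]) (unfold opp_def, rule b(3), rule b(4))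
  show "opp q (\<lambda>_::'d. 1) \<noteq> (\<lambda>_. 1)" by (auto simp: opp_def fun_eq_iff)
qed

lemma lift_res_in:
  assumes "q \<ge> 3" "r \<in> Jq (q - 1)"
  shows "lift_res q r \<in> Jq q" "res (q - 1) (lift_res q r) = r"
proof -
  have r: "0 \<le> r i" "r i < 2 ^ (q - 1)" for i using assms(2) by (auto simp: Jq_def)
  have p: "(2::int) ^ q = 2 * 2 ^ (q - 1)" using assms(1) by (intro two_power_2) simp
  show "lift_res q r \<in> Jq q"
    unfolding Jq_def lift_res_def mem_Collect_eq
  proof
    fix i show "0 \<le> (if 4 * r i < 2 ^ q then r i else r i + 2 ^ (q - 1)) \<and> (if 4 * r i < 2 ^ q then r i else r i + 2 ^ (q - 1)) < 2 ^ q"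
      using r[of i] p by auto
  qed
  show "res (q - 1) (lift_res q r) = r"
    using r by (auto simp: res_def lift_res_def fun_eq_iff)
qed

text \<open>Disagreement with the lift in some coordinate means that this coordinate lies between
  N/4 and 3N/4, away from the multiples of N. So every class of a fibre except possibly the lift has
  high frequency.\<close>

lemma ww_ge_not_lift:
  assumes "q \<ge> 3" "r \<in> Jq q" "r \<noteq> lift_res q (res (q - 1) r)"
  shows "(2 ^ q)\<^sup>2 / 4 \<le> ww q r"
proof -
  let ?h = "2 ^ (q - 1) :: int"
  have p: "(2::int) ^ q = 2 * ?h" using assms(1) by (intro two_power_2) simp
  obtain i where i: "r i \<noteq> lift_res q (res (q - 1) r) i" using assms(3) by (auto simp: fun_eq_iff)
  have r: "0 \<le> r i" "r i < 2 * ?h" using assms(2) p by (auto simp: Jq_def)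
  have cases: "(r i < ?h \<and> r i mod ?h = r i) \<or> (?h \<le> r i \<and> r i mod ?h = r i - ?h)"
  proof (cases "r i < ?h")
    case False
    then have "(r i - ?h) mod ?h = r i - ?h" using r by (intro mod_pos_pos_trivial) auto
    moreover have "(r i - ?h) mod ?h = r i mod ?h" by simp
    ultimately show ?thesis using False by auto
  qed (use r in auto)
  have "2 ^ q \<le> 8 * r i \<and> 8 * r i \<le> 7 * 2 ^ q"
    using i cases r p unfolding lift_res_def res_def by (auto split: if_splits)
  then show ?thesis using ww_ge_of_coord[OF assms(2)] by blast
qed

lemma card_res_fibre:
  assumes "q \<ge> 1"
  shows "card {r\<in>Jq q. res (q - 1) r = (r' :: 'd::finite \<Rightarrow> int)} \<le> 2 ^ CARD('d)"
proof -
  let ?h = "2 ^ (q - 1) :: int"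
  have p: "(2::int) ^ q = 2 * ?h" using assms by (rule two_power_2)
  have "{r\<in>Jq q. res (q - 1) r = r'} \<subseteq> Pi\<^sub>E UNIV (\<lambda>i. {r' i, r' i + ?h})"
  proof (rule subsetI)
    fix r assume "r \<in> {r\<in>Jq q. res (q - 1) r = r'}"
    then have r: "r \<in> Jq q" and r': "r' = res (q - 1) r" by auto
    have "r i \<in> {res (q - 1) r i, res (q - 1) r i + ?h}" for i
    proof -
      have b: "0 \<le> r i" "r i < 2 * ?h" using r p by (auto simp: Jq_def)
      show "r i \<in> {res (q - 1) r i, res (q - 1) r i + ?h}"
      proof (cases "r i < ?h")
        case False
        then have "(r i - ?h) mod ?h = r i - ?h" using b by (intro mod_pos_pos_trivial) auto
        moreover have "(r i - ?h) mod ?h = r i mod ?h" by simp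
        ultimately show ?thesis by (simp add: res_def)
      qed (use b in \<open>simp add: res_def\<close>)
    qed
    then show "r \<in> Pi\<^sub>E UNIV (\<lambda>i. {r' i, r' i + ?h})" unfolding r' by (simp add: PiE_iff)
  qed
  then have "card {r\<in>Jq q. res (q - 1) r = r'} \<le> card (Pi\<^sub>E UNIV (\<lambda>i. {r' i, r' i + ?h}))"
    by (intro card_mono finite_PiE) auto
  also have "\<dots> = 2 ^ CARD('d)" by (simp add: card_PiE numeral_2_eq_2)
  finally show ?thesis .
qed

section \<open>Elementary inequalities for powers, pairs and weighted means\<close>

lemma powr_band:
  fixes N w c u B :: real
  assumes "c \<ge> 1" "N > 0" "N\<^sup>2 / 4 \<le> w" "w \<le> c * N\<^sup>2" "\<bar>u\<bar> \<le> B"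
  shows "N powr (2 * u) / (4 * c) powr B \<le> w powr u" "w powr u \<le> (4 * c) powr B * N powr (2 * u)"
proof -
  \<comment> \<open>The ratio w/N^2 lies between 1/4 and c, so its logarithm is at most ln (4c) in
    absolute value; this gives one constant for all exponents of size at most B and for both
    directions.\<close>
  define \<theta> where "\<theta> = w / N\<^sup>2"
  have N2: "N\<^sup>2 > 0" using assms(2) by simp
  have w: "w = N\<^sup>2 * \<theta>" using N2 by (simp add: \<theta>_def)
  have \<theta>: "1 / 4 \<le> \<theta>" "\<theta> \<le> c" using assms(3,4) N2 by (simp_all add: \<theta>_def field_simps)
  have ln0: "ln (4 * c) \<ge> 0" using assms(1) by simp
  have "ln \<theta> \<le> ln (4 * c)" using \<theta> assms(1) by (intro ln_mono) auto
  moreover have "- ln (4 * c) \<le> ln \<theta>"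
  proof -
    have "1 / (4 * c) \<le> 1 / 4" using assms(1) by simp
    then have "1 / (4 * c) \<le> \<theta>" using \<theta>(1) by linarith
    moreover have "0 < 1 / (4 * c)" using assms(1) by simp
    ultimately have "ln (1 / (4 * c)) \<le> ln \<theta>" by (intro ln_mono) auto
    then show ?thesis using assms(1) by (simp add: ln_div)
  qed
  ultimately have "\<bar>ln \<theta>\<bar> \<le> ln (4 * c)" by linarith
  then have "\<bar>u * ln \<theta>\<bar> \<le> B * ln (4 * c)"
    unfolding abs_mult using assms(5) ln0 by (intro mult_mono) auto
  then have e: "exp (- (B * ln (4 * c))) \<le> exp (u * ln \<theta>)" "exp (u * ln \<theta>) \<le> exp (B * ln (4 * c))"
    by auto
  have wp: "w powr u = N powr (2 * u) * exp (u * ln \<theta>)"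
  proof -
    have "w powr u = (N\<^sup>2) powr u * \<theta> powr u" unfolding w by (rule powr_mult)
    also have "(N\<^sup>2) powr u = N powr (2 * u)"
      using assms(2) by (simp add: powr_powr flip: powr_numeral)
    also have "\<theta> powr u = exp (u * ln \<theta>)" using \<theta> by (simp add: powr_def)
    finally show ?thesis .
  qed
  have K: "(4 * c) powr B = exp (B * ln (4 * c))" using assms(1) by (simp add: powr_def)
  show "N powr (2 * u) / (4 * c) powr B \<le> w powr u"
  proof -
    have "N powr (2 * u) * exp (- (B * ln (4 * c))) \<le> w powr u"
      unfolding wp by (rule mult_left_mono[OF e(1)]) simp
    then show ?thesis unfolding K by (simp add: exp_minus divide_inverse)
  qed
  show "w powr u \<le> (4 * c) powr B * N powr (2 * u)"
  proof -
    have "w powr u \<le> N powr (2 * u) * exp (B * ln (4 * c))"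
      unfolding wp by (rule mult_left_mono[OF e(2)]) simp
    then show ?thesis unfolding K by (simp only: mult.commute)
  qed
qed

lemma powr_const_band:
  fixes c u B :: real
  assumes "c \<ge> 1" "\<bar>u\<bar> \<le> B"
  shows "1 / (4 * c) powr B \<le> c powr u" "c powr u \<le> (4 * c) powr B"
  using powr_band[of c 1 c u B] assms by auto

text \<open>Whatever the common centre c, the distances of u and v to it add up to at least the
  distance between u and v. In the application c is the value coming from the coarse grid, which can
  thus remain arbitrary.\<close>

lemma sum_pair_lower:
  fixes u v :: complex and G1 G2 g :: real
  assumes "0 \<le> g" "g \<le> G1" "g \<le> G2"
  shows "g / 2 * (cmod (u - v))\<^sup>2 \<le> G1 * (cmod (u - c))\<^sup>2 + G2 * (cmod (v - c))\<^sup>2"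
proof -
  let ?a = "cmod (u - c)" and ?b = "cmod (v - c)"
  have "cmod (u - v) \<le> ?a + ?b" using norm_triangle_ineq4[of "u - c" "v - c"] by simp
  then have "(cmod (u - v))\<^sup>2 \<le> (?a + ?b)\<^sup>2" by (intro power_mono) auto
  also have "\<dots> \<le> 2 * (?a\<^sup>2 + ?b\<^sup>2)"
    using zero_le_power2[of "?a - ?b"] by (simp add: power2_eq_square algebra_simps)
  finally have "(cmod (u - v))\<^sup>2 \<le> 2 * (?a\<^sup>2 + ?b\<^sup>2)" .
  then have "g / 2 * (cmod (u - v))\<^sup>2 \<le> g / 2 * (2 * (?a\<^sup>2 + ?b\<^sup>2))" using assms by (intro mult_left_mono) auto
  also have "\<dots> = g * ?a\<^sup>2 + g * ?b\<^sup>2" by (simp add: algebra_simps)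
  also have "\<dots> \<le> G1 * ?a\<^sup>2 + G2 * ?b\<^sup>2" using assms by (intro add_mono mult_right_mono) auto
  finally show ?thesis .
qed

text \<open>The weighted deviations from the mean cancel, so moving the centre to b adds (c - b)^2
  times the total weight. In upper bounds the mean over a fibre may thus be replaced by any
  convenient value.\<close>

lemma weighted_mean_minimal:
  fixes g x :: "'i \<Rightarrow> real"
  assumes "finite A" "\<And>i. i \<in> A \<Longrightarrow> 0 \<le> g i" "sum g A > 0" "c = (\<Sum>i\<in>A. g i * x i) / sum g A"
  shows "(\<Sum>i\<in>A. g i * (x i - c)\<^sup>2) \<le> (\<Sum>i\<in>A. g i * (x i - b)\<^sup>2)"
proof -
  have 0: "(\<Sum>i\<in>A. g i * (x i - c)) = 0"
  proof -
    have "(\<Sum>i\<in>A. g i * (x i - c)) = (\<Sum>i\<in>A. g i * x i) - sum g A * c"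
      by (simp add: right_diff_distrib sum_subtractf sum_distrib_right)
    then show ?thesis using assms(3,4) by simp
  qed
  have "(\<Sum>i\<in>A. g i * (x i - b)\<^sup>2) = (\<Sum>i\<in>A. g i * (x i - c)\<^sup>2 + (2 * (c - b)) * (g i * (x i - c)) + (c - b)\<^sup>2 * g i)"
    by (intro sum.cong refl) (simp add: power2_eq_square algebra_simps)
  also have "\<dots> = (\<Sum>i\<in>A. g i * (x i - c)\<^sup>2) + (2 * (c - b)) * (\<Sum>i\<in>A. g i * (x i - c)) + (c - b)\<^sup>2 * sum g A"
    by (simp add: sum.distrib sum_distrib_left)
  finally show ?thesis using 0 assms(3) by simp
qed

section \<open>Empirical Bayes\<close>

lemma hnorm2_interp_normalized:
  fixes f :: "('d::finite \<Rightarrow> real) \<Rightarrow> complex"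
  assumes t: "t > real CARD('d) / 2" and s: "s > real CARD('d) / 2"
    and Fd: "\<And>r. r \<in> Jq q \<Longrightarrow> Fd q f r = complex_of_real (sqrt (Gw q s r) * z r)"
  shows "hnorm2 t (interp t q f) = (\<Sum>r\<in>Jq q. Gw q s r / Gw q t r * (z r)\<^sup>2)"
  unfolding hnorm2_interp[OF t]
proof (intro sum.cong refl)
  fix r :: "'d \<Rightarrow> int" assume r: "r \<in> Jq q"
  have "(cmod (Fd q f r))\<^sup>2 = Gw q s r * (z r)\<^sup>2"
    unfolding Fd[OF r] norm_of_real using Gw_pos[OF s r] by (simp add: power_mult_distrib)
  then show "(cmod (Fd q f r))\<^sup>2 / Gw q t r = Gw q s r / Gw q t r * (z r)\<^sup>2" by simp
qed

text \<open>Everything reduces to the two-sided comparison of G with w^(-t). The simple ratio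
  governs the norms, the ratio with G(t,r) squared governs the normalised coefficients in the Kernel
  Flow numerator.\<close>

lemma Gw_ratio:
  fixes r :: "'d::finite \<Rightarrow> int"
  assumes a: "real CARD('d) / 2 < a" and s: "a \<le> s" "s \<le> T" and t: "a \<le> t" "t \<le> T" and r: "r \<in> Jq q"
  defines "C \<equiv> Gconst TYPE('d) a T"
  shows Gw_ratio_ge: "ww q r powr (t - s) / C \<le> Gw q s r / Gw q t r"
    and Gw_ratio_le: "Gw q s r / Gw q t r \<le> C * ww q r powr (t - s)"
    and Gw_ratio2_ge: "ww q r powr (2 * t - s) / C\<^sup>2 \<le> Gw q s r / (Gw q t r)\<^sup>2"
    and Gw_ratio2_le: "Gw q s r / (Gw q t r)\<^sup>2 \<le> C * ww q r powr (2 * t - s)"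
    and ln_Gw_ratio_ge: "(s - t) * ln (ww q r) - ln C \<le> ln (Gw q t r) - ln (Gw q s r)"
proof -
  let ?w = "ww q r"
  have w: "?w \<ge> 1" by (rule ww_ge_1[OF r])
  have C: "C \<ge> 1" unfolding C_def by (rule Gconst_ge_1)
  have Gs: "?w powr (- s) \<le> Gw q s r" "Gw q s r \<le> C * ?w powr (- s)" "Gw q s r > 0"
    unfolding C_def using Gw_ge[of s r q] Gw_le[OF a s r] Gw_pos[of s r q] a s r by auto
  have Gt: "?w powr (- t) \<le> Gw q t r" "Gw q t r \<le> C * ?w powr (- t)" "Gw q t r > 0"
    unfolding C_def using Gw_ge[of t r q] Gw_le[OF a t r] Gw_pos[of t r q] a t r by auto
  have wp: "?w powr (t - s) = ?w powr (- s) / ?w powr (- t)"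
    using w by (simp add: powr_diff[symmetric])
  have wp2: "?w powr (2 * t - s) = ?w powr (- s) / (?w powr (- t))\<^sup>2"
    using w by (simp add: power2_eq_square flip: powr_add powr_diff)
  have p: "?w powr (- s) > 0" "?w powr (- t) > 0" using w by auto
  have Cs: "0 \<le> C * ?w powr (- s)" using C by simp
  have sq: "(?w powr (- t))\<^sup>2 \<le> (Gw q t r)\<^sup>2" "(Gw q t r)\<^sup>2 \<le> (C * ?w powr (- t))\<^sup>2"
    by (rule power_mono[OF Gt(1) less_imp_le[OF p(2)]], rule power_mono[OF Gt(2) less_imp_le[OF Gt(3)]])
  show "?w powr (t - s) / C \<le> Gw q s r / Gw q t r"
    using frac_le[OF less_imp_le[OF Gs(3)] Gs(1) Gt(3) Gt(2)] unfolding wp by (simp add: mult.commute)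
  show "Gw q s r / Gw q t r \<le> C * ?w powr (t - s)"
    using frac_le[OF Cs Gs(2) p(2) Gt(1)] unfolding wp by simp
  show "?w powr (2 * t - s) / C\<^sup>2 \<le> Gw q s r / (Gw q t r)\<^sup>2"
    using frac_le[OF less_imp_le[OF Gs(3)] Gs(1) zero_less_power[OF Gt(3)] sq(2)]
    unfolding wp2 by (simp add: power_mult_distrib mult.commute)
  show "Gw q s r / (Gw q t r)\<^sup>2 \<le> C * ?w powr (2 * t - s)"
    using frac_le[OF Cs Gs(2) zero_less_power[OF p(2)] sq(1)] unfolding wp2 by simp
  have "ln (?w powr (- t)) \<le> ln (Gw q t r)" by (rule ln_mono[OF Gt(1) p(2)])
  moreover have "ln (Gw q s r) \<le> ln (C * ?w powr (- s))" by (rule ln_mono[OF Gs(2,3)])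
  moreover have "ln (C * ?w powr (- s)) = ln C + ln (?w powr (- s))"
    using C p by (intro ln_mult_pos) auto
  moreover have "ln (?w powr (- s)) = - s * ln ?w" "ln (?w powr (- t)) = - t * ln ?w"
    using w by (simp_all add: ln_powr)
  ultimately show "(s - t) * ln ?w - ln C \<le> ln (Gw q t r) - ln (Gw q s r)"
    by (simp add: algebra_simps)
qed

lemma EB_obj_diff:
  fixes f :: "('d::finite \<Rightarrow> real) \<Rightarrow> complex"
  assumes t: "t > real CARD('d) / 2" and s: "s > real CARD('d) / 2"
    and Fd: "\<And>r. r \<in> Jq q \<Longrightarrow> Fd q f r = complex_of_real (sqrt (Gw q s r) * z r)"
  shows "EB_obj f q t - EB_obj f q s = (\<Sum>r\<in>Jq q. Gw q s r / Gw q t r * (z r)\<^sup>2) - (\<Sum>r\<in>Jq q. (z r)\<^sup>2)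
    + (\<Sum>r\<in>(Jq q :: ('d \<Rightarrow> int) set). ln (Gw q t r) - ln (Gw q s r))"
proof -
  have "Gw q s r / Gw q s r = 1" if "r \<in> Jq q" for r :: "'d \<Rightarrow> int"
    using Gw_pos[OF s that] by simp
  then have "(\<Sum>r\<in>Jq q. Gw q s r / Gw q s r * (z r)\<^sup>2) = (\<Sum>r\<in>Jq q. (z r)\<^sup>2)"
    by (intro sum.cong) auto
  then have "hnorm2 s (interp s q f) = (\<Sum>r\<in>Jq q. (z r)\<^sup>2)"
    using hnorm2_interp_normalized[OF s s, of q f z] Fd by simp
  moreover have "hnorm2 t (interp t q f) = (\<Sum>r\<in>Jq q. Gw q s r / Gw q t r * (z r)\<^sup>2)"
    using hnorm2_interp_normalized[OF t s, of q f z] Fd by simp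
  ultimately show ?thesis
    unfolding EB_obj_def ln_det_gram[OF t] ln_det_gram[OF s] sum_subtractf by linarith
qed

text \<open>The nonnegative quadratic term at t is dropped. Since w \<ge> 1, each class has a
  nonnegative logarithmic gain up to the constant ln C, and the classes of \<open>mid\<close> gain
  at least \<epsilon> ln (N^2/4) each.\<close>

lemma EB_below:
  fixes f :: "('d::finite \<Rightarrow> real) \<Rightarrow> complex"
  assumes a: "real CARD('d) / 2 < a" and s: "a \<le> s" "s \<le> T" and t: "a \<le> t" "t \<le> s - \<epsilon>" and q: "q \<ge> 3" and \<epsilon>: "\<epsilon> > 0"
    and Fd: "\<And>r. r \<in> Jq q \<Longrightarrow> Fd q f r = complex_of_real (sqrt (Gw q s r) * z r)"
  shows "(2 ^ q) ^ CARD('d) * (\<epsilon> / 4 ^ CARD('d) * ln ((2 ^ q)\<^sup>2 / 4) - ln (Gconst TYPE('d) a T)) - (\<Sum>r\<in>Jq q. (z r)\<^sup>2)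
    \<le> EB_obj f q t - EB_obj f q s"
proof -
  let ?C = "Gconst TYPE('d) a T" and ?J = "Jq q :: ('d \<Rightarrow> int) set"
  have t': "t > real CARD('d) / 2" "s > real CARD('d) / 2" "t \<le> T" using a s t \<epsilon> by auto
  have q1: "0 < ((2::real) ^ q)\<^sup>2 / 4" by simp
  have "real (card (mid q :: ('d \<Rightarrow> int) set)) * (\<epsilon> * ln ((2 ^ q)\<^sup>2 / 4)) \<le> (\<Sum>r\<in>mid q. (s - t) * ln (ww q (r :: 'd \<Rightarrow> int)))"
  proof (rule sum_bounded_below)
    fix r :: "'d \<Rightarrow> int" assume r: "r \<in> mid q"
    have w: "(2 ^ q)\<^sup>2 / 4 \<le> ww q r" "1 \<le> ww q r" using opp_mid(4)[OF q r] ww_ge_1 mid_subset r by auto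
    have "\<epsilon> * ln ((2 ^ q)\<^sup>2 / 4) \<le> \<epsilon> * ln (ww q r)"
      using w q1 \<epsilon> by (intro mult_left_mono ln_mono) auto
    also have "\<dots> \<le> (s - t) * ln (ww q r)" using t w by (intro mult_right_mono) auto
    finally show "\<epsilon> * ln ((2 ^ q)\<^sup>2 / 4) \<le> (s - t) * ln (ww q r)" .
  qed
  also have "\<dots> \<le> (\<Sum>r\<in>?J. (s - t) * ln (ww q r))"
  proof (rule sum_mono2[OF finite_Jq mid_subset])
    fix r :: "'d \<Rightarrow> int" assume "r \<in> Jq q - mid q"
    then show "0 \<le> (s - t) * ln (ww q r)"
      using t \<epsilon> ww_ge_1[of r q] by (intro mult_nonneg_nonneg ln_ge_zero) auto
  qed
  finally have 1: "real (card (mid q :: ('d \<Rightarrow> int) set)) * (\<epsilon> * ln ((2 ^ q)\<^sup>2 / 4)) \<le> (\<Sum>r\<in>?J. (s - t) * ln (ww q r))" .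
  have "(\<Sum>r\<in>?J. (s - t) * ln (ww q r) - ln ?C) \<le> (\<Sum>r\<in>?J. ln (Gw q t r) - ln (Gw q s r))"
    by (intro sum_mono ln_Gw_ratio_ge[OF a s t(1) t'(3)])
  moreover have "(\<Sum>r\<in>?J. (s - t) * ln (ww q r) - ln ?C) = (\<Sum>r\<in>?J. (s - t) * ln (ww q r)) - (2 ^ q) ^ CARD('d) * ln ?C"
    by (simp add: sum_subtractf card_Jq)
  moreover have "0 \<le> (\<Sum>r\<in>?J. Gw q s r / Gw q t r * (z r)\<^sup>2)"
    using Gw_pos[OF t'(1)] Gw_pos[OF t'(2)] by (intro sum_nonneg mult_nonneg_nonneg divide_nonneg_nonneg) (auto intro: less_imp_le)
  moreover have "EB_obj f q t - EB_obj f q s = (\<Sum>r\<in>?J. Gw q s r / Gw q t r * (z r)\<^sup>2) - (\<Sum>r\<in>?J. (z r)\<^sup>2)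
      + (\<Sum>r\<in>?J. ln (Gw q t r) - ln (Gw q s r))"
    by (rule EB_obj_diff[OF t'(1,2) Fd])
  moreover have "(2 ^ q) ^ CARD('d) * (\<epsilon> / 4 ^ CARD('d) * ln ((2 ^ q)\<^sup>2 / 4) - ln ?C)
      = real (card (mid q :: ('d \<Rightarrow> int) set)) * (\<epsilon> * ln ((2 ^ q)\<^sup>2 / 4)) - (2 ^ q) ^ CARD('d) * ln ?C"
    unfolding card_mid[OF q] by (simp add: right_diff_distrib)
  ultimately show ?thesis using 1 by linarith
qed

text \<open>The quadratic term is kept on \<open>mid\<close> only, where w \<ge> N^2/4 turns the
  distance \<epsilon> into a power of N; the logarithmic loss is at most T ln (4 pi^2 d N^2) + ln C
  per class.\<close>

lemma EB_above:
  fixes f :: "('d::finite \<Rightarrow> real) \<Rightarrow> complex"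
  assumes a: "real CARD('d) / 2 < a" and s: "a \<le> s" "s \<le> T" and t: "s + \<epsilon> \<le> t" "t \<le> T" and q: "q \<ge> 3" and \<epsilon>: "\<epsilon> > 0"
    and Fd: "\<And>r. r \<in> Jq q \<Longrightarrow> Fd q f r = complex_of_real (sqrt (Gw q s r) * z r)"
  shows "((2 ^ q)\<^sup>2 / 4) powr \<epsilon> / Gconst TYPE('d) a T * (\<Sum>r\<in>mid q. (z r)\<^sup>2)
     - (2 ^ q) ^ CARD('d) * (T * ln (4 * pi\<^sup>2 * real CARD('d) * (2 ^ q)\<^sup>2) + ln (Gconst TYPE('d) a T)) - (\<Sum>r\<in>Jq q. (z r)\<^sup>2)
    \<le> EB_obj f q t - EB_obj f q s"
proof -
  let ?C = "Gconst TYPE('d) a T" and ?J = "Jq q :: ('d \<Rightarrow> int) set" and ?W = "4 * pi\<^sup>2 * real CARD('d) * (2 ^ q)\<^sup>2"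
  have C: "?C \<ge> 1" by (rule Gconst_ge_1)
  have t': "t > real CARD('d) / 2" "s > real CARD('d) / 2" "a \<le> t" using a s t \<epsilon> by auto
  have s0: "s \<ge> 0" using t'(2) by (meson divide_nonneg_nonneg less_eq_real_def of_nat_0_le_iff order.trans zero_le_numeral)
  have T0: "T \<ge> 0" using s0 s(2) by linarith
  have pw: "((2 ^ q)\<^sup>2 / 4) powr \<epsilon> \<le> ww q r powr (t - s)" if "r \<in> mid q" for r :: "'d \<Rightarrow> int"
  proof -
    have w: "(2 ^ q)\<^sup>2 / 4 \<le> ww q r" "1 \<le> ww q r" using opp_mid(4)[OF q that] ww_ge_1 mid_subset that by auto
    have "((2 ^ q)\<^sup>2 / 4) powr \<epsilon> \<le> ww q r powr \<epsilon>" using w \<epsilon> by (intro powr_mono2) auto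
    also have "\<dots> \<le> ww q r powr (t - s)" using w t by (intro powr_mono) auto
    finally show ?thesis .
  qed
  have "((2 ^ q)\<^sup>2 / 4) powr \<epsilon> / ?C * (\<Sum>r\<in>(mid q :: ('d \<Rightarrow> int) set). (z r)\<^sup>2)
      = (\<Sum>r\<in>mid q. ((2 ^ q)\<^sup>2 / 4) powr \<epsilon> / ?C * (z r)\<^sup>2)" by (rule sum_distrib_left)
  also have "\<dots> \<le> (\<Sum>r\<in>mid q. Gw q s r / Gw q t r * (z r)\<^sup>2)"
  proof (intro sum_mono mult_right_mono)
    fix r :: "'d \<Rightarrow> int" assume r: "r \<in> mid q"
    have "((2 ^ q)\<^sup>2 / 4) powr \<epsilon> / ?C \<le> ww q r powr (t - s) / ?C"
      using pw[OF r] C by (intro divide_right_mono) auto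
    also have "\<dots> \<le> Gw q s r / Gw q t r"
      using r mid_subset by (intro Gw_ratio_ge[OF a s t'(3) t(2)]) auto
    finally show "((2 ^ q)\<^sup>2 / 4) powr \<epsilon> / ?C \<le> Gw q s r / Gw q t r" .
  qed simp
  also have "\<dots> \<le> (\<Sum>r\<in>?J. Gw q s r / Gw q t r * (z r)\<^sup>2)"
    using Gw_pos[OF t'(1)] Gw_pos[OF t'(2)]
    by (intro sum_mono2[OF finite_Jq mid_subset]) (auto intro!: mult_nonneg_nonneg divide_nonneg_nonneg intro: less_imp_le)
  finally have 1: "((2 ^ q)\<^sup>2 / 4) powr \<epsilon> / ?C * (\<Sum>r\<in>(mid q :: ('d \<Rightarrow> int) set). (z r)\<^sup>2) \<le> (\<Sum>r\<in>?J. Gw q s r / Gw q t r * (z r)\<^sup>2)" .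
  have "- ((2 ^ q) ^ CARD('d) * (T * ln ?W + ln ?C)) = (\<Sum>r\<in>?J. - (T * ln ?W + ln ?C))"
    by (simp add: card_Jq algebra_simps)
  also have "\<dots> \<le> (\<Sum>r\<in>?J. ln (Gw q t r) - ln (Gw q s r))"
  proof (rule sum_mono)
    fix r :: "'d \<Rightarrow> int" assume r: "r \<in> Jq q"
    have w: "1 \<le> ww q r" "ww q r \<le> ?W" using ww_ge_1[OF r] ww_le[OF r] by auto
    have "(t - s) * ln (ww q r) \<le> T * ln ?W"
      using w t s0 T0 by (intro mult_mono ln_mono) auto
    then show "- (T * ln ?W + ln ?C) \<le> ln (Gw q t r) - ln (Gw q s r)"
      using ln_Gw_ratio_ge[OF a s t'(3) t(2) r] by (simp add: algebra_simps)
  qed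
  finally have "- ((2 ^ q) ^ CARD('d) * (T * ln ?W + ln ?C)) \<le> (\<Sum>r\<in>?J. ln (Gw q t r) - ln (Gw q s r))" .
  moreover have "EB_obj f q t - EB_obj f q s = (\<Sum>r\<in>?J. Gw q s r / Gw q t r * (z r)\<^sup>2) - (\<Sum>r\<in>?J. (z r)\<^sup>2)
      + (\<Sum>r\<in>?J. ln (Gw q t r) - ln (Gw q s r))"
    by (rule EB_obj_diff[OF t'(1,2) Fd])
  ultimately show ?thesis using 1 by linarith
qed

section \<open>Empirical Bayes: probabilistic bounds and conclusion\<close>

context gaussian_coefficients
begin

text \<open>The mean is N^d, so the factor q is spare room that lets Markov's inequality take the
  place of a law of large numbers. The logarithmic gain has order q N^d, so a small fixed \<kappa>
  is good enough.\<close>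

lemma whp_sum_squares:
  assumes "\<kappa> > 0"
  shows "whp M (\<lambda>q \<omega>. (\<Sum>r\<in>Jq q. (Zc q r \<omega>)\<^sup>2) < \<kappa> * real q * (2 ^ q) ^ CARD('d))"
proof -
  have "whp M (\<lambda>q \<omega>. (\<Sum>r\<in>Jq q. 1 * (Zc q r \<omega>)\<^sup>2) < \<kappa> * real q * (2 ^ q) ^ CARD('d))"
  proof (rule whp_weighted_squares)
    show "\<forall>\<^sub>F q in sequentially. (\<forall>r\<in>(Jq q :: ('d \<Rightarrow> int) set). (0::real) \<le> 1) \<and>
        (\<Sum>r\<in>(Jq q :: ('d \<Rightarrow> int) set). 1) \<le> real ((2 ^ q) ^ CARD('d)) \<and> 0 < \<kappa> * real q * (2 ^ q) ^ CARD('d)"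
      using eventually_gt_at_top[of 0] by eventually_elim (use assms in \<open>simp add: card_Jq\<close>)
    have "(\<lambda>q. (1 / \<kappa>) / real q) \<longlonglongrightarrow> 0" by real_asymp
    then show "(\<lambda>q. real ((2 ^ q) ^ CARD('d)) / (\<kappa> * real q * (2 ^ q) ^ CARD('d))) \<longlonglongrightarrow> 0"
      by (simp add: field_simps)
  qed
  then show ?thesis by simp
qed

text \<open>A coefficient is at most N^(-\<gamma>) in size with probability at most N^(-\<gamma>).
  By Markov's inequality for the fraction \<open>X q\<close> of such classes, at least half of
  \<open>mid\<close> exceeds this size with high probability. Losing N^(-2\<gamma>) against the true
  order is affordable.\<close>

lemma whp_mid_sum_squares:
  assumes "\<gamma> > 0"
  shows "whp M (\<lambda>q \<omega>. ((2::real) ^ q) powr (- 2 * \<gamma>) * (2 ^ q) ^ CARD('d) / (2 * 4 ^ CARD('d)) \<le> (\<Sum>r\<in>mid q. (Zc q r \<omega>)\<^sup>2))"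
proof -
  define X where "X q \<omega> = (\<Sum>r\<in>mid q. indicator {\<omega>\<in>space M. \<bar>Zc q r \<omega>\<bar> \<le> ((2::real) ^ q) powr (- \<gamma>)} \<omega>) / real (card (mid q :: ('d \<Rightarrow> int) set))" for q \<omega>
  have cpos: "real (card (mid q :: ('d \<Rightarrow> int) set)) > 0" if "q \<ge> 3" for q
    unfolding card_mid[OF that] by simp
  have "whp M (\<lambda>q \<omega>. X q \<omega> < 1 / 2)"
  proof (rule whp_markov)
    show "\<forall>\<^sub>F q in sequentially. integrable M (X q) \<and> (\<forall>\<omega>. 0 \<le> X q \<omega>) \<and> expectation (X q) \<le> ((2::real) ^ q) powr (- \<gamma>) \<and> (1 / 2 :: real) > 0"
      using eventually_ge_at_top[of 3]
    proof eventually_elim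
      case q: (elim q)
      let ?A = "\<lambda>r. {\<omega>\<in>space M. \<bar>Zc q r \<omega>\<bar> \<le> ((2::real) ^ q) powr (- \<gamma>)}"
      have A: "?A r \<in> sets M" "prob (?A r) \<le> ((2::real) ^ q) powr (- \<gamma>)" if "r \<in> mid q" for r
      proof -
        have r: "r \<in> Jq q" using that mid_subset by blast
        note Zc_measurable[OF r, measurable]
        show "?A r \<in> sets M" by measurable
        show "prob (?A r) \<le> ((2::real) ^ q) powr (- \<gamma>)" by (rule Zc_law(4)[OF r r]) simp
      qed
      have int: "integrable M (\<lambda>\<omega>. indicator (?A r) \<omega> :: real)" if "r \<in> mid q" for r
        by (rule integrable_real_indicator[OF A(1)[OF that]]) (simp add: less_top[symmetric])
      have gen: "expectation (indicator A) = prob A" if "A \<in> sets M" for A using that by simp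
      have "expectation (X q) = (\<Sum>r\<in>mid q. expectation (indicator (?A r))) / real (card (mid q :: ('d \<Rightarrow> int) set))"
        unfolding X_def[abs_def] integral_divide_zero
        by (simp only: Bochner_Integration.integral_sum[OF int])
      also have "(\<Sum>r\<in>mid q. expectation (indicator (?A r))) = (\<Sum>r\<in>mid q. prob (?A r))"
      proof (intro sum.cong refl)
        fix r :: "'d \<Rightarrow> int" assume "r \<in> mid q"
        then show "expectation (indicator (?A r)) = prob (?A r)" by (intro gen A(1))
      qed
      also have "(\<Sum>r\<in>mid q. prob (?A r)) / real (card (mid q :: ('d \<Rightarrow> int) set))
          \<le> real (card (mid q :: ('d \<Rightarrow> int) set)) * ((2::real) ^ q) powr (- \<gamma>) / real (card (mid q :: ('d \<Rightarrow> int) set))"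
        by (rule divide_right_mono[OF sum_bounded_above[OF A(2)]]) simp_all
      finally have "expectation (X q) \<le> ((2::real) ^ q) powr (- \<gamma>)"
        by (simp only: nonzero_mult_div_cancel_left[OF less_imp_neq[OF cpos[OF q], symmetric]])
      moreover have "integrable M (X q)"
        unfolding X_def[abs_def] using int by (intro integrable_divide Bochner_Integration.integrable_sum)
      moreover have "\<forall>\<omega>. 0 \<le> X q \<omega>" unfolding X_def by (intro allI divide_nonneg_nonneg sum_nonneg) simp_all
      ultimately show ?case
        by simp
    qed
    show "(\<lambda>q. ((2::real) ^ q) powr (- \<gamma>) / (1 / 2)) \<longlonglongrightarrow> 0"
      using assms by real_asymp
  qed
  then show ?thesis
  proof (rule whp_mono)
    show "\<forall>\<^sub>F q in sequentially. \<forall>\<omega>\<in>space M. X q \<omega> < 1 / 2 \<longrightarrow>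
      ((2::real) ^ q) powr (- 2 * \<gamma>) * (2 ^ q) ^ CARD('d) / (2 * 4 ^ CARD('d)) \<le> (\<Sum>r\<in>mid q. (Zc q r \<omega>)\<^sup>2)"
      using eventually_ge_at_top[of 3]
    proof eventually_elim
      case q: (elim q)
      let ?c = "real (card (mid q :: ('d \<Rightarrow> int) set))" and ?b = "((2::real) ^ q) powr (- \<gamma>)"
      show ?case
      proof (intro ballI impI)
        fix \<omega> assume \<omega>: "\<omega> \<in> space M" "X q \<omega> < 1 / 2"
        let ?I = "\<lambda>r. indicator {\<omega>\<in>space M. \<bar>Zc q r \<omega>\<bar> \<le> ?b} \<omega> :: real"
        have "(\<Sum>r\<in>mid q. ?I r) \<le> ?c / 2"
          using \<omega>(2) cpos[OF q] unfolding X_def by (simp add: field_simps)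
        then have "?b\<^sup>2 * (?c / 2) \<le> ?b\<^sup>2 * (\<Sum>r\<in>mid q. 1 - ?I r)"
          by (intro mult_left_mono) (auto simp: sum_subtractf)
        also have "\<dots> = (\<Sum>r\<in>mid q. ?b\<^sup>2 * (1 - ?I r))" by (rule sum_distrib_left)
        also have "\<dots> \<le> (\<Sum>r\<in>mid q. (Zc q r \<omega>)\<^sup>2)"
        proof (rule sum_mono)
          fix r :: "'d \<Rightarrow> int"
          show "?b\<^sup>2 * (1 - ?I r) \<le> (Zc q r \<omega>)\<^sup>2"
          proof (cases "\<bar>Zc q r \<omega>\<bar> \<le> ?b")
            case False
            then have "?b\<^sup>2 \<le> \<bar>Zc q r \<omega>\<bar>\<^sup>2" by (intro power_mono) auto
            then show ?thesis using False by simp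
          qed (use \<omega>(1) in simp)
        qed
        finally have "?b\<^sup>2 * (?c / 2) \<le> (\<Sum>r\<in>mid q. (Zc q r \<omega>)\<^sup>2)" .
        moreover have "?b\<^sup>2 = ((2::real) ^ q) powr (- 2 * \<gamma>)"
          by (simp add: power2_eq_square flip: powr_add)
        ultimately show "((2::real) ^ q) powr (- 2 * \<gamma>) * (2 ^ q) ^ CARD('d) / (2 * 4 ^ CARD('d)) \<le> (\<Sum>r\<in>mid q. (Zc q r \<omega>)\<^sup>2)"
          unfolding card_mid[OF q] by (simp add: field_simps)
      qed
    qed
  qed
qed

lemma EB_consistent:
  assumes a: "real CARD('d) / 2 < a" and s: "s \<in> {a..T}" and \<epsilon>: "\<epsilon> > 0"
  shows "whp M (\<lambda>q \<omega>. \<forall>t\<in>argmin_set (EB_obj (ufield s (\<xi> \<omega>)) q) {a..T}. \<bar>t - s\<bar> \<le> \<epsilon>)"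
proof -
  let ?C = "Gconst TYPE('d) a T" and ?d = "CARD('d)"
  \<comment> \<open>The logarithmic gain per class, \<epsilon>/4^d ln (N^2/4), equals 2\<kappa>(q -
    1); so \<kappa> q is about half of it, and the other half absorbs the constant.\<close>
  define \<kappa> where "\<kappa> = \<epsilon> * ln 2 / 4 ^ ?d"
  have \<kappa>: "\<kappa> > 0" using \<epsilon> by (simp add: \<kappa>_def)
  have C: "?C \<ge> 1" by (rule Gconst_ge_1)
  define c1 where "c1 = 4 * pi\<^sup>2 * real ?d"
  have c1: "c1 > 0" by (simp add: c1_def)
  have ev1: "\<forall>\<^sub>F q in sequentially. \<kappa> * real q < \<epsilon> / 4 ^ ?d * ln ((2 ^ q)\<^sup>2 / 4) - ln ?C"
  proof -
    have "\<forall>\<^sub>F q in sequentially. \<kappa> * real q < 2 * \<kappa> * (real q - 1) - ln ?C"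
      using \<kappa> by real_asymp
    moreover have "\<epsilon> / 4 ^ ?d * ln ((2 ^ q)\<^sup>2 / 4) = 2 * \<kappa> * (real q - 1)" for q :: nat
    proof -
      have "ln (((2::real) ^ q)\<^sup>2 / 4) = ln ((2 ^ q)\<^sup>2) - ln (2 ^ 2)" by (simp add: ln_div)
      also have "\<dots> = 2 * (real q * ln 2) - 2 * ln 2" by (simp only: ln_realpow of_nat_numeral)
      finally have eq: "ln (((2::real) ^ q)\<^sup>2 / 4) = 2 * (real q * ln 2) - 2 * ln 2" .
      show ?thesis unfolding eq \<kappa>_def by (simp add: field_simps)
    qed
    ultimately show ?thesis by simp
  qed
  \<comment> \<open>With \<gamma> = \<epsilon>/2 the gain of order N^(2\<epsilon>) is reduced by
    N^(-\<epsilon>), and the remaining N^\<epsilon> still beats every multiple of q.\<close>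
  have ev2: "\<forall>\<^sub>F q in sequentially. T * ln (c1 * (2 ^ q)\<^sup>2) + ln ?C + \<kappa> * real q
      < ((2 ^ q)\<^sup>2 / 4) powr \<epsilon> / ?C * (((2::real) ^ q) powr (- 2 * (\<epsilon> / 2)) / (2 * 4 ^ ?d))"
  proof -
    define K where "K = (1 / 4) powr \<epsilon> / ?C / (2 * 4 ^ ?d)"
    have K: "K > 0" using C by (simp add: K_def)
    have "\<forall>\<^sub>F q in sequentially. T * (ln c1 + 2 * (real q * ln 2)) + ln ?C + \<kappa> * real q < K * 2 powr (real q * \<epsilon>)"
      using K \<epsilon> by real_asymp
    moreover have "ln (c1 * (2 ^ q)\<^sup>2) = ln c1 + 2 * (real q * ln 2)" for q :: nat
      using c1 by (simp add: ln_mult_pos ln_realpow)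
    moreover have "((2 ^ q)\<^sup>2 / 4) powr \<epsilon> / ?C * (((2::real) ^ q) powr (- 2 * (\<epsilon> / 2)) / (2 * 4 ^ ?d)) = K * 2 powr (real q * \<epsilon>)" for q :: nat
    proof -
      have "((2 ^ q)\<^sup>2 / 4) powr \<epsilon> = (2 ^ q) powr \<epsilon> * (2 ^ q) powr \<epsilon> * (1 / 4 :: real) powr \<epsilon>"
        by (simp add: powr_mult[symmetric] power2_eq_square)
      moreover have "(2 ^ q) powr \<epsilon> * ((2::real) ^ q) powr (- 2 * (\<epsilon> / 2)) = 1" by (simp flip: powr_add)
      moreover have "((2::real) ^ q) powr \<epsilon> = 2 powr (real q * \<epsilon>)"
        by (simp add: powr_powr flip: powr_realpow)
      ultimately show ?thesis by (simp add: K_def field_simps)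
    qed
    ultimately show ?thesis by simp
  qed
  define P where "P q \<omega> \<longleftrightarrow>
    (\<forall>r\<in>Jq q. Fd q (ufield s (\<xi> \<omega>)) r = complex_of_real (sqrt (Gw q s r) * Zc q r \<omega>)) \<and>
    (\<Sum>r\<in>Jq q. (Zc q r \<omega>)\<^sup>2) < \<kappa> * real q * (2 ^ q) ^ ?d \<and>
    ((2::real) ^ q) powr (- 2 * (\<epsilon> / 2)) * (2 ^ q) ^ ?d / (2 * 4 ^ ?d) \<le> (\<Sum>r\<in>mid q. (Zc q r \<omega>)\<^sup>2)" for q \<omega>
  have "whp M P"
    unfolding P_def using \<epsilon>
    by (intro whp_conj whp_AE[OF AE_Fd] whp_sum_squares[OF \<kappa>] whp_mid_sum_squares) simp
  then show ?thesis
  proof (rule whp_mono)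
    show "\<forall>\<^sub>F q in sequentially. \<forall>\<omega>\<in>space M. P q \<omega> \<longrightarrow>
        (\<forall>t\<in>argmin_set (EB_obj (ufield s (\<xi> \<omega>)) q) {a..T}. \<bar>t - s\<bar> \<le> \<epsilon>)"
      using ev1 ev2 eventually_ge_at_top[of 3]
    proof eventually_elim
      case (elim q)
      note e1 = elim(1) and e2 = elim(2) and q = elim(3)
      let ?n = "(2 ^ q) ^ ?d :: real"
      have n: "?n > 0" by simp
      show ?case
      proof (intro ballI impI)
        fix \<omega> t
        assume P: "P q \<omega>" and tm: "t \<in> argmin_set (EB_obj (ufield s (\<xi> \<omega>)) q) {a..T}"
        from P have S: "(\<Sum>r\<in>Jq q. (Zc q r \<omega>)\<^sup>2) < \<kappa> * real q * ?n"
          and L: "((2::real) ^ q) powr (- 2 * (\<epsilon> / 2)) * ?n / (2 * 4 ^ ?d) \<le> (\<Sum>r\<in>mid q. (Zc q r \<omega>)\<^sup>2)"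
          unfolding P_def by blast+
        have Fd': "Fd q (ufield s (\<xi> \<omega>)) r = complex_of_real (sqrt (Gw q s r) * Zc q r \<omega>)" if "r \<in> Jq q" for r
          using P that unfolding P_def by blast
        have tI: "a \<le> t" "t \<le> T" "EB_obj (ufield s (\<xi> \<omega>)) q t \<le> EB_obj (ufield s (\<xi> \<omega>)) q s"
          using tm s by (auto simp: argmin_set_def)
        have sI: "a \<le> s" "s \<le> T" using s by auto
        have "\<not> t \<le> s - \<epsilon>"
        proof
          assume "t \<le> s - \<epsilon>"
          from EB_below[OF a sI tI(1) this q \<epsilon> Fd']
          have "?n * (\<epsilon> / 4 ^ ?d * ln ((2 ^ q)\<^sup>2 / 4) - ln ?C) - (\<Sum>r\<in>Jq q. (Zc q r \<omega>)\<^sup>2) \<le> 0"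
            using tI(3) by linarith
          moreover have "?n * (\<kappa> * real q) < ?n * (\<epsilon> / 4 ^ ?d * ln ((2 ^ q)\<^sup>2 / 4) - ln ?C)"
            using e1 n by (rule mult_strict_left_mono)
          ultimately show False using S by (simp only: mult.commute[of ?n "\<kappa> * real q"])
        qed
        moreover have "\<not> s + \<epsilon> \<le> t"
        proof
          assume "s + \<epsilon> \<le> t"
          from EB_above[OF a sI this tI(2) q \<epsilon> Fd']
          have "((2 ^ q)\<^sup>2 / 4) powr \<epsilon> / ?C * (\<Sum>r\<in>mid q. (Zc q r \<omega>)\<^sup>2)
              - ?n * (T * ln (c1 * (2 ^ q)\<^sup>2) + ln ?C) - (\<Sum>r\<in>Jq q. (Zc q r \<omega>)\<^sup>2) \<le> 0"
            using tI(3) unfolding c1_def by linarith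
          moreover have "((2 ^ q)\<^sup>2 / 4) powr \<epsilon> / ?C * (((2::real) ^ q) powr (- 2 * (\<epsilon> / 2)) * ?n / (2 * 4 ^ ?d))
              \<le> ((2 ^ q)\<^sup>2 / 4) powr \<epsilon> / ?C * (\<Sum>r\<in>mid q. (Zc q r \<omega>)\<^sup>2)"
            using L C by (intro mult_left_mono) auto
          moreover have "?n * (T * ln (c1 * (2 ^ q)\<^sup>2) + ln ?C + \<kappa> * real q)
              < ?n * (((2 ^ q)\<^sup>2 / 4) powr \<epsilon> / ?C * (((2::real) ^ q) powr (- 2 * (\<epsilon> / 2)) / (2 * 4 ^ ?d)))"
            using e2 n by (rule mult_strict_left_mono)
          ultimately show False using S by (simp add: algebra_simps)
        qed
        ultimately show "\<bar>t - s\<bar> \<le> \<epsilon>" by linarith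
      qed
    qed
  qed
qed

end

section \<open>Kernel Flow\<close>

text \<open>The Kernel Flow estimates are deterministic: one sample on one grid, with normalised
  coefficients z. T has to dominate s and the values of t, so it may exceed the end of the search
  interval.\<close>

locale grid_sample =
  fixes f :: "('d::finite \<Rightarrow> real) \<Rightarrow> complex" and z :: "('d \<Rightarrow> int) \<Rightarrow> real" and q :: nat and a s T :: real
  assumes a: "real CARD('d) / 2 < a" and s: "a \<le> s" "s \<le> T" and q: "q \<ge> 3"
    and Fd: "\<And>r. r \<in> Jq q \<Longrightarrow> Fd q f r = complex_of_real (sqrt (Gw q s r) * z r)"
begin

definition NN :: real where "NN = 2 ^ q"
definition cc :: real where "cc = 4 * pi\<^sup>2 * real CARD('d)"
text \<open>The price of replacing w by N^2 in a power whose exponent has size at most 2T, a range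
  that contains 2t - s.\<close>

definition KK :: real where "KK = (4 * cc) powr (2 * T)"
definition CC :: real where "CC = Gconst TYPE('d) a T"
text \<open>The class factor of the fine interpolant: its Fourier coefficient at m is
  \<open>lam t m\<close> times this number at the residue of m.\<close>

definition xx :: "real \<Rightarrow> ('d \<Rightarrow> int) \<Rightarrow> real" where "xx t r = sqrt (Gw q s r) * z r / Gw q t r"
definition num :: "real \<Rightarrow> real" where "num t = hnorm2 t (\<lambda>y. interp t q f y - interp t (q - 1) f y)"
definition den :: "real \<Rightarrow> real" where "den t = hnorm2 t (interp t q f)"

lemma KF_obj_eq: "KF_obj f q t = num t / den t"
  by (simp add: KF_obj_def num_def den_def)

lemma NN_ge: "NN \<ge> 8"
  using two_power_8[OF q, where 'a = real] by (simp add: NN_def)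

lemma NN_pos: "NN > 0" using NN_ge by linarith

lemma cc_ge: "cc \<ge> 1"
proof -
  have "real CARD('d) \<ge> 1" by (simp add: Suc_leI)
  then show ?thesis unfolding cc_def using mult_mono[of 1 "4 * pi\<^sup>2" 1 "real CARD('d)"] pi_sq_ge by simp
qed

lemma T_pos: "T > 0"
proof -
  have "0 \<le> real CARD('d) / 2" by simp
  then show ?thesis using a s by linarith
qed

lemma KK_ge: "KK \<ge> 1"
  unfolding KK_def using cc_ge T_pos by (intro ge_one_powr_ge_zero) auto

lemma CC_ge: "CC \<ge> 1"
  unfolding CC_def by (rule Gconst_ge_1)

lemma KC_pos: "KK > 0" "CC > 0" using KK_ge CC_ge by auto

lemma ww_le': "(r :: 'd \<Rightarrow> int) \<in> Jq q \<Longrightarrow> ww q r \<le> cc * NN\<^sup>2"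
  unfolding cc_def NN_def by (rule ww_le)

lemma band:
  assumes "NN\<^sup>2 / 4 \<le> w" "w \<le> cc * NN\<^sup>2" "\<bar>u\<bar> \<le> 2 * T"
  shows "NN powr (2 * u) / KK \<le> w powr u" "w powr u \<le> KK * NN powr (2 * u)"
  unfolding KK_def by (rule powr_band[OF cc_ge NN_pos assms])+

lemma top_band:
  assumes "\<bar>u\<bar> \<le> 2 * T"
  shows "NN powr (2 * u) / KK \<le> (cc * NN\<^sup>2) powr u" "(cc * NN\<^sup>2) powr u \<le> KK * NN powr (2 * u)"
proof -
  have "NN\<^sup>2 / 4 \<le> cc * NN\<^sup>2" using mult_right_mono[OF cc_ge, of "NN\<^sup>2"] zero_le_power2[of NN] by linarith
  then show "NN powr (2 * u) / KK \<le> (cc * NN\<^sup>2) powr u" "(cc * NN\<^sup>2) powr u \<le> KK * NN powr (2 * u)"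
    using band[of "cc * NN\<^sup>2" u] assms by auto
qed

lemma Gpos: "a \<le> t \<Longrightarrow> (r :: 'd \<Rightarrow> int) \<in> Jq q \<Longrightarrow> Gw q t r > 0"
  using a by (intro Gw_pos) auto

text \<open>Since w is at most \<open>cc\<close> times N^2, even the smallest weight w^(-t) is of
  order N^(-2t).\<close>

lemma G_lower:
  assumes "a \<le> t" "t \<le> T" "(r :: 'd \<Rightarrow> int) \<in> Jq q"
  shows "NN powr (- 2 * t) / KK \<le> Gw q t r"
proof -
  have t: "t > 0" using assms(1) a by (smt (verit) divide_nonneg_nonneg of_nat_0_le_iff)
  have "NN powr (2 * (- t)) / KK \<le> (cc * NN\<^sup>2) powr (- t)" using assms t by (intro top_band) auto
  also have "\<dots> \<le> ww q r powr (- t)"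
    using ww_le'[OF assms(3)] ww_ge_1[OF assms(3)] t by (intro powr_mono2') auto
  also have "\<dots> \<le> Gw q t r" using assms a by (intro Gw_ge) auto
  finally show ?thesis by simp
qed

lemma xx_sq: "a \<le> t \<Longrightarrow> r \<in> Jq q \<Longrightarrow> (xx t r)\<^sup>2 = Gw q s r / (Gw q t r)\<^sup>2 * (z r)\<^sup>2"
  using Gpos[OF s(1), of r] by (simp add: xx_def power_mult_distrib power_divide)

lemma xx_sq_ge:
  assumes "a \<le> t" "t \<le> T" "r \<in> Jq q"
  shows "ww q r powr (2 * t - s) / CC\<^sup>2 * (z r)\<^sup>2 \<le> (xx t r)\<^sup>2"
  unfolding xx_sq[OF assms(1,3)] CC_def
  by (intro mult_right_mono Gw_ratio2_ge[OF a s assms]) simp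

lemma xx_sq_le:
  assumes "a \<le> t" "t \<le> T" "r \<in> Jq q"
  shows "(xx t r)\<^sup>2 \<le> CC * ww q r powr (2 * t - s) * (z r)\<^sup>2"
  unfolding xx_sq[OF assms(1,3)] CC_def
  by (intro mult_right_mono Gw_ratio2_le[OF a s assms]) simp

lemma den_eq: "a \<le> t \<Longrightarrow> den t = (\<Sum>r\<in>Jq q. Gw q s r / Gw q t r * (z r)\<^sup>2)"
  unfolding den_def using a s by (intro hnorm2_interp_normalized Fd) auto

lemma den_le:
  assumes "a \<le> t" "t \<le> T"
  shows "den t \<le> CC * (\<Sum>r\<in>Jq q. ww q r powr (t - s) * (z r)\<^sup>2)"
  unfolding den_eq[OF assms(1)] sum_distrib_left mult.assoc[symmetric] CC_def
  by (intro sum_mono mult_right_mono Gw_ratio_le[OF a s assms]) auto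

lemma den_ge:
  assumes "a \<le> t" "t \<le> T" "r \<in> Jq q"
  shows "ww q r powr (t - s) / CC * (z r)\<^sup>2 \<le> den t"
proof -
  have "ww q r powr (t - s) / CC * (z r)\<^sup>2 \<le> Gw q s r / Gw q t r * (z r)\<^sup>2"
    unfolding CC_def by (intro mult_right_mono Gw_ratio_ge[OF a s assms]) simp
  also have "\<dots> \<le> den t"
    unfolding den_eq[OF assms(1)]
  proof (rule member_le_sum[OF assms(3) _ finite_Jq])
    fix r' :: "'d \<Rightarrow> int" assume "r' \<in> Jq q - {r}"
    then show "0 \<le> Gw q s r' / Gw q t r' * (z r')\<^sup>2"
      using Gpos[OF s(1), of r'] Gpos[OF assms(1), of r'] by (intro mult_nonneg_nonneg divide_nonneg_nonneg) auto
  qed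
  finally show ?thesis .
qed

text \<open>The class factor of the coarse interpolant. The name anticipates \<open>mean_eq\<close>:
  coefficients and weights of a coarse class are both sums over its fine classes, which makes this
  factor the G-weighted mean of \<open>xx\<close> over the fibre.\<close>

definition mean :: "real \<Rightarrow> ('d \<Rightarrow> int) \<Rightarrow> complex" where
  "mean t r = Fd (q - 1) f r / Gw (q - 1) t r"

lemma num_eq:
  assumes "a \<le> t"
  shows "num t = (\<Sum>r\<in>Jq q. Gw q t r * (cmod (complex_of_real (xx t r) - mean t (res (q - 1) r)))\<^sup>2)"
proof -
  have t: "t > real CARD('d) / 2" using a assms by linarith
  show ?thesis
    unfolding num_def hnorm2_interp_diff[OF t diff_le_self[of q 1]]
    by (intro sum.cong refl) (simp add: Fd xx_def mean_def)
qed

text \<open>Both members of a pair lie in one coarse class, so the same value is subtracted from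
  them and their two terms are bounded below by their difference; disjoint pairs may be added
  up.\<close>

lemma num_ge_pairs:
  assumes t: "a \<le> t" and A: "A \<subseteq> Jq q" "opp q ` A \<subseteq> Jq q" "A \<inter> opp q ` A = {}" and g: "0 \<le> g"
    "\<And>r :: 'd \<Rightarrow> int. r \<in> Jq q \<Longrightarrow> g \<le> Gw q t r"
  shows "(\<Sum>r\<in>A. g / 2 * (xx t r - xx t (opp q r))\<^sup>2) \<le> num t"
proof -
  let ?F = "\<lambda>r. Gw q t r * (cmod (complex_of_real (xx t r) - mean t (res (q - 1) r)))\<^sup>2"
  have fin: "finite A" using A(1) finite_Jq by (rule finite_subset)
  have "(\<Sum>r\<in>A. g / 2 * (xx t r - xx t (opp q r))\<^sup>2) \<le> (\<Sum>r\<in>A. ?F r + ?F (opp q r))"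
  proof (rule sum_mono)
    fix r assume r: "r \<in> A"
    have "g / 2 * (cmod (complex_of_real (xx t r) - complex_of_real (xx t (opp q r))))\<^sup>2
        \<le> Gw q t r * (cmod (complex_of_real (xx t r) - mean t (res (q - 1) r)))\<^sup>2
          + Gw q t (opp q r) * (cmod (complex_of_real (xx t (opp q r)) - mean t (res (q - 1) r)))\<^sup>2"
      using r A(1,2) by (intro sum_pair_lower[OF g(1) g(2) g(2)]) auto
    moreover have "(cmod (complex_of_real (xx t r) - complex_of_real (xx t (opp q r))))\<^sup>2 = (xx t r - xx t (opp q r))\<^sup>2"
      by (simp flip: of_real_diff)
    moreover have "res (q - 1) (opp q r) = res (q - 1) r" using q by (intro res_opp) simp
    ultimately show "g / 2 * (xx t r - xx t (opp q r))\<^sup>2 \<le> ?F r + ?F (opp q r)" by simp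
  qed
  also have "\<dots> = sum ?F A + sum ?F (opp q ` A)"
    by (simp add: sum.distrib sum.reindex[OF inj_opp])
  also have "\<dots> = sum ?F (A \<union> opp q ` A)"
    using fin A(3) by (intro sum.union_disjoint[symmetric]) auto
  also have "\<dots> \<le> sum ?F (Jq q)"
  proof (rule sum_mono2)
    fix r assume "r \<in> Jq q - (A \<union> opp q ` A)"
    then show "0 \<le> ?F r" using Gpos[OF t, of r] by simp
  qed (use A in auto)
  also have "\<dots> = num t" by (simp add: num_eq[OF t])
  finally show ?thesis .
qed

lemma mean_eq:
  assumes "a \<le> t" "r' \<in> Jq (q - 1)"
  shows "mean t r' = complex_of_real ((\<Sum>r\<in>{r\<in>Jq q. res (q - 1) r = r'}. Gw q t r * xx t r) / (\<Sum>r\<in>{r\<in>Jq q. res (q - 1) r = r'}. Gw q t r))"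
proof -
  have t: "t > real CARD('d) / 2" using a assms(1) by linarith
  have "Fd (q - 1) f r' = (\<Sum>r\<in>{r\<in>Jq q. res (q - 1) r = r'}. Fd q f r)"
    by (rule Fd_coarse[OF diff_le_self assms(2)])
  also have "\<dots> = (\<Sum>r\<in>{r\<in>Jq q. res (q - 1) r = r'}. complex_of_real (Gw q t r * xx t r))"
  proof (intro sum.cong refl)
    fix r assume "r \<in> {r\<in>Jq q. res (q - 1) r = r'}"
    then have r: "r \<in> Jq q" by simp
    show "Fd q f r = complex_of_real (Gw q t r * xx t r)"
      unfolding Fd[OF r] xx_def using Gpos[OF assms(1) r] by simp
  qed
  finally show ?thesis
    unfolding mean_def Gw_coarse[OF t diff_le_self[of q 1]] by simp
qed

text \<open>Within a fibre the weighted mean minimises the weighted sum of squares, so it may be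
  replaced by the value at the lift. That class, the one whose weight G may be large, then
  contributes nothing.\<close>

lemma num_le_lift:
  assumes t: "a \<le> t"
  shows "num t \<le> (\<Sum>r\<in>Jq q. Gw q t r * (xx t r - xx t (lift_res q (res (q - 1) r)))\<^sup>2)"
proof -
  let ?fib = "\<lambda>r'. {r\<in>Jq q. res (q - 1) r = r'}"
  have grp: "(\<Sum>r\<in>Jq q. h r) = (\<Sum>r'\<in>Jq (q - 1). \<Sum>r\<in>?fib r'. h r)" for h :: "('d \<Rightarrow> int) \<Rightarrow> real"
    by (rule sum.group[symmetric]) auto
  have "num t = (\<Sum>r'\<in>Jq (q - 1). \<Sum>r\<in>?fib r'. Gw q t r * (cmod (complex_of_real (xx t r) - mean t (res (q - 1) r)))\<^sup>2)"
    unfolding num_eq[OF t] by (rule grp)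
  also have "\<dots> \<le> (\<Sum>r'\<in>Jq (q - 1). \<Sum>r\<in>?fib r'. Gw q t r * (xx t r - xx t (lift_res q (res (q - 1) r)))\<^sup>2)"
  proof (rule sum_mono)
    fix r' :: "'d \<Rightarrow> int" assume r': "r' \<in> Jq (q - 1)"
    define c where "c = (\<Sum>r\<in>?fib r'. Gw q t r * xx t r) / (\<Sum>r\<in>?fib r'. Gw q t r)"
    have "lift_res q r' \<in> ?fib r'" using lift_res_in[OF q r'] by simp
    then have ne: "?fib r' \<noteq> {}" by blast
    have "(\<Sum>r\<in>?fib r'. Gw q t r * (cmod (complex_of_real (xx t r) - mean t (res (q - 1) r)))\<^sup>2)
        = (\<Sum>r\<in>?fib r'. Gw q t r * (xx t r - c)\<^sup>2)"
    proof (intro sum.cong refl)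
      fix r assume "r \<in> ?fib r'"
      then have "mean t (res (q - 1) r) = complex_of_real c" using mean_eq[OF t r', folded c_def] by simp
      then have "cmod (complex_of_real (xx t r) - mean t (res (q - 1) r)) = \<bar>xx t r - c\<bar>"
        by (simp only: of_real_diff[symmetric] norm_of_real)
      then show "Gw q t r * (cmod (complex_of_real (xx t r) - mean t (res (q - 1) r)))\<^sup>2 = Gw q t r * (xx t r - c)\<^sup>2"
        by (simp only: power2_abs)
    qed
    also have "\<dots> \<le> (\<Sum>r\<in>?fib r'. Gw q t r * (xx t r - xx t (lift_res q r'))\<^sup>2)"
      by (rule weighted_mean_minimal[OF _ _ _ c_def])
        (use Gpos[OF t] ne in \<open>auto intro!: sum_pos less_imp_le\<close>)
    also have "\<dots> = (\<Sum>r\<in>?fib r'. Gw q t r * (xx t r - xx t (lift_res q (res (q - 1) r)))\<^sup>2)"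
      by (intro sum.cong) auto
    finally show "(\<Sum>r\<in>?fib r'. Gw q t r * (cmod (complex_of_real (xx t r) - mean t (res (q - 1) r)))\<^sup>2)
        \<le> (\<Sum>r\<in>?fib r'. Gw q t r * (xx t r - xx t (lift_res q (res (q - 1) r)))\<^sup>2)" .
  qed
  also have "\<dots> = (\<Sum>r\<in>Jq q. Gw q t r * (xx t r - xx t (lift_res q (res (q - 1) r)))\<^sup>2)"
    by (rule grp[symmetric])
  finally show ?thesis .
qed

text \<open>Fibres have at most 2^d members, and distinct coarse classes have distinct
  lifts.\<close>

lemma sum_lift_le:
  fixes h :: "('d \<Rightarrow> int) \<Rightarrow> real"
  assumes "\<And>r. 0 \<le> h r"
  shows "(\<Sum>r\<in>Jq q. h (lift_res q (res (q - 1) r))) \<le> 2 ^ CARD('d) * (\<Sum>r\<in>Jq q. h r)"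
proof -
  let ?fib = "\<lambda>r'. {r\<in>Jq q. res (q - 1) r = r'}"
  have "(\<Sum>r\<in>Jq q. h (lift_res q (res (q - 1) r))) = (\<Sum>r'\<in>Jq (q - 1). \<Sum>r\<in>?fib r'. h (lift_res q (res (q - 1) r)))"
    by (rule sum.group[symmetric]) auto
  also have "\<dots> = (\<Sum>r'\<in>Jq (q - 1). real (card (?fib r')) * h (lift_res q r'))"
    by (intro sum.cong refl) simp
  also have "\<dots> \<le> (\<Sum>r'\<in>Jq (q - 1). 2 ^ CARD('d) * h (lift_res q r'))"
  proof (intro sum_mono mult_right_mono assms)
    fix r' :: "'d \<Rightarrow> int"
    have "card (?fib r') \<le> 2 ^ CARD('d)" using q by (intro card_res_fibre) simp
    then have "real (card (?fib r')) \<le> real (2 ^ CARD('d))" by (simp only: of_nat_le_iff)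
    then show "real (card (?fib r')) \<le> 2 ^ CARD('d)" by simp
  qed
  also have "\<dots> = 2 ^ CARD('d) * (\<Sum>r\<in>lift_res q ` Jq (q - 1). h r)"
  proof -
    have "inj_on (lift_res q) (Jq (q - 1) :: ('d \<Rightarrow> int) set)"
      by (rule inj_on_inverseI[where g = "res (q - 1)"]) (rule lift_res_in(2)[OF q])
    then show ?thesis by (simp add: sum.reindex sum_distrib_left)
  qed
  also have "\<dots> \<le> 2 ^ CARD('d) * (\<Sum>r\<in>Jq q. h r)"
    using lift_res_in(1)[OF q] assms by (intro mult_left_mono sum_mono2) auto
  finally show ?thesis .
qed

text \<open>Only classes other than the lifts contribute, and for these w is comparable with N^2.
  The first term collects the high frequencies themselves, the second the aliasing of the low ones;
  the factors 2 come from (x - b)^2 \<le> 2x^2 + 2b^2.\<close>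

lemma num_le:
  assumes t: "a \<le> t" "t \<le> T"
  shows "num t \<le> 2 * CC * KK * NN powr (2 * (t - s)) * (\<Sum>r\<in>Jq q. (z r)\<^sup>2)
    + 2 * CC * KK * NN powr (- 2 * t) * (2 ^ CARD('d) * (\<Sum>r\<in>Jq q. (xx t r)\<^sup>2))"
proof -
  have t0: "t > 0" "s > 0" using t(1) s(1) a by (smt (verit) divide_nonneg_nonneg of_nat_0_le_iff)+
  have "Gw q t r * (xx t r - xx t (lift_res q (res (q - 1) r)))\<^sup>2
      \<le> 2 * CC * KK * NN powr (2 * (t - s)) * (z r)\<^sup>2 + 2 * CC * KK * NN powr (- 2 * t) * (xx t (lift_res q (res (q - 1) r)))\<^sup>2"
    if r: "r \<in> Jq q" for r
  proof (cases "r = lift_res q (res (q - 1) r)")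
    case True
    then have "Gw q t r * (xx t r - xx t (lift_res q (res (q - 1) r)))\<^sup>2 = 0" by simp
    moreover have "0 \<le> 2 * CC * KK * NN powr (2 * (t - s)) * (z r)\<^sup>2 + 2 * CC * KK * NN powr (- 2 * t) * (xx t (lift_res q (res (q - 1) r)))\<^sup>2"
      using KC_pos by (intro add_nonneg_nonneg mult_nonneg_nonneg) auto
    ultimately show ?thesis by linarith
  next
    case False
    let ?b = "xx t (lift_res q (res (q - 1) r))" and ?G = "Gw q t r" and ?w = "ww q r"
    have w: "NN\<^sup>2 / 4 \<le> ?w" unfolding NN_def by (rule ww_ge_not_lift[OF q r False])
    have G: "?G > 0" by (rule Gpos[OF t(1) r])
    have "(xx t r - ?b)\<^sup>2 \<le> 2 * (xx t r)\<^sup>2 + 2 * ?b\<^sup>2"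
      using zero_le_power2[of "xx t r + ?b"] by (simp add: power2_eq_square algebra_simps)
    then have "?G * (xx t r - ?b)\<^sup>2 \<le> ?G * (2 * (xx t r)\<^sup>2 + 2 * ?b\<^sup>2)"
      using G by (intro mult_left_mono) auto
    also have "\<dots> = 2 * (?G * (xx t r)\<^sup>2) + 2 * (?G * ?b\<^sup>2)" by (simp add: algebra_simps)
    also have "?G * (xx t r)\<^sup>2 = Gw q s r / ?G * (z r)\<^sup>2"
      unfolding xx_sq[OF t(1) r] using G by (simp add: power2_eq_square)
    also have "Gw q s r / ?G * (z r)\<^sup>2 \<le> (CC * (KK * NN powr (2 * (t - s)))) * (z r)\<^sup>2"
    proof (rule mult_right_mono)
      have "Gw q s r / ?G \<le> CC * ?w powr (t - s)" unfolding CC_def by (rule Gw_ratio_le[OF a s t r])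
      also have "\<dots> \<le> CC * (KK * NN powr (2 * (t - s)))"
        using t s t0 KC_pos by (intro mult_left_mono band(2)[OF w ww_le'[OF r]]) auto
      finally show "Gw q s r / ?G \<le> CC * (KK * NN powr (2 * (t - s)))" .
    qed simp
    also have "?G * ?b\<^sup>2 \<le> (CC * (KK * NN powr (2 * (- t)))) * ?b\<^sup>2"
    proof (rule mult_right_mono)
      have "?G \<le> CC * ?w powr (- t)" unfolding CC_def by (rule Gw_le[OF a t r])
      also have "\<dots> \<le> CC * (KK * NN powr (2 * (- t)))"
        using t t0 KC_pos by (intro mult_left_mono band(2)[OF w ww_le'[OF r]]) auto
      finally show "?G \<le> CC * (KK * NN powr (2 * (- t)))" .
    qed simp
    finally show ?thesis by (simp add: mult.assoc)
  qed
  then have "num t \<le> (\<Sum>r\<in>Jq q. 2 * CC * KK * NN powr (2 * (t - s)) * (z r)\<^sup>2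
      + 2 * CC * KK * NN powr (- 2 * t) * (xx t (lift_res q (res (q - 1) r)))\<^sup>2)"
    by (intro order_trans[OF num_le_lift[OF t(1)]] sum_mono)
  also have "\<dots> = 2 * CC * KK * NN powr (2 * (t - s)) * (\<Sum>r\<in>Jq q. (z r)\<^sup>2)
      + 2 * CC * KK * NN powr (- 2 * t) * (\<Sum>r\<in>Jq q. (xx t (lift_res q (res (q - 1) r)))\<^sup>2)"
    by (simp add: sum.distrib sum_distrib_left)
  also have "(\<Sum>r\<in>Jq q. (xx t (lift_res q (res (q - 1) r)))\<^sup>2) \<le> 2 ^ CARD('d) * (\<Sum>r\<in>Jq q. (xx t r)\<^sup>2)"
    by (rule sum_lift_le) simp
  finally show ?thesis using KC_pos by (simp add: mult_left_mono)
qed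

end

section \<open>The Kernel Flow objective at, below and above the target\<close>

context grid_sample
begin

lemma ones_facts:
  shows "(\<lambda>_. 1) \<in> (Jq q :: ('d \<Rightarrow> int) set)" "ww q (\<lambda>_::'d. 1) = cc" "opp q (\<lambda>_::'d. 1) \<in> Jq q"
    "NN\<^sup>2 / 4 \<le> ww q (opp q (\<lambda>_::'d. 1))" "opp q (\<lambda>_::'d. 1) \<noteq> (\<lambda>_. 1)"
  using ones[OF q, where 'd = 'd] by (simp_all add: cc_def NN_def)

lemma cc_band: "\<bar>u\<bar> \<le> 2 * T \<Longrightarrow> 1 / KK \<le> cc powr u"
  unfolding KK_def by (rule powr_const_band(1)[OF cc_ge])

lemma s_pos: "s > 0"
  using s(1) a by (smt (verit) divide_nonneg_nonneg of_nat_0_le_iff)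

text \<open>Here 2\<tau> - s = -d/2 is the border of summability, so the exponent is lowered by
  \<gamma>/2 at the price of N^\<gamma>. Both terms of the numerator then have at most the order
  N^(-2\<tau>+2\<gamma>), the first because 2(\<tau> - s) + d = -2\<tau>. The class of (1,...,1)
  alone keeps the denominator above the order N^(-\<gamma>), which explains the 3\<gamma>.\<close>

lemma KF_at:
  assumes \<tau>: "a \<le> \<tau>" "\<tau> \<le> T" "s = 2 * \<tau> + real CARD('d) / 2" and \<gamma>: "0 < \<gamma>" "\<gamma> \<le> 4 * T"
    and S1: "(\<Sum>r\<in>Jq q. (z r)\<^sup>2) < NN powr (real CARD('d) + \<gamma>)"
    and S2: "(\<Sum>r\<in>Jq q. ww q r powr (- (real CARD('d) / 2) - \<gamma> / 2) * (z r)\<^sup>2) < NN powr \<gamma>"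
    and z1: "NN powr (- \<gamma>) \<le> (z (\<lambda>_. 1))\<^sup>2"
  shows "KF_obj f q \<tau> \<le> (2 * CC * KK + 2 * CC * KK * (2 ^ CARD('d) * (CC * KK))) * (KK * CC) * NN powr (- 2 * \<tau> + 3 * \<gamma>)"
proof -
  let ?d = "real CARD('d)"
  have N1: "NN \<ge> 1" using NN_ge by linarith
  have xs: "(\<Sum>r\<in>Jq q. (xx \<tau> r)\<^sup>2) \<le> CC * KK * NN powr (2 * \<gamma>)"
  proof -
    have "(xx \<tau> r)\<^sup>2 \<le> CC * KK * NN powr \<gamma> * (ww q r powr (- (?d / 2) - \<gamma> / 2) * (z r)\<^sup>2)" if r: "r \<in> Jq q" for r
    proof -
      have w1: "ww q r \<ge> 1" by (rule ww_ge_1[OF r])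
      have "ww q r powr (2 * \<tau> - s) = ww q r powr (- (?d / 2) - \<gamma> / 2) * ww q r powr (\<gamma> / 2)"
        unfolding powr_add[symmetric] using \<tau>(3) by simp
      also have "\<dots> \<le> ww q r powr (- (?d / 2) - \<gamma> / 2) * (KK * NN powr \<gamma>)"
      proof (rule mult_left_mono)
        have "ww q r powr (\<gamma> / 2) \<le> (cc * NN\<^sup>2) powr (\<gamma> / 2)"
          using ww_le'[OF r] w1 \<gamma> by (intro powr_mono2) auto
        also have "\<dots> \<le> KK * NN powr (2 * (\<gamma> / 2))" using \<gamma> by (intro top_band) auto
        finally show "ww q r powr (\<gamma> / 2) \<le> KK * NN powr \<gamma>" by simp
      qed simp
      finally have "CC * ww q r powr (2 * \<tau> - s) * (z r)\<^sup>2 \<le> CC * (ww q r powr (- (?d / 2) - \<gamma> / 2) * (KK * NN powr \<gamma>)) * (z r)\<^sup>2"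
        using KC_pos by (intro mult_right_mono mult_left_mono) auto
      with xx_sq_le[OF \<tau>(1,2) r] show ?thesis by (simp add: mult_ac)
    qed
    then have "(\<Sum>r\<in>Jq q. (xx \<tau> r)\<^sup>2) \<le> CC * KK * NN powr \<gamma> * (\<Sum>r\<in>Jq q. ww q r powr (- (?d / 2) - \<gamma> / 2) * (z r)\<^sup>2)"
      unfolding sum_distrib_left by (rule sum_mono)
    also have "\<dots> \<le> CC * KK * NN powr \<gamma> * NN powr \<gamma>"
      using S2 KC_pos by (intro mult_left_mono) auto
    also have "\<dots> = CC * KK * NN powr (2 * \<gamma>)" by (simp add: mult.assoc flip: powr_add)
    finally show ?thesis .
  qed
  have "num \<tau> \<le> 2 * CC * KK * NN powr (2 * (\<tau> - s)) * NN powr (?d + \<gamma>)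
      + 2 * CC * KK * NN powr (- 2 * \<tau>) * (2 ^ CARD('d) * (CC * KK * NN powr (2 * \<gamma>)))"
    using S1 KC_pos by (intro order_trans[OF num_le[OF \<tau>(1,2)]] add_mono mult_left_mono xs) auto
  also have "NN powr (2 * (\<tau> - s)) * NN powr (?d + \<gamma>) = NN powr (- 2 * \<tau> + \<gamma>)"
    unfolding powr_add[symmetric] using \<tau>(3) by simp
  then have "2 * CC * KK * NN powr (2 * (\<tau> - s)) * NN powr (?d + \<gamma>) = 2 * CC * KK * NN powr (- 2 * \<tau> + \<gamma>)"
    by (simp add: mult.assoc)
  also have "NN powr (- 2 * \<tau> + \<gamma>) \<le> NN powr (- 2 * \<tau> + 2 * \<gamma>)" using N1 \<gamma> by (intro powr_mono) auto
  then have "2 * CC * KK * NN powr (- 2 * \<tau> + \<gamma>) \<le> 2 * CC * KK * NN powr (- 2 * \<tau> + 2 * \<gamma>)"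
    using KC_pos by (intro mult_left_mono) auto
  also have "2 * CC * KK * NN powr (- 2 * \<tau>) * (2 ^ CARD('d) * (CC * KK * NN powr (2 * \<gamma>)))
      = 2 * CC * KK * (2 ^ CARD('d) * (CC * KK)) * NN powr (- 2 * \<tau> + 2 * \<gamma>)"
    unfolding powr_add by (simp only: mult_ac)
  finally have num: "num \<tau> \<le> (2 * CC * KK + 2 * CC * KK * (2 ^ CARD('d) * (CC * KK))) * NN powr (- 2 * \<tau> + 2 * \<gamma>)"
    by (simp add: distrib_right)
  have den: "NN powr (- \<gamma>) / (KK * CC) \<le> den \<tau>"
  proof -
    have "NN powr (- \<gamma>) / (KK * CC) = 1 / KK / CC * NN powr (- \<gamma>)" by simp
    also have "\<dots> \<le> cc powr (\<tau> - s) / CC * (z (\<lambda>_. 1))\<^sup>2"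
      using \<tau> s s_pos KC_pos z1 a by (intro mult_mono divide_right_mono cc_band) auto
    also have "\<dots> \<le> den \<tau>" using den_ge[OF \<tau>(1,2) ones_facts(1)] by (simp add: ones_facts(2))
    finally show ?thesis .
  qed
  have dpos: "0 < NN powr (- \<gamma>) / (KK * CC)" using KC_pos NN_pos by simp
  have "KF_obj f q \<tau> \<le> ((2 * CC * KK + 2 * CC * KK * (2 ^ CARD('d) * (CC * KK))) * NN powr (- 2 * \<tau> + 2 * \<gamma>)) / (NN powr (- \<gamma>) / (KK * CC))"
    unfolding KF_obj_eq using num den dpos KC_pos by (intro frac_le) auto
  also have "\<dots> = (2 * CC * KK + 2 * CC * KK * (2 ^ CARD('d) * (CC * KK))) * (KK * CC) * (NN powr (- 2 * \<tau> + 2 * \<gamma>) / NN powr (- \<gamma>))"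
    by simp
  also have "NN powr (- 2 * \<tau> + 2 * \<gamma>) / NN powr (- \<gamma>) = NN powr (- 2 * \<tau> + 3 * \<gamma>)"
    by (simp flip: powr_diff)
  finally show ?thesis .
qed

text \<open>One pair suffices: the class of (1,...,1) and its partner. For 2t - s \<le> -d/2 the
  partner's coefficient is smaller by about N^(-d/2), so it cannot cancel the other, and the weight
  N^(-2t) gives the order of the numerator. The denominator is bounded through the fixed exponent t1
  - s, so that one random sum serves for all t.\<close>

lemma KF_below:
  assumes t: "a \<le> t" "t \<le> T" "2 * t - s \<le> - (real CARD('d) / 2)" "t \<le> t1" and \<gamma>: "0 < \<gamma>"
    and S: "(\<Sum>r\<in>Jq q. ww q r powr (t1 - s) * (z r)\<^sup>2) < NN powr \<gamma>"
    and z1: "NN powr (- \<gamma>) \<le> (z (\<lambda>_. 1))\<^sup>2" and z2: "(z (opp q (\<lambda>_. 1)))\<^sup>2 < NN powr \<gamma>"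
    and ev: "4 * (CC * KK * NN powr (\<gamma> - real CARD('d))) \<le> NN powr (- \<gamma>) / (KK * CC\<^sup>2)"
  shows "NN powr (- 2 * t - 2 * \<gamma>) / (8 * KK\<^sup>2 * CC ^ 3) \<le> KF_obj f q t"
proof -
  let ?d = "real CARD('d)" and ?o = "\<lambda>_::'d. 1::int"
  have N1: "NN \<ge> 1" using NN_ge by linarith
  have d0: "?d \<ge> 0" by simp
  have t0: "t > 0" using t(1) a d0 by (smt (verit) divide_nonneg_nonneg)
  have x1: "NN powr (- \<gamma>) / (KK * CC\<^sup>2) \<le> (xx t ?o)\<^sup>2"
  proof -
    have "NN powr (- \<gamma>) / (KK * CC\<^sup>2) = 1 / KK / CC\<^sup>2 * NN powr (- \<gamma>)" by simp
    also have "\<dots> \<le> cc powr (2 * t - s) / CC\<^sup>2 * (z ?o)\<^sup>2"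
      using t s s_pos t0 KC_pos z1 by (intro mult_mono divide_right_mono cc_band) auto
    also have "\<dots> \<le> (xx t ?o)\<^sup>2" using xx_sq_ge[OF t(1,2) ones_facts(1)] by (simp add: ones_facts(2))
    finally show ?thesis .
  qed
  have x2: "(xx t (opp q ?o))\<^sup>2 \<le> CC * KK * NN powr (\<gamma> - ?d)"
  proof -
    have "(xx t (opp q ?o))\<^sup>2 \<le> CC * ww q (opp q ?o) powr (2 * t - s) * (z (opp q ?o))\<^sup>2"
      by (rule xx_sq_le[OF t(1,2) ones_facts(3)])
    also have "\<dots> \<le> CC * (KK * NN powr (- ?d)) * NN powr \<gamma>"
    proof (intro mult_mono)
      have "ww q (opp q ?o) powr (2 * t - s) \<le> KK * NN powr (2 * (2 * t - s))"
        using t t0 s s_pos by (intro band(2)[OF ones_facts(4) ww_le'[OF ones_facts(3)]]) auto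
      also have "\<dots> \<le> KK * NN powr (- ?d)"
        using t N1 KC_pos by (intro mult_left_mono powr_mono) auto
      finally show "ww q (opp q ?o) powr (2 * t - s) \<le> KK * NN powr (- ?d)" .
    qed (use KC_pos z2 in auto)
    also have "\<dots> = CC * KK * NN powr (\<gamma> - ?d)" by (simp add: mult.assoc flip: powr_add)
    finally show ?thesis .
  qed
  \<comment> \<open>The factor 4 in \<open>ev\<close> makes the partner at most half as large, so
    the difference is at least half of the leading coefficient.\<close>
  have "4 * (xx t (opp q ?o))\<^sup>2 \<le> (xx t ?o)\<^sup>2" using x1 x2 ev by linarith
  then have "(2 * xx t (opp q ?o))\<^sup>2 \<le> (xx t ?o)\<^sup>2" by (simp add: power_mult_distrib)
  then have "\<bar>2 * xx t (opp q ?o)\<bar> \<le> \<bar>xx t ?o\<bar>" by (simp only: abs_le_square_iff)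
  then have "\<bar>xx t ?o\<bar> \<le> \<bar>2 * (xx t ?o - xx t (opp q ?o))\<bar>"
    using abs_triangle_ineq2[of "xx t ?o" "xx t (opp q ?o)"] by (simp add: abs_mult)
  then have "(xx t ?o)\<^sup>2 \<le> (2 * (xx t ?o - xx t (opp q ?o)))\<^sup>2" by (simp only: abs_le_square_iff)
  then have diff: "(xx t ?o)\<^sup>2 / 4 \<le> (xx t ?o - xx t (opp q ?o))\<^sup>2"
    unfolding power_mult_distrib by simp
  define g where "g = NN powr (- 2 * t) / KK"
  have g0: "g \<ge> 0" using KC_pos by (simp add: g_def)
  have "g / 2 * (NN powr (- \<gamma>) / (KK * CC\<^sup>2) / 4) \<le> g / 2 * (xx t ?o - xx t (opp q ?o))\<^sup>2"
    using x1 diff g0 by (intro mult_left_mono) auto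
  also have "\<dots> = (\<Sum>r\<in>{?o}. g / 2 * (xx t r - xx t (opp q r))\<^sup>2)" by simp
  also have "\<dots> \<le> num t"
    using ones_facts(1,3,5) G_lower[OF t(1,2)] by (intro num_ge_pairs[OF t(1) _ _ _ g0]) (auto simp: g_def)
  finally have num: "g / 2 * (NN powr (- \<gamma>) / (KK * CC\<^sup>2) / 4) \<le> num t" .
  have "den t \<le> CC * (\<Sum>r\<in>Jq q. ww q r powr (t - s) * (z r)\<^sup>2)" by (rule den_le[OF t(1,2)])
  also have "\<dots> \<le> CC * (\<Sum>r\<in>Jq q. ww q r powr (t1 - s) * (z r)\<^sup>2)"
    using KC_pos t(4) ww_ge_1 by (intro mult_left_mono sum_mono mult_right_mono powr_mono) auto
  also have "\<dots> \<le> CC * NN powr \<gamma>" using S KC_pos by (intro mult_left_mono) auto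
  finally have den: "den t \<le> CC * NN powr \<gamma>" .
  have dpos: "den t > 0"
  proof -
    have "0 < NN powr (- \<gamma>)" using NN_pos by simp
    then have "0 < (z ?o)\<^sup>2" using z1 by linarith
    moreover have "0 < cc powr (t - s)" using cc_ge by simp
    ultimately have "0 < cc powr (t - s) / CC * (z ?o)\<^sup>2" using KC_pos by simp
    also have "\<dots> \<le> den t" using den_ge[OF t(1,2) ones_facts(1)] by (simp add: ones_facts(2))
    finally show ?thesis .
  qed
  have "(g / 2 * (NN powr (- \<gamma>) / (KK * CC\<^sup>2) / 4)) / (CC * NN powr \<gamma>) \<le> KF_obj f q t"
    unfolding KF_obj_eq using num den dpos g0 KC_pos by (intro frac_le order_trans[OF _ num]) auto
  also have "(g / 2 * (NN powr (- \<gamma>) / (KK * CC\<^sup>2) / 4)) / (CC * NN powr \<gamma>)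
      = NN powr (- 2 * t - 2 * \<gamma>) / (8 * KK\<^sup>2 * CC ^ 3)"
  proof -
    have "- 2 * t - 2 * \<gamma> = - 2 * t + - \<gamma> - \<gamma>" by simp
    then have "NN powr (- 2 * t - 2 * \<gamma>) = NN powr (- 2 * t) * NN powr (- \<gamma>) / NN powr \<gamma>"
      by (simp only: powr_diff powr_add)
    then show ?thesis by (simp add: g_def power2_eq_square power3_eq_cube mult_ac)
  qed
  finally show ?thesis .
qed

text \<open>The numerator collects of the order of N^d pairs from \<open>mid\<close>, each
  contributing about N^(-2t) N^(2(2t-s)). The denominator may itself grow with t: writing w^(t-s) as
  w^(t-t1) w^(t1-s) and bounding the first factor by a multiple of N^(2(t-t1)) leaves a random sum
  free of t, and the dependence on t cancels in the quotient.\<close>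

lemma KF_above:
  assumes t: "a \<le> t" "t \<le> T" "t1 \<le> t" "0 \<le> t1" and \<gamma>: "0 < \<gamma>"
    and S: "(\<Sum>r\<in>Jq q. ww q r powr (t1 - s) * (z r)\<^sup>2) < NN powr \<gamma>"
    and z1: "NN powr (- \<gamma>) \<le> (z (\<lambda>_. 1))\<^sup>2"
    and good: "1 / 8 * real (card (mid q :: ('d \<Rightarrow> int) set)) / 2 \<le> real (card {r\<in>mid q. 1 / 4 \<le> z r \<and> z (opp q r) \<le> 0})"
  shows "NN powr (2 * t1 - 2 * s + real CARD('d) - \<gamma>) / (512 * 4 ^ CARD('d) * KK ^ 3 * CC ^ 3) \<le> KF_obj f q t"
proof -
  let ?d = "real CARD('d)" and ?o = "\<lambda>_::'d. 1::int" and ?A = "{r\<in>mid q. 1 / 4 \<le> z r \<and> z (opp q r) \<le> 0}"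
  have t0: "t > 0" using t(1) a by (smt (verit) divide_nonneg_nonneg of_nat_0_le_iff)
  define g where "g = NN powr (- 2 * t) / KK"
  have g0: "g \<ge> 0" using KC_pos by (simp add: g_def)
  define h where "h = NN powr (2 * (2 * t - s)) / KK / CC\<^sup>2 * (1 / 16)"
  have h0: "h \<ge> 0" using KC_pos by (simp add: h_def)
  have hx: "h \<le> (xx t r - xx t (opp q r))\<^sup>2" if r: "r \<in> ?A" for r
  proof -
    have rm: "r \<in> mid q" "1 / 4 \<le> z r" "z (opp q r) \<le> 0" using r by auto
    have rJ: "r \<in> Jq q" "opp q r \<in> Jq q" using rm mid_subset opp_mid(1)[OF q] by auto
    have w: "NN\<^sup>2 / 4 \<le> ww q r" unfolding NN_def by (rule opp_mid(4)[OF q rm(1)])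
    have "(1 / 4)\<^sup>2 \<le> (z r)\<^sup>2" using rm(2) by (intro power_mono) auto
    then have "h \<le> ww q r powr (2 * t - s) / CC\<^sup>2 * (z r)\<^sup>2"
      unfolding h_def using t t0 s s_pos KC_pos
      by (intro mult_mono divide_right_mono band(1)[OF w ww_le'[OF rJ(1)]]) (auto simp: power2_eq_square)
    also have "\<dots> \<le> (xx t r)\<^sup>2" by (rule xx_sq_ge[OF t(1,2) rJ(1)])
    also have "\<dots> \<le> (xx t r - xx t (opp q r))\<^sup>2"
    proof (rule power_mono)
      have "xx t (opp q r) \<le> 0"
        unfolding xx_def using rm(3) Gpos[OF t(1) rJ(2)] Gpos[OF s(1) rJ(2)]
        by (intro divide_nonpos_pos mult_nonneg_nonpos) auto
      then show "xx t r \<le> xx t r - xx t (opp q r)" by simp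
      show "0 \<le> xx t r"
        unfolding xx_def using rm(2) Gpos[OF t(1) rJ(1)] Gpos[OF s(1) rJ(1)]
        by (intro divide_nonneg_pos mult_nonneg_nonneg) auto
    qed
    finally show ?thesis .
  qed
  \<comment> \<open>The proportion 1/16 of good pairs, half of the success probability 1/8, times
    the N^d/4^d classes of \<open>mid\<close>.\<close>
  have cA: "NN powr ?d / (16 * 4 ^ CARD('d)) \<le> real (card ?A)"
    using good NN_pos unfolding card_mid[OF q] by (simp add: powr_realpow NN_def)
  have "NN powr ?d / (16 * 4 ^ CARD('d)) * (g / 2 * h) \<le> real (card ?A) * (g / 2 * h)"
    using cA g0 h0 by (intro mult_right_mono) auto
  also have "\<dots> \<le> (\<Sum>r\<in>?A. g / 2 * (xx t r - xx t (opp q r))\<^sup>2)"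
    using hx g0 by (intro sum_bounded_below mult_left_mono) auto
  also have "\<dots> \<le> num t"
  proof (rule num_ge_pairs[OF t(1) _ _ _ g0])
    show "?A \<subseteq> Jq q" using mid_subset by auto
    show "opp q ` ?A \<subseteq> Jq q" using opp_mid(1)[OF q] by auto
    show "?A \<inter> opp q ` ?A = {}" using opp_mid(2)[OF q] by auto
  qed (use G_lower[OF t(1,2)] in \<open>simp add: g_def\<close>)
  finally have num: "NN powr ?d / (16 * 4 ^ CARD('d)) * (g / 2 * h) \<le> num t" .
  have "den t \<le> CC * (\<Sum>r\<in>Jq q. ww q r powr (t - s) * (z r)\<^sup>2)" by (rule den_le[OF t(1,2)])
  also have "\<dots> \<le> CC * (\<Sum>r\<in>Jq q. (KK * NN powr (2 * (t - t1))) * (ww q r powr (t1 - s) * (z r)\<^sup>2))"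
  proof (intro mult_left_mono sum_mono)
    fix r :: "'d \<Rightarrow> int" assume r: "r \<in> Jq q"
    have "ww q r powr (t - s) = ww q r powr (t - t1) * ww q r powr (t1 - s)" by (simp flip: powr_add)
    also have "\<dots> \<le> (KK * NN powr (2 * (t - t1))) * ww q r powr (t1 - s)"
    proof (rule mult_right_mono)
      have "ww q r powr (t - t1) \<le> (cc * NN\<^sup>2) powr (t - t1)"
        using ww_le'[OF r] ww_ge_1[OF r] t by (intro powr_mono2) auto
      also have "\<dots> \<le> KK * NN powr (2 * (t - t1))" using t t0 by (intro top_band) auto
      finally show "ww q r powr (t - t1) \<le> KK * NN powr (2 * (t - t1))" .
    qed simp
    finally show "ww q r powr (t - s) * (z r)\<^sup>2 \<le> (KK * NN powr (2 * (t - t1))) * (ww q r powr (t1 - s) * (z r)\<^sup>2)"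
      by (simp add: mult_right_mono flip: mult.assoc)
  qed (use KC_pos in simp)
  also have "\<dots> = CC * ((KK * NN powr (2 * (t - t1))) * (\<Sum>r\<in>Jq q. ww q r powr (t1 - s) * (z r)\<^sup>2))"
    by (simp add: sum_distrib_left)
  also have "\<dots> \<le> CC * ((KK * NN powr (2 * (t - t1))) * NN powr \<gamma>)"
    using S KC_pos by (intro mult_left_mono) auto
  finally have den: "den t \<le> CC * ((KK * NN powr (2 * (t - t1))) * NN powr \<gamma>)" .
  have dpos: "den t > 0"
  proof -
    have "0 < NN powr (- \<gamma>)" using NN_pos by simp
    then have "0 < (z ?o)\<^sup>2" using z1 by linarith
    moreover have "0 < cc powr (t - s)" using cc_ge by simp
    ultimately have "0 < cc powr (t - s) / CC * (z ?o)\<^sup>2" using KC_pos by simp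
    also have "\<dots> \<le> den t" using den_ge[OF t(1,2) ones_facts(1)] by (simp add: ones_facts(2))
    finally show ?thesis .
  qed
  have num0: "0 \<le> NN powr ?d / (16 * 4 ^ CARD('d)) * (g / 2 * h)" using g0 h0 by simp
  have "(NN powr ?d / (16 * 4 ^ CARD('d)) * (g / 2 * h)) / (CC * ((KK * NN powr (2 * (t - t1))) * NN powr \<gamma>)) \<le> KF_obj f q t"
    unfolding KF_obj_eq by (rule frac_le[OF order_trans[OF num0 num] num dpos den])
  also have "(NN powr ?d / (16 * 4 ^ CARD('d)) * (g / 2 * h)) / (CC * ((KK * NN powr (2 * (t - t1))) * NN powr \<gamma>))
      = NN powr (2 * t1 - 2 * s + ?d - \<gamma>) / (512 * 4 ^ CARD('d) * KK ^ 3 * CC ^ 3)"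
  proof -
    have "NN powr (2 * t1 - 2 * s + ?d - \<gamma>)
        = NN powr ?d * NN powr (- 2 * t) * NN powr (2 * (2 * t - s)) / (NN powr (2 * (t - t1)) * NN powr \<gamma>)"
      by (simp add: algebra_simps flip: powr_add powr_diff)
    then show ?thesis by (simp add: g_def h_def power2_eq_square power3_eq_cube mult_ac)
  qed
  finally show ?thesis .
qed

end

section \<open>Kernel Flow: high-probability events and conclusion\<close>

lemma eventually_powr_less:
  fixes A B p p' :: real
  assumes "B > 0" "p < p'"
  shows "\<forall>\<^sub>F q in sequentially. A * (2 ^ q) powr p < B * (2 ^ q) powr p'"
proof -
  have "p' - p > 0" using assms by simp
  then have "filterlim (\<lambda>q. ((2::real) ^ q) powr (p' - p)) at_top sequentially" by real_asymp
  then have "\<forall>\<^sub>F q in sequentially. A / B < ((2::real) ^ q) powr (p' - p)"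
    by (simp add: filterlim_at_top_dense)
  then show ?thesis
  proof eventually_elim
    case (elim q)
    then have "A < B * (2 ^ q) powr (p' - p)" using assms(1) by (simp add: pos_divide_less_eq mult.commute)
    then have "A * (2 ^ q) powr p < B * (2 ^ q) powr (p' - p) * (2 ^ q) powr p"
      by (intro mult_strict_right_mono) auto
    also have "\<dots> = B * (2 ^ q) powr p'" by (simp add: mult.assoc flip: powr_add)
    finally show ?case .
  qed
qed

lemma tendsto_const_div_powr:
  assumes "\<gamma> > 0" shows "(\<lambda>q. c / ((2::real) ^ q) powr \<gamma>) \<longlonglongrightarrow> 0"
proof -
  have "(\<lambda>q. c * ((2::real) ^ q) powr (- \<gamma>)) \<longlonglongrightarrow> c * 0"
    using assms by (intro tendsto_mult tendsto_const) real_asymp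
  then show ?thesis by (simp add: powr_minus divide_inverse)
qed

context gaussian_coefficients
begin

lemma whp_sum_squares_powr:
  assumes "\<gamma> > 0"
  shows "whp M (\<lambda>q \<omega>. (\<Sum>r\<in>Jq q. (Zc q r \<omega>)\<^sup>2) < ((2::real) ^ q) powr (real CARD('d) + \<gamma>))"
proof -
  have "whp M (\<lambda>q \<omega>. (\<Sum>r\<in>Jq q. 1 * (Zc q r \<omega>)\<^sup>2) < ((2::real) ^ q) powr (real CARD('d) + \<gamma>))"
  proof (rule whp_weighted_squares)
    show "\<forall>\<^sub>F q in sequentially. (\<forall>r\<in>(Jq q :: ('d \<Rightarrow> int) set). (0::real) \<le> 1) \<and>
        (\<Sum>r\<in>(Jq q :: ('d \<Rightarrow> int) set). 1) \<le> ((2::real) ^ q) ^ CARD('d) \<and> 0 < ((2::real) ^ q) powr (real CARD('d) + \<gamma>)"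
      by (intro always_eventually allI) (simp add: card_Jq)
    have "((2::real) ^ q) ^ CARD('d) / (2 ^ q) powr (real CARD('d) + \<gamma>) = 1 / (2 ^ q) powr \<gamma>" for q
      by (simp add: powr_add powr_realpow)
    then show "(\<lambda>q. ((2::real) ^ q) ^ CARD('d) / (2 ^ q) powr (real CARD('d) + \<gamma>)) \<longlonglongrightarrow> 0"
      using tendsto_const_div_powr[OF assms, of 1] by simp
  qed
  then show ?thesis by simp
qed

text \<open>Beyond the exponent d/2 the expectations are bounded uniformly in q, so any positive
  power of N exceeds the sum with high probability.\<close>

lemma whp_ww_sum_squares:
  assumes "p > real CARD('d) / 2" "\<gamma> > 0"
  shows "whp M (\<lambda>q \<omega>. (\<Sum>r\<in>Jq q. ww q r powr (- p) * (Zc q r \<omega>)\<^sup>2) < ((2::real) ^ q) powr \<gamma>)"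
proof (rule whp_weighted_squares[OF _ tendsto_const_div_powr[OF assms(2)]])
  show "\<forall>\<^sub>F q in sequentially. (\<forall>r\<in>(Jq q :: ('d \<Rightarrow> int) set). 0 \<le> ww q r powr (- p)) \<and>
      (\<Sum>r\<in>(Jq q :: ('d \<Rightarrow> int) set). ww q r powr (- p)) \<le> infsum (lam p) (UNIV - {\<lambda>_. 0 :: int} :: ('d \<Rightarrow> int) set) \<and>
      0 < ((2::real) ^ q) powr \<gamma>"
    using sum_ww_powr_le[OF assms(1)] by (intro always_eventually allI conjI ballI) simp_all
qed

text \<open>The bounded density gives a coefficient of size at most N^(-\<gamma>/2) a probability of
  at most N^(-\<gamma>/2), which tends to 0.\<close>

lemma whp_ones_large:
  assumes "\<gamma> > 0"
  shows "whp M (\<lambda>q \<omega>. ((2::real) ^ q) powr (- \<gamma>) \<le> (Zc q (\<lambda>_. 1) \<omega>)\<^sup>2)"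
proof (rule whp_tendsto_0)
  show "(\<lambda>q. ((2::real) ^ q) powr (- (\<gamma> / 2))) \<longlonglongrightarrow> 0"
    unfolding powr_minus_divide using tendsto_const_div_powr[of "\<gamma> / 2" 1] assms by simp
  show "\<forall>\<^sub>F q in sequentially. {\<omega>\<in>space M. \<not> ((2::real) ^ q) powr (- \<gamma>) \<le> (Zc q (\<lambda>_. 1) \<omega>)\<^sup>2} \<in> sets M \<and>
      measure M {\<omega>\<in>space M. \<not> ((2::real) ^ q) powr (- \<gamma>) \<le> (Zc q (\<lambda>_. 1) \<omega>)\<^sup>2} \<le> ((2::real) ^ q) powr (- (\<gamma> / 2))"
    using eventually_ge_at_top[of 3]
  proof eventually_elim
    case q: (elim q)
    note J = ones(1)[OF q, where 'd = 'd]
    note Zc_measurable[OF J, measurable]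
    let ?b = "((2::real) ^ q) powr (- (\<gamma> / 2))"
    have b2: "((2::real) ^ q) powr (- \<gamma>) = ?b\<^sup>2" by (simp add: power2_eq_square flip: powr_add)
    have "prob {\<omega>\<in>space M. \<not> ((2::real) ^ q) powr (- \<gamma>) \<le> (Zc q (\<lambda>_. 1) \<omega>)\<^sup>2} \<le> prob {\<omega>\<in>space M. \<bar>Zc q (\<lambda>_. 1) \<omega>\<bar> \<le> ?b}"
    proof (rule finite_measure_mono)
      show "{\<omega>\<in>space M. \<not> ((2::real) ^ q) powr (- \<gamma>) \<le> (Zc q (\<lambda>_. 1) \<omega>)\<^sup>2} \<subseteq> {\<omega>\<in>space M. \<bar>Zc q (\<lambda>_. 1) \<omega>\<bar> \<le> ?b}"
      proof safe
        fix \<omega> assume "\<not> ((2::real) ^ q) powr (- \<gamma>) \<le> (Zc q (\<lambda>_. 1) \<omega>)\<^sup>2"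
        then have "(Zc q (\<lambda>_. 1) \<omega>)\<^sup>2 \<le> ?b\<^sup>2" unfolding b2 by simp
        then have "\<bar>Zc q (\<lambda>_. 1) \<omega>\<bar> \<le> \<bar>?b\<bar>" by (simp only: abs_le_square_iff)
        then show "\<bar>Zc q (\<lambda>_. 1) \<omega>\<bar> \<le> ?b" by simp
      qed
    qed measurable
    also have "\<dots> \<le> ?b" by (rule Zc_law(4)[OF J J]) simp
    finally show ?case by simp
  qed
qed

lemma whp_opp_ones_small:
  assumes "\<gamma> > 0"
  shows "whp M (\<lambda>q \<omega>. (Zc q (opp q (\<lambda>_. 1)) \<omega>)\<^sup>2 < ((2::real) ^ q) powr \<gamma>)"
proof (rule whp_markov[OF _ tendsto_const_div_powr[OF assms]])
  show "\<forall>\<^sub>F q in sequentially. integrable M (\<lambda>\<omega>. (Zc q (opp q (\<lambda>_. 1)) \<omega>)\<^sup>2) \<and> (\<forall>\<omega>. 0 \<le> (Zc q (opp q (\<lambda>_. 1)) \<omega>)\<^sup>2) \<and>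
      expectation (\<lambda>\<omega>. (Zc q (opp q (\<lambda>_. 1)) \<omega>)\<^sup>2) \<le> 1 \<and> ((2::real) ^ q) powr \<gamma> > 0"
    using eventually_ge_at_top[of 3]
  proof eventually_elim
    case q: (elim q)
    note J = ones(3)[OF q, where 'd = 'd]
    show ?case
      using Zc_law(1,2)[OF J J] by simp
  qed
qed

text \<open>For a pair of coefficients of opposite signs the two normalised coefficients cannot cancel, whatever the
  t-dependent weights: this makes the lower bound for the Kernel Flow numerator uniform in t.\<close>

lemma whp_opposite_signs:
  "whp M (\<lambda>q \<omega>. 1 / 8 * real (card (mid q :: ('d \<Rightarrow> int) set)) / 2
     \<le> real (card {r\<in>mid q. 1 / 4 \<le> Zc q r \<omega> \<and> Zc q (opp q r) \<omega> \<le> 0}))"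
proof (rule whp_tendsto_0)
  let ?c = "\<lambda>q. real (card (mid q :: ('d \<Rightarrow> int) set))"
  have "(\<lambda>q. (256 * 4 ^ CARD('d)) / ((2::real) ^ q) powr (real CARD('d))) \<longlonglongrightarrow> 0"
    by (rule tendsto_const_div_powr) simp
  then have lim: "(\<lambda>q. (256 * 4 ^ CARD('d)) / ((2::real) ^ q) ^ CARD('d)) \<longlonglongrightarrow> 0"
    by (simp add: powr_realpow)
  have "\<forall>\<^sub>F q in sequentially. (256 * 4 ^ CARD('d)) / ((2::real) ^ q) ^ CARD('d) = 4 / ((1 / 8)\<^sup>2 * ?c q)"
    using eventually_ge_at_top[of 3]
  proof eventually_elim
    case (elim q)
    from card_mid[OF this, where 'd = 'd] show ?case
      by (simp add: power2_eq_square)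
  qed
  from Lim_transform_eventually[OF lim this]
  show "(\<lambda>q. 4 / ((1 / 8)\<^sup>2 * ?c q)) \<longlonglongrightarrow> 0" .
  show "\<forall>\<^sub>F q in sequentially.
      {\<omega>\<in>space M. \<not> 1 / 8 * ?c q / 2 \<le> real (card {r\<in>mid q. 1 / 4 \<le> Zc q r \<omega> \<and> Zc q (opp q r) \<omega> \<le> 0})} \<in> sets M \<and>
      measure M {\<omega>\<in>space M. \<not> 1 / 8 * ?c q / 2 \<le> real (card {r\<in>mid q. 1 / 4 \<le> Zc q r \<omega> \<and> Zc q (opp q r) \<omega> \<le> 0})}
        \<le> 4 / ((1 / 8)\<^sup>2 * ?c q)"
    using eventually_ge_at_top[of 3]
  proof eventually_elim
    case q: (elim q)
    let ?E = "{1/4..} \<times> {..0} :: (real \<times> real) set"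
    have J: "r \<in> Jq q" "opp q r \<in> Jq q" "r \<noteq> opp q r" if "r \<in> mid q" for r :: "'d \<Rightarrow> int"
      using that mid_subset opp_mid(1,2)[OF q that] by auto
    have ind: "indep_vars (\<lambda>_. borel \<Otimes>\<^sub>M borel) (\<lambda>r \<omega>. (Zc q r \<omega>, Zc q (opp q r) \<omega>)) (mid q)"
      by (rule indep_vars_pairs[OF indep_Zc[of q] inj_opp]) (use J opp_mid(2)[OF q] in auto)
    have ne: "(mid q :: ('d \<Rightarrow> int) set) \<noteq> {}"
      using card_mid[OF q, where 'd = 'd] by auto
    \<comment> \<open>The two events are independent, with probabilities at least 1/4 and 1/2,
      whence the constant 1/8.\<close>
    have p: "1 / 8 \<le> prob {\<omega>\<in>space M. (Zc q r \<omega>, Zc q (opp q r) \<omega>) \<in> ?E}" if r: "r \<in> mid q" for r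
    proof -
      let ?A = "\<lambda>i. if i = r then {1/4..} else {..0} :: real set"
      have "prob (\<Inter>i\<in>{r, opp q r}. Zc q i -` ?A i \<inter> space M) = (\<Prod>i\<in>{r, opp q r}. prob (Zc q i -` ?A i \<inter> space M))"
        using J[OF r] by (intro indep_varsD[OF indep_Zc[of q]]) auto
      also have "(\<Inter>i\<in>{r, opp q r}. Zc q i -` ?A i \<inter> space M) = {\<omega>\<in>space M. (Zc q r \<omega>, Zc q (opp q r) \<omega>) \<in> ?E}"
        using J(3)[OF r] by auto
      also have "(\<Prod>i\<in>{r, opp q r}. prob (Zc q i -` ?A i \<inter> space M))
          = prob {\<omega>\<in>space M. Zc q r \<omega> \<ge> 1 / 4} * prob {\<omega>\<in>space M. Zc q (opp q r) \<omega> \<le> 0}"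
        using J(3)[OF r] by (simp add: vimage_def Int_def conj_commute)
      finally show ?thesis
        using mult_mono[OF Zc_law(6)[OF J(1)[OF r] J(1)[OF r]] Zc_law(5)[OF J(2)[OF r] J(2)[OF r]]] by simp
    qed
    have E: "?E \<in> sets (borel \<Otimes>\<^sub>M borel)" by simp
    have "(0::real) < 1 / 8" by simp
    note few = prob_few_successes[OF ind finite_mid ne E p this]
    have eq: "{r\<in>mid q. (Zc q r \<omega>, Zc q (opp q r) \<omega>) \<in> ?E} = {r\<in>mid q. 1 / 4 \<le> Zc q r \<omega> \<and> Zc q (opp q r) \<omega> \<le> 0}" for \<omega>
      by auto
    show ?case
      using few unfolding eq by blast
  qed
qed

text \<open>What remains is a comparison of exponents. With \<gamma> = \<epsilon>/4 the value at the
  target has exponent at most -2\<tau> + 3\<epsilon>/4, while the lower bounds have at least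
  -2\<tau> + 3\<epsilon>/2 to the left and -2\<tau> + 7\<epsilon>/4 to the right.\<close>

lemma KF_consistent:
  assumes a: "real CARD('d) / 2 < a" and \<tau>: "\<tau> \<in> {a..T0}" "s = 2 * \<tau> + real CARD('d) / 2"
    and \<epsilon>: "0 < \<epsilon>" "\<epsilon> < \<tau>" "\<epsilon> < 1"
  shows "whp M (\<lambda>q \<omega>. \<forall>t\<in>argmin_set (KF_obj (ufield s (\<xi> \<omega>)) q) {a..T0}. \<bar>t - \<tau>\<bar> \<le> \<epsilon>)"
proof -
  let ?d = "real CARD('d)"
  \<comment> \<open>s = 2\<tau> + d/2 may lie beyond the search interval, whereas the comparison of
    G(s,r) with powers of w asks for s \<le> T.\<close>
  define T where "T = max T0 s"
  define C where "C = Gconst TYPE('d) a T"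
  define K where "K = (4 * (4 * pi\<^sup>2 * ?d)) powr (2 * T)"
  define \<gamma> where "\<gamma> = \<epsilon> / 4"
  \<comment> \<open>s - t1 = d/2 + \<tau> - \<epsilon> exceeds d/2 because \<epsilon> < \<tau>, so
    the weights w^(t1-s) have bounded sums; the same random sum controls the denominator on both
    sides of the target.\<close>
  define t1 where "t1 = \<tau> + \<epsilon>"
  define A where "A = (2 * C * K + 2 * C * K * (2 ^ CARD('d) * (C * K))) * (K * C)"
  have d1: "?d \<ge> 1" by (simp add: Suc_leI)
  have C: "C > 0" unfolding C_def using Gconst_ge_1[of a T, where 'd = 'd] by linarith
  have K: "K > 0" using d1 by (simp add: K_def)
  have \<gamma>: "0 < \<gamma>" "\<gamma> < 1 / 4" using \<epsilon> by (auto simp: \<gamma>_def)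
  have aT: "a \<le> \<tau>" "\<tau> \<le> T0" "T0 \<le> T" "s \<le> T" using \<tau> by (auto simp: T_def)
  have as: "a \<le> s" using aT a d1 \<tau>(2) by linarith
  \<comment> \<open>\<gamma> < 1/4 and d \<ge> 1 give \<gamma> - d < -\<gamma>, which makes the
    partner of the class (1,...,1) negligible.\<close>
  have ev1: "\<forall>\<^sub>F q in sequentially. 4 * (C * K) * (2 ^ q) powr (\<gamma> - ?d) < 1 / (K * C\<^sup>2) * (2 ^ q) powr (- \<gamma>)"
  proof (rule eventually_powr_less)
    show "\<gamma> - ?d < - \<gamma>" using \<gamma> d1 by linarith
  qed (use K C in simp)
  have ev2: "\<forall>\<^sub>F q in sequentially. A * (2 ^ q) powr (- 2 * \<tau> + 3 * \<gamma>) < 1 / (8 * K\<^sup>2 * C ^ 3) * (2 ^ q) powr (- 2 * \<tau> + 2 * \<epsilon> - 2 * \<gamma>)"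
    using \<epsilon> K C by (intro eventually_powr_less) (auto simp: \<gamma>_def)
  have ev3: "\<forall>\<^sub>F q in sequentially. A * (2 ^ q) powr (- 2 * \<tau> + 3 * \<gamma>)
      < 1 / (512 * 4 ^ CARD('d) * K ^ 3 * C ^ 3) * (2 ^ q) powr (2 * t1 - 2 * s + ?d - \<gamma>)"
    using \<epsilon> K C \<tau>(2) by (intro eventually_powr_less) (auto simp: \<gamma>_def t1_def)
  define P where "P q \<omega> \<longleftrightarrow>
    (\<forall>r\<in>Jq q. Fd q (ufield s (\<xi> \<omega>)) r = complex_of_real (sqrt (Gw q s r) * Zc q r \<omega>)) \<and>
    (\<Sum>r\<in>Jq q. (Zc q r \<omega>)\<^sup>2) < (2 ^ q) powr (?d + \<gamma>) \<and>
    (\<Sum>r\<in>Jq q. ww q r powr (- (?d / 2 + \<gamma> / 2)) * (Zc q r \<omega>)\<^sup>2) < (2 ^ q) powr \<gamma> \<and>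
    (\<Sum>r\<in>Jq q. ww q r powr (- (s - t1)) * (Zc q r \<omega>)\<^sup>2) < (2 ^ q) powr \<gamma> \<and>
    (2 ^ q) powr (- \<gamma>) \<le> (Zc q (\<lambda>_. 1) \<omega>)\<^sup>2 \<and>
    (Zc q (opp q (\<lambda>_. 1)) \<omega>)\<^sup>2 < (2 ^ q) powr \<gamma> \<and>
    1 / 8 * real (card (mid q :: ('d \<Rightarrow> int) set)) / 2 \<le> real (card {r\<in>mid q. 1 / 4 \<le> Zc q r \<omega> \<and> Zc q (opp q r) \<omega> \<le> 0})" for q \<omega>
  have "whp M P"
    unfolding P_def
    by (intro whp_conj whp_AE[OF AE_Fd] whp_sum_squares_powr whp_ww_sum_squares whp_ones_large whp_opp_ones_small
        whp_opposite_signs) (use \<gamma> \<epsilon> \<tau>(2) in \<open>auto simp: t1_def\<close>)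
  then show ?thesis
  proof (rule whp_mono)
    show "\<forall>\<^sub>F q in sequentially. \<forall>\<omega>\<in>space M. P q \<omega> \<longrightarrow>
        (\<forall>t\<in>argmin_set (KF_obj (ufield s (\<xi> \<omega>)) q) {a..T0}. \<bar>t - \<tau>\<bar> \<le> \<epsilon>)"
      using ev1 ev2 ev3 eventually_ge_at_top[of 3]
    proof eventually_elim
      case (elim q)
      note e1 = elim(1) and e2 = elim(2) and e3 = elim(3) and q = elim(4)
      show ?case
      proof (intro ballI impI)
        fix \<omega> t assume P: "P q \<omega>" and tm: "t \<in> argmin_set (KF_obj (ufield s (\<xi> \<omega>)) q) {a..T0}"
        let ?f = "ufield s (\<xi> \<omega>)"
        interpret G: grid_sample ?f "\<lambda>r. Zc q r \<omega>" q a s T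
          using a as aT(4) q P by unfold_locales (auto simp: P_def)
        have cst: "G.NN = 2 ^ q" "G.CC = C" "G.KK = K"
          by (simp_all add: G.NN_def G.CC_def G.KK_def G.cc_def C_def K_def)
        have tI: "a \<le> t" "t \<le> T0" "t \<le> T" "KF_obj ?f q t \<le> KF_obj ?f q \<tau>"
          using tm \<tau>(1) aT by (auto simp: argmin_set_def)
        have S5: "(\<Sum>r\<in>Jq q. ww q r powr (t1 - s) * (Zc q r \<omega>)\<^sup>2) < (2 ^ q) powr \<gamma>"
          using P unfolding P_def minus_diff_eq by blast
        have at: "KF_obj ?f q \<tau> \<le> A * (2 ^ q) powr (- 2 * \<tau> + 3 * \<gamma>)"
          unfolding A_def
        proof (rule G.KF_at[unfolded cst, OF aT(1) _ \<tau>(2) \<gamma>(1)])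
          show "\<tau> \<le> T" using aT by linarith
          show "\<gamma> \<le> 4 * T" using \<gamma>(2) aT as a d1 by linarith
          show "(\<Sum>r\<in>Jq q. ww q r powr (- (?d / 2) - \<gamma> / 2) * (Zc q r \<omega>)\<^sup>2) < (2 ^ q) powr \<gamma>"
            using P unfolding P_def minus_add_distrib diff_conv_add_uminus by blast
        qed (use P in \<open>auto simp: P_def\<close>)
        have "\<not> t < \<tau> - \<epsilon>"
        proof
          assume lt: "t < \<tau> - \<epsilon>"
          have "(2 ^ q) powr (- 2 * t - 2 * \<gamma>) / (8 * K\<^sup>2 * C ^ 3) \<le> KF_obj ?f q t"
          proof (rule G.KF_below[unfolded cst, OF tI(1,3) _ _ \<gamma>(1) S5])
            show "2 * t - s \<le> - (?d / 2)" using lt \<tau>(2) \<epsilon>(1) by linarith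
            show "t \<le> t1" using lt \<epsilon>(1) by (simp add: t1_def)
            show "4 * (C * K * (2 ^ q) powr (\<gamma> - ?d)) \<le> (2 ^ q) powr (- \<gamma>) / (K * C\<^sup>2)"
              using e1 by (simp add: mult.assoc)
          qed (use P in \<open>auto simp: P_def\<close>)
          moreover have "(2 ^ q) powr (- 2 * \<tau> + 2 * \<epsilon> - 2 * \<gamma>) / (8 * K\<^sup>2 * C ^ 3) \<le> (2 ^ q) powr (- 2 * t - 2 * \<gamma>) / (8 * K\<^sup>2 * C ^ 3)"
            using lt K C by (intro divide_right_mono powr_mono) auto
          ultimately show False using at e2 tI(4) by simp
        qed
        moreover have "\<not> t > \<tau> + \<epsilon>"
        proof
          assume gt: "t > \<tau> + \<epsilon>"
          have "(2 ^ q) powr (2 * t1 - 2 * s + ?d - \<gamma>) / (512 * 4 ^ CARD('d) * K ^ 3 * C ^ 3) \<le> KF_obj ?f q t"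
          proof (rule G.KF_above[unfolded cst, OF tI(1,3) _ _ \<gamma>(1) S5])
            show "t1 \<le> t" using gt by (simp add: t1_def)
            show "0 \<le> t1" using \<epsilon> by (simp add: t1_def)
          qed (use P in \<open>auto simp: P_def\<close>)
          then show False using at e3 tI(4) by simp
        qed
        ultimately show "\<bar>t - \<tau>\<bar> \<le> \<epsilon>" by linarith
      qed
    qed
  qed
qed

end

theorem theorem2p1:
  fixes M :: "'w measure" and \<xi> :: "'w \<Rightarrow> ('d::finite \<Rightarrow> int) \<Rightarrow> real"
    and \<delta> s :: real
  assumes "prob_space M"
    and "\<And>m. m \<noteq> (\<lambda>_. 0) \<Longrightarrow> distributed M lborel (\<lambda>\<omega>. \<xi> \<omega> m) std_normal_density"
    and "prob_space.indep_vars M (\<lambda>_. borel) (\<lambda>m \<omega>. \<xi> \<omega> m) (UNIV - {\<lambda>_. 0})"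
    and "\<delta> > 0"
  shows "(s \<in> {real CARD('d) / 2 + \<delta> .. 1 / \<delta>} \<longrightarrow>
           argmin_conv_prob M
             (\<lambda>q \<omega>. argmin_set (EB_obj (ufield s (\<xi> \<omega>)) q) {real CARD('d) / 2 + \<delta> .. 1 / \<delta>}) s) \<and>
         ((s - real CARD('d) / 2) / 2 \<in> {real CARD('d) / 2 + \<delta> .. 1 / \<delta>} \<longrightarrow>
           argmin_conv_prob M
             (\<lambda>q \<omega>. argmin_set (KF_obj (ufield s (\<xi> \<omega>)) q) {real CARD('d) / 2 + \<delta> .. 1 / \<delta>})
             ((s - real CARD('d) / 2) / 2))"
proof -
  let ?d = "real CARD('d)"
  have a: "?d / 2 < ?d / 2 + \<delta>" using assms(4) by simp
  have coeffs: "gaussian_coefficients M \<xi> s" if "s > ?d / 2"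
    using assms(1-3) that by (simp add: gaussian_coefficients_def gaussian_coefficients_axioms_def)
  show ?thesis
  proof (intro conjI impI)
    assume s: "s \<in> {?d / 2 + \<delta> .. 1 / \<delta>}"
    interpret gaussian_coefficients M \<xi> s using s assms(4) by (intro coeffs) auto
    show "argmin_conv_prob M (\<lambda>q \<omega>. argmin_set (EB_obj (ufield s (\<xi> \<omega>)) q) {?d / 2 + \<delta> .. 1 / \<delta>}) s"
      by (rule argmin_conv_probI[where bnd = 1]) (auto intro: EB_consistent[OF a s])
  next
    assume \<tau>: "(s - ?d / 2) / 2 \<in> {?d / 2 + \<delta> .. 1 / \<delta>}"
    define \<tau> where "\<tau> = (s - ?d / 2) / 2"
    have s: "s = 2 * \<tau> + ?d / 2" by (simp add: \<tau>_def field_simps)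
    have \<tau>I: "\<tau> \<in> {?d / 2 + \<delta> .. 1 / \<delta>}" using \<tau> by (simp add: \<tau>_def)
    have "0 \<le> ?d / 2" by simp
    then have \<tau>0: "\<tau> > 0" using \<tau>I assms(4) unfolding atLeastAtMost_iff by linarith
    \<comment> \<open>s exceeds d/2 because \<tau> is positive, as the search interval lies to the
      right of d/2.\<close>
    then interpret gaussian_coefficients M \<xi> s by (intro coeffs) (simp add: s)
    have "argmin_conv_prob M (\<lambda>q \<omega>. argmin_set (KF_obj (ufield s (\<xi> \<omega>)) q) {?d / 2 + \<delta> .. 1 / \<delta>}) \<tau>"
      by (rule argmin_conv_probI[where bnd = "min \<tau> 1"]) (use \<tau>0 in \<open>auto intro: KF_consistent[OF a \<tau>I s]\<close>)
    then show "argmin_conv_prob M (\<lambda>q \<omega>. argmin_set (KF_obj (ufield s (\<xi> \<omega>)) q) {?d / 2 + \<delta> .. 1 / \<delta>}) ((s - ?d / 2) / 2)"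
      unfolding \<tau>_def .
  qed
qed

end
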